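(* Let $G$ be a connected $K_{1,5}$-free graph with $n$ vertices. If $\sigma_5(G)\geq n-1$, then $G$ contains a spanning tree with at most $4$ leaves.
   Context: All graphs are finite and simple. For a vertex $v$, $d(v)$ denotes its degree in $G$. For $k\geq 1$, $\sigma_k(G)=\min\{\sum_{i=1}^k d(v_i) : \{v_1,\ldots,v_k\}$ is an independent set of $k$ vertices in $G\}$. A graph is $K_{1,r}$-free if it does not contain $K_{1,r}$ as an induced subgraph. A leaf of a tree is a vertex of degree one in the tree. *)

theory Defs
  imports Main
begin

definition simple_graph :: "'a set \<Rightarrow> 'a set set \<Rightarrow> bool" where
  "simple_graph V E \<longleftrightarrow> finite V \<and>
     (\<forall>e\<in>E. \<exists>u v. e = {u, v} \<and> u \<noteq> v \<and> u \<in> V \<and> v \<in> V)"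

definition adj :: "'a set set \<Rightarrow> 'a \<Rightarrow> 'a \<Rightarrow> bool" where
  "adj E u v \<longleftrightarrow> {u, v} \<in> E"

definition deg :: "'a set \<Rightarrow> 'a set set \<Rightarrow> 'a \<Rightarrow> nat" where
  "deg V E v = card {u\<in>V. adj E u v}"

definition is_walk :: "'a set \<Rightarrow> 'a set set \<Rightarrow> 'a list \<Rightarrow> bool" where
  "is_walk V E xs \<longleftrightarrow> xs \<noteq> [] \<and> set xs \<subseteq> V \<and>
     (\<forall>i. Suc i < length xs \<longrightarrow> adj E (xs ! i) (xs ! Suc i))"

definition connected_graph :: "'a set \<Rightarrow> 'a set set \<Rightarrow> bool" where
  "connected_graph V E \<longleftrightarrow> V \<noteq> {} \<and>
     (\<forall>u\<in>V. \<forall>v\<in>V. \<exists>xs. is_walk V E xs \<and> hd xs = u \<and> last xs = v)"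

definition has_cycle :: "'a set \<Rightarrow> 'a set set \<Rightarrow> bool" where
  "has_cycle V E \<longleftrightarrow> (\<exists>xs. is_walk V E xs \<and> length xs \<ge> 3 \<and> distinct xs \<and>
       adj E (last xs) (hd xs))"

definition is_tree :: "'a set \<Rightarrow> 'a set set \<Rightarrow> bool" where
  "is_tree V T \<longleftrightarrow> simple_graph V T \<and> connected_graph V T \<and> \<not> has_cycle V T"

definition spanning_tree :: "'a set \<Rightarrow> 'a set set \<Rightarrow> 'a set set \<Rightarrow> bool" where
  "spanning_tree V E T \<longleftrightarrow> T \<subseteq> E \<and> is_tree V T"

definition leaves :: "'a set \<Rightarrow> 'a set set \<Rightarrow> 'a set" where
  "leaves V T = {v\<in>V. deg V T v = 1}"

definition independent :: "'a set set \<Rightarrow> 'a set \<Rightarrow> bool" where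
  "independent E S \<longleftrightarrow> (\<forall>u\<in>S. \<forall>v\<in>S. \<not> adj E u v)"

definition K1r_free :: "nat \<Rightarrow> 'a set \<Rightarrow> 'a set set \<Rightarrow> bool" where
  "K1r_free r V E \<longleftrightarrow> \<not> (\<exists>c\<in>V. \<exists>S\<subseteq>V. card S = r \<and> c \<notin> S \<and>
       (\<forall>s\<in>S. adj E c s) \<and> independent E S)"

text \<open>sigma_k(G) \<ge> m, with the convention (min over the empty set = +\<infinity>)
  that the condition holds vacuously if G has no independent k-set.\<close>
definition sigma_ge :: "nat \<Rightarrow> 'a set \<Rightarrow> 'a set set \<Rightarrow> nat \<Rightarrow> bool" where
  "sigma_ge k V E m \<longleftrightarrow> (\<forall>S\<subseteq>V. card S = k \<and> independent E S \<longrightarrow>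
       (\<Sum>v\<in>S. deg V E v) \<ge> m)"

end

theory Submission
  imports Defs
begin

text \<open>
  Among the trees of \<open>G\<close> with at most five leaves take one on a largest vertex set \<open>W\<close>. If it is not
  a spanning tree with at most four leaves, then every tree of \<open>G\<close> on \<open>W\<close> has at least five leaves,
  and the leaves of a five-leaf tree \<open>T\<close> on \<open>W\<close> are independent with all their neighbours in \<open>W\<close>.
  It remains to choose \<open>T\<close> such that the leaf degrees sum to at most \<open>|W| - 2\<close>.

  The basic move is a rotation: if a leaf \<open>u\<close> lies on the \<open>y\<close>-side of a tree edge \<open>yz\<close> and is adjacent
  to \<open>z\<close>, then exchanging \<open>yz\<close> for \<open>uz\<close> shows that \<open>y\<close> has degree two and becomes a leaf in place of
  \<open>u\<close>, so no other leaf is adjacent to \<open>y\<close>. Call the path from a leaf to the nearest branch vertex a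
  leg. Rotations together with \<open>K\<^sub>1\<^sub>,\<^sub>5\<close>-freeness show that a leg with \<open>m\<close> vertices receives at most
  \<open>m - 1\<close> edges from leaves, or exactly \<open>m\<close> in an exceptional case, in which the last vertex of the leg
  can be made a leaf and hence is adjacent neither to a leaf nor to the other tree neighbours of
  its branch vertex. Choose \<open>T\<close> with the legs covering as many vertices as possible. The remaining
  vertices form a path (the spine), and the stars around its branch vertices bound the number of
  adjacent leaves plus exceptional legs. Summing along the spine gives the estimate.\<close>

section \<open>Trees as cut-connected edge sets\<close>

text \<open>The budget has no slack. If the legs cover \<open>r\<close> vertices and
  \<open>k\<close> of them are exceptional, they receive at most \<open>r - 5 + k\<close> edges from
  leaves. Charging each exceptional leg to its branch vertex leaves the spine a surplus of three
  over its number of vertices. An end of the spine carries at least two legs, so the five legs are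
  distributed as 5, as 2 + 3 or as 2 + 1 + 2. In each case the bounds add up to exactly this
  surplus: a two-leg end with its stretch of spine costs one extra, a three-leg end two, a middle
  branch vertex one, and a single-vertex spine three.

  The maximal leg region serves to keep the two leaves at such an end away from the rest of the
  spine. The case of a further leaf adjacent to the first two spine vertices of an end with an
  exceptional leg needs a second choice: \<open>optimal\<close> minimises, among the trees with
  maximal leg region, the number of edges between leaves and the spine.

  Maximality of \<open>W\<close> is confined to the final theorem, where it makes five the minimum
  number of leaves and keeps the neighbours of leaves inside \<open>W\<close>.\<close>

definition nb :: "'a set set \<Rightarrow> 'a \<Rightarrow> 'a set" where
  "nb T v = {u. {v, u} \<in> T}"

abbreviation dg :: "'a set set \<Rightarrow> 'a \<Rightarrow> nat" where
  "dg T v \<equiv> card (nb T v)"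

text \<open>Connectivity by crossing edges instead of walks makes every edge exchange an argument
  about vertex sets.\<close>

definition cut_connected :: "'a set \<Rightarrow> 'a set set \<Rightarrow> bool" where
  "cut_connected W T \<longleftrightarrow> W \<noteq> {} \<and>
     (\<forall>A. A \<subseteq> W \<longrightarrow> A \<noteq> {} \<longrightarrow> A \<noteq> W \<longrightarrow> (\<exists>a\<in>A. \<exists>b\<in>W - A. {a, b} \<in> T))"

text \<open>Acyclicity is replaced by the number of edges, which an exchange of one edge for another
  preserves at once.\<close>

definition tree_on :: "'a set set \<Rightarrow> 'a set \<Rightarrow> 'a set set \<Rightarrow> bool" where
  "tree_on E W T \<longleftrightarrow> simple_graph W T \<and> T \<subseteq> E \<and> cut_connected W T \<and> card T + 1 = card W"

text \<open>For a tree this is the fundamental cut of the edge \<open>yz\<close>: \<open>A\<close>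
  is the component of \<open>y\<close> after the edge is deleted.\<close>

definition cut :: "'a set \<Rightarrow> 'a set set \<Rightarrow> 'a set \<Rightarrow> 'a \<Rightarrow> 'a \<Rightarrow> bool" where
  "cut W T A y z \<longleftrightarrow> A \<subseteq> W \<and> y \<in> A \<and> z \<in> W - A \<and> {y, z} \<in> T \<and>
     (\<forall>a\<in>A. \<forall>b\<in>W - A. {a, b} \<in> T \<longrightarrow> a = y \<and> b = z)"

definition leaf_set :: "'a set \<Rightarrow> 'a set set \<Rightarrow> 'a set" where
  "leaf_set W T = {v \<in> W. dg T v = 1}"

lemma simple_graph_edge:
  assumes "simple_graph W T" "{u, v} \<in> T"
  shows "u \<in> W" "v \<in> W" "u \<noteq> v"
  using assms unfolding simple_graph_def by (metis doubleton_eq_iff)+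

lemma simple_graph_finite:
  assumes "simple_graph W T" shows "finite W" "finite T"
proof -
  show "finite W" using assms by (simp add: simple_graph_def)
  moreover have "T \<subseteq> Pow W" using assms by (auto simp: simple_graph_def)
  ultimately show "finite T" by (meson finite_Pow_iff finite_subset)
qed

lemma in_nb [simp]: "u \<in> nb T v \<longleftrightarrow> {v, u} \<in> T"
  by (simp add: nb_def)

lemma nb_subset: "simple_graph W T \<Longrightarrow> nb T v \<subseteq> W"
  by (auto dest: simple_graph_edge)

lemma finite_nb: "simple_graph W T \<Longrightarrow> finite (nb T v)"
  by (meson finite_subset nb_subset simple_graph_finite(1))

lemma leaf_set_eq: "simple_graph V T \<Longrightarrow> leaves V T = leaf_set V T"
proof -
  assume s: "simple_graph V T"
  have "{u \<in> V. adj T u v} = nb T v" for v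
    using nb_subset[OF s, of v] by (auto simp: adj_def insert_commute)
  then show ?thesis by (simp add: leaves_def leaf_set_def deg_def)
qed

lemma cut_connectedD:
  "cut_connected W T \<Longrightarrow> A \<subseteq> W \<Longrightarrow> A \<noteq> {} \<Longrightarrow> A \<noteq> W \<Longrightarrow> \<exists>a\<in>A. \<exists>b\<in>W - A. {a, b} \<in> T"
  by (simp add: cut_connected_def)

lemma cut_compl:
  assumes "cut W T A y z" shows "cut W T (W - A) z y"
  unfolding cut_def
proof (intro conjI ballI impI)
  fix a b assume h: "a \<in> W - A" "b \<in> W - (W - A)" "{a, b} \<in> T"
  then have "b \<in> A" "{b, a} \<in> T" by (auto simp: insert_commute[of b])
  then show "a = z" "b = y" using assms h unfolding cut_def by blast+
qed (use assms in \<open>auto simp: cut_def insert_commute[of z]\<close>)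

text \<open>A vertex set can be grown one vertex at a time; each new vertex arrives along an edge
  not induced before.\<close>

lemma cut_connected_card:
  assumes c: "cut_connected W T" and s: "simple_graph W T"
  shows "card W \<le> card T + 1"
proof -
  have fin: "finite W" "finite T" using simple_graph_finite[OF s] .
  have "k < card W \<Longrightarrow> \<exists>A\<subseteq>W. card A = Suc k \<and> k \<le> card {e \<in> T. e \<subseteq> A}" for k
  proof (induction k)
    case 0
    then obtain w where "w \<in> W" by fastforce
    then show ?case by (intro exI[of _ "{w}"]) auto
  next
    case (Suc k)
    then obtain A where A: "A \<subseteq> W" "card A = Suc k" "k \<le> card {e \<in> T. e \<subseteq> A}"
      using Suc_lessD by blast
    then have "A \<noteq> {}" "A \<noteq> W" using Suc.prems by auto
    then obtain a b where ab: "a \<in> A" "b \<in> W - A" "{a, b} \<in> T"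
      using c A(1) unfolding cut_connected_def by blast
    have "insert {a, b} {e \<in> T. e \<subseteq> A} \<subseteq> {e \<in> T. e \<subseteq> insert b A}"
      using ab by auto
    moreover have "finite {e \<in> T. e \<subseteq> insert b A}" using fin by simp
    ultimately have "card (insert {a, b} {e \<in> T. e \<subseteq> A}) \<le> card {e \<in> T. e \<subseteq> insert b A}"
      by (rule card_mono[rotated])
    moreover have "card (insert {a, b} {e \<in> T. e \<subseteq> A}) = Suc (card {e \<in> T. e \<subseteq> A})"
      using ab fin by (subst card_insert_disjoint) auto
    ultimately have "Suc k \<le> card {e \<in> T. e \<subseteq> insert b A}" using A by simp
    moreover have "card (insert b A) = Suc (Suc k)"
      using ab A finite_subset[OF A(1) fin(1)] by simp
    ultimately show ?case using ab A by (intro exI[of _ "insert b A"]) auto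
  qed
  from this[of "card W - 1"] c fin obtain A where
    "A \<subseteq> W" "card W - 1 \<le> card {e \<in> T. e \<subseteq> A}"
    unfolding cut_connected_def by (metis card_gt_0_iff diff_less zero_less_one)
  moreover have "card {e \<in> T. e \<subseteq> A} \<le> card T" using fin by (intro card_mono) auto
  ultimately show ?thesis by linarith
qed

text \<open>Without \<open>yz\<close> there are too few edges for cut-connectedness, so some set has
  no remaining edge leaving it. Since \<open>T\<close> itself is connected, \<open>yz\<close> leaves
  that set, in one of two orientations.\<close>

lemma tree_on_cut:
  assumes t: "tree_on E W T" and e: "{y, z} \<in> T"
  obtains A where "cut W T A y z"
proof -
  have s: "simple_graph W T" and c: "cut_connected W T" and n: "card T + 1 = card W"
    using t by (auto simp: tree_on_def)
  have fin: "finite T" using simple_graph_finite[OF s] by simp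
  let ?T = "T - {{y, z}}"
  have s': "simple_graph W ?T" using s by (auto simp: simple_graph_def)
  have "card ?T + 1 < card W" using e fin n by (metis add_less_mono1 card_Diff1_less)
  then have "\<not> cut_connected W ?T" using cut_connected_card[OF _ s'] by auto
  moreover have "W \<noteq> {}" using c by (simp add: cut_connected_def)
  ultimately obtain A where A: "A \<subseteq> W" "A \<noteq> {}" "A \<noteq> W" "\<not> (\<exists>a\<in>A. \<exists>b\<in>W - A. {a, b} \<in> ?T)"
    unfolding cut_connected_def by metis
  then obtain a b where ab: "a \<in> A" "b \<in> W - A" "{a, b} \<in> T"
    using cut_connectedD[OF c] by blast
  have eq: "{a', b'} = {y, z}" if "a' \<in> A" "b' \<in> W - A" "{a', b'} \<in> T" for a' b'
    using A that by auto
  have "{a, b} = {y, z}" using eq ab by blast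
  then consider "a = y" "b = z" | "a = z" "b = y" by (auto simp: doubleton_eq_iff)
  then show thesis
  proof cases
    case 1
    have "cut W T A y z" unfolding cut_def
    proof (intro conjI ballI impI)
      fix a' b' assume h: "a' \<in> A" "b' \<in> W - A" "{a', b'} \<in> T"
      have "{a', b'} = {y, z}" using eq h by blast
      then show "a' = y" "b' = z" using h ab 1 by (auto simp: doubleton_eq_iff)
    qed (use A(1) ab 1 e in auto)
    then show thesis by (rule that)
  next
    case 2
    have "cut W T A z y" unfolding cut_def
    proof (intro conjI ballI impI)
      fix a' b' assume h: "a' \<in> A" "b' \<in> W - A" "{a', b'} \<in> T"
      have "{a', b'} = {y, z}" using eq h by blast
      then show "a' = z" "b' = y" using h ab 2 by (auto simp: doubleton_eq_iff)
    qed (use A(1) ab 2 in auto)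
    then show thesis by (rule that[OF cut_compl])
  qed
qed

text \<open>A set that no new edge leaves would be left in \<open>T\<close> by \<open>yz\<close>
  alone. Since \<open>ab\<close> does not leave it either, its intersection with one side of the cut
  would already disconnect \<open>T\<close>.\<close>

lemma cut_swap_connected:
  assumes c: "cut_connected W T" and cu: "cut W T A y z" and a: "a \<in> A" and b: "b \<in> W - A"
  shows "cut_connected W (insert {a, b} (T - {{y, z}}))"
  unfolding cut_connected_def
proof (intro conjI allI impI)
  show "W \<noteq> {}" using c by (simp add: cut_connected_def)
  fix C0 assume C0: "C0 \<subseteq> W" "C0 \<noteq> {}" "C0 \<noteq> W"
  let ?T = "insert {a, b} (T - {{y, z}})"
  show "\<exists>c\<in>C0. \<exists>d\<in>W - C0. {c, d} \<in> ?T"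
  proof (rule ccontr)
    assume no0: "\<not> ?thesis"
    \<comment> \<open>Passing to the complement if necessary, the bad set may be assumed to contain
      \<open>y\<close> and not \<open>z\<close>.\<close>
    obtain C where C: "C \<subseteq> W" "y \<in> C" "z \<in> W - C" "\<And>c d. c \<in> C \<Longrightarrow> d \<in> W - C \<Longrightarrow> {c, d} \<notin> ?T"
    proof -
      obtain c d where cd: "c \<in> C0" "d \<in> W - C0" "{c, d} \<in> T"
        using c C0 unfolding cut_connected_def by blast
      then have "{c, d} = {y, z}" using no0 by auto
      then consider "c = y" "d = z" | "c = z" "d = y" by (auto simp: doubleton_eq_iff)
      then show thesis
      proof cases
        case 1
        have "{c, d} \<notin> ?T" if "c \<in> C0" "d \<in> W - C0" for c d
          using no0 that by blast
        then show thesis using that[of C0] C0(1) cd(1,2) 1 by blast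
      next
        case 2 
        have "{c, d} \<notin> ?T" if "c \<in> W - C0" "d \<in> W - (W - C0)" for c d
        proof -
          have "d \<in> C0" "c \<in> W - C0" using that by auto
          then have "{d, c} \<notin> ?T" using no0 by blast
          moreover have "{d, c} = {c, d}" by auto
          ultimately show ?thesis by simp
        qed
        then show thesis using that[of "W - C0"] C0(1) cd(1,2) 2 by blast
      qed
    qed
    have cross: "c = y \<and> d = z" if "c \<in> C" "d \<in> W - C" "{c, d} \<in> T" for c d
      using C(4)[OF that(1,2)] that C(2,3) by (auto simp: doubleton_eq_iff)
    have crossA: "c = y \<and> d = z" if "c \<in> A" "d \<in> W - A" "{c, d} \<in> T" for c d
      using cu that unfolding cut_def by blast
    have yz: "y \<in> A" "z \<in> W - A" "A \<subseteq> W" using cu by (auto simp: cut_def)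
    have "{a, b} \<in> ?T" "{b, a} \<in> ?T" by (auto simp: insert_commute)
    then have "(a \<in> C \<and> b \<in> C) \<or> (a \<notin> C \<and> b \<notin> C)"
      using C(4) a b yz by (metis DiffI Diff_iff subsetD)
    then show False
    proof
      assume "a \<in> C \<and> b \<in> C"
      then have "C - A \<noteq> {}" "C - A \<noteq> W" "C - A \<subseteq> W" using C b by auto
      then obtain c d where cd: "c \<in> C - A" "d \<in> W - (C - A)" "{c, d} \<in> T"
        using c unfolding cut_connected_def by blast
      show False
      proof (cases "d \<in> A")
        case True
        then have "d = y \<and> c = z" using crossA[of d c] cd C(1) by (auto simp: insert_commute)
        then show False using cd C by auto
      next
        case False
        then have "c = y" using cross[of c d] cd by auto
        then show False using cd yz by auto
      qed
    next
      assume "a \<notin> C \<and> b \<notin> C"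
      then have "A - C \<noteq> {}" "A - C \<noteq> W" "A - C \<subseteq> W" using C a yz by auto
      then obtain c d where cd: "c \<in> A - C" "d \<in> W - (A - C)" "{c, d} \<in> T"
        using c unfolding cut_connected_def by blast
      show False
      proof (cases "d \<in> A")
        case True
        then have "d = y \<and> c = z" using cross[of d c] cd yz by (auto simp: insert_commute)
        then show False using cd yz by auto
      next
        case False
        then have "c = y" using crossA[of c d] cd by auto
        then show False using cd C by auto
      qed
    qed
  qed
qed

lemma cut_swap_tree:
  assumes t: "tree_on E W T" and cu: "cut W T A y z"
    and a: "a \<in> A" and b: "b \<in> W - A" and e: "{a, b} \<in> E"
  shows "tree_on E W (insert {a, b} (T - {{y, z}}))"
proof -
  have s: "simple_graph W T" and c: "cut_connected W T" and n: "card T + 1 = card W" and TE: "T \<subseteq> E"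
    using t by (auto simp: tree_on_def)
  have fin: "finite T" using simple_graph_finite[OF s] by simp
  have AW: "A \<subseteq> W" and yzT: "{y, z} \<in> T" using cu by (auto simp: cut_def)
  have "{a, b} \<notin> T - {{y, z}}" using cu a b by (auto simp: cut_def)
  then have "card (insert {a, b} (T - {{y, z}})) = Suc (card (T - {{y, z}}))"
    using fin by simp
  also have "\<dots> = card T" using yzT fin by (metis card_Suc_Diff1)
  finally have "card (insert {a, b} (T - {{y, z}})) = card T" .
  moreover have "simple_graph W (insert {a, b} (T - {{y, z}}))"
    unfolding simple_graph_def
  proof (intro conjI ballI)
    show "finite W" using s by (simp add: simple_graph_def)
    fix e assume "e \<in> insert {a, b} (T - {{y, z}})"
    then show "\<exists>u v. e = {u, v} \<and> u \<noteq> v \<and> u \<in> W \<and> v \<in> W"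
      using s a b AW unfolding simple_graph_def by blast
  qed
  ultimately show ?thesis
    using n TE e cut_swap_connected[OF c cu a b] by (auto simp: tree_on_def)
qed

text \<open>Losses are added on the left rather than subtracted on the right, to avoid truncation.
  The two edges may share one endpoint, whose two corrections then cancel.\<close>

lemma cut_swap_dg:
  assumes t: "tree_on E W T" and cu: "cut W T A y z"
    and a: "a \<in> A" and b: "b \<in> W - A" and ne: "a \<noteq> y \<or> b \<noteq> z"
  shows "dg (insert {a, b} (T - {{y, z}})) x + (if x = y \<or> x = z then 1 else 0)
       = dg T x + (if x = a \<or> x = b then 1 else 0)"
proof -
  let ?T = "insert {a, b} (T - {{y, z}})"
  have s: "simple_graph W T" using t by (simp add: tree_on_def)
  have fin: "finite (nb T x)" using finite_nb[OF s] .
  have yz: "y \<noteq> z" "{y, z} \<in> T" "y \<in> A" "z \<notin> A" using cu by (auto simp: cut_def)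
  have ab: "a \<noteq> b" "b \<notin> A" using a b by auto
  have abT: "{a, b} \<notin> T" using cu a b ne by (auto simp: cut_def)
  define R where "R = (if x = y then {z} else if x = z then {y} else {})"
  define D where "D = (if x = a then {b} else if x = b then {a} else {})"
  have eq: "nb ?T x = (nb T x - R) \<union> D"
    using yz ab abT unfolding R_def D_def by (auto simp: doubleton_eq_iff)
  have "R \<subseteq> nb T x" using yz by (auto simp: R_def insert_commute)
  moreover have "D \<inter> nb T x = {}" using abT by (auto simp: D_def insert_commute)
  moreover have "finite R" "finite D" by (auto simp: R_def D_def)
  moreover have "card R \<le> card (nb T x)" using fin \<open>R \<subseteq> nb T x\<close> by (rule card_mono)
  ultimately have "card (nb ?T x) + card R = card (nb T x) + card D"
    unfolding eq using fin
    by (subst card_Un_disjoint) (auto simp: card_Diff_subset)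
  moreover have "card R = (if x = y \<or> x = z then 1 else 0)" by (simp add: R_def)
  moreover have "card D = (if x = a \<or> x = b then 1 else 0)" by (simp add: D_def)
  ultimately show ?thesis by simp
qed

lemma handshake:
  assumes "simple_graph W T"
  shows "(\<Sum>v\<in>W. dg T v) = 2 * card T"
proof -
  have fin: "finite W" "finite T" using simple_graph_finite[OF assms] .
  have "dg T v = card {e \<in> T. v \<in> e}" for v
  proof (rule bij_betw_same_card[of "\<lambda>u. {v, u}"], rule bij_betwI')
    fix e assume e: "e \<in> {e \<in> T. v \<in> e}"
    then obtain a b where "e = {a, b}" using assms unfolding simple_graph_def by auto
    with e have "e = {v, a} \<or> e = {v, b}" by (auto simp: insert_commute[of a])
    then show "\<exists>u\<in>nb T v. e = {v, u}"
    proof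
      assume "e = {v, a}" then show ?thesis using e by (intro bexI[of _ a]) auto
    next
      assume "e = {v, b}" then show ?thesis using e by (intro bexI[of _ b]) auto
    qed
  qed (auto simp: doubleton_eq_iff)
  then have "(\<Sum>v\<in>W. dg T v) = (\<Sum>v\<in>W. \<Sum>e\<in>T. if v \<in> e then 1 else 0)"
    using fin by (simp add: sum.If_cases Int_def)
  also have "\<dots> = (\<Sum>e\<in>T. \<Sum>v\<in>W. if v \<in> e then 1 else 0)" by (rule sum.swap)
  also have "\<dots> = (\<Sum>e\<in>T. 2)"
  proof (rule sum.cong[OF refl])
    fix e assume "e \<in> T"
    then obtain u v where "e = {u, v}" "u \<noteq> v" "u \<in> W" "v \<in> W"
      using assms unfolding simple_graph_def by blast
    then have "{x \<in> W. x \<in> e} = {u, v}" "u \<noteq> v" by auto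
    then show "(\<Sum>v\<in>W. if v \<in> e then 1 else 0) = (2::nat)"
      using fin by (simp add: sum.If_cases Int_def)
  qed
  finally show ?thesis by simp
qed

lemma tree_dg_pos:
  assumes "tree_on E W T" "card W \<ge> 2" "v \<in> W"
  shows "dg T v \<ge> 1"
proof -
  have s: "simple_graph W T" and c: "cut_connected W T" using assms by (auto simp: tree_on_def)
  have "{v} \<noteq> W" using assms(2) by auto
  then obtain b where "{v, b} \<in> T" using cut_connectedD[OF c, of "{v}"] assms(3) by auto
  then have "nb T v \<noteq> {}" by auto
  then show ?thesis using finite_nb[OF s] by (simp add: Suc_le_eq card_gt_0_iff)
qed

section \<open>Legs and rotations of trees with a minimum number of leaves\<close>

text \<open>Nothing is required of the degrees at the two ends, so that the same notion serves for
  legs and for stretches of the spine between branch vertices.\<close>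

definition thread :: "'a set set \<Rightarrow> (nat \<Rightarrow> 'a) \<Rightarrow> nat \<Rightarrow> bool" where
  "thread T p m \<longleftrightarrow> m \<ge> 1 \<and> inj_on p {..m} \<and> (\<forall>i<m. {p i, p (Suc i)} \<in> T) \<and>
     (\<forall>i. 0 < i \<and> i < m \<longrightarrow> dg T (p i) = 2)"

definition leg :: "'a set set \<Rightarrow> (nat \<Rightarrow> 'a) \<Rightarrow> nat \<Rightarrow> bool" where
  "leg T p m \<longleftrightarrow> thread T p m \<and> dg T (p 0) = 1 \<and> 3 \<le> dg T (p m)"

definition preleg :: "'a set set \<Rightarrow> (nat \<Rightarrow> 'a) \<Rightarrow> nat \<Rightarrow> bool" where
  "preleg T p k \<longleftrightarrow> inj_on p {..k} \<and> (\<forall>i<k. {p i, p (Suc i)} \<in> T) \<and> dg T (p 0) = 1 \<and>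
     (\<forall>i. 0 < i \<and> i \<le> k \<longrightarrow> dg T (p i) = 2)"

text \<open>Initial pieces of legs suffice: a vertex is placed in the region of a modified tree
  without locating the branch vertex at which its new leg stops.\<close>

definition leg_region :: "'a set set \<Rightarrow> 'a set" where
  "leg_region T = {x. \<exists>p k i. preleg T p k \<and> i \<le> k \<and> x = p i}"

lemma thread_inj: "thread T p m \<Longrightarrow> i \<le> m \<Longrightarrow> j \<le> m \<Longrightarrow> p i = p j \<longleftrightarrow> i = j"
  by (auto simp: thread_def inj_on_def)

lemma card2_eq: "card S = 2 \<Longrightarrow> a \<in> S \<Longrightarrow> b \<in> S \<Longrightarrow> a \<noteq> b \<Longrightarrow> S = {a, b}"
  by (auto simp: card_2_iff)

lemma thread_nb:
  assumes "thread T p m" "Suc i < m"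
  shows "nb T (p (Suc i)) = {p i, p (Suc (Suc i))}"
proof (rule card2_eq)
  show "dg T (p (Suc i)) = 2" using assms by (simp add: thread_def)
  have "{p i, p (Suc i)} \<in> T" "{p (Suc i), p (Suc (Suc i))} \<in> T"
    using assms by (simp_all add: thread_def)
  then show "p i \<in> nb T (p (Suc i))" "p (Suc (Suc i)) \<in> nb T (p (Suc i))"
    by (simp_all add: insert_commute)
  show "p i \<noteq> p (Suc (Suc i))" using thread_inj[OF assms(1)] assms(2) by simp
qed

lemma leg_nb_0:
  assumes "leg T p m"
  shows "nb T (p 0) = {p (Suc 0)}"
proof -
  have "card (nb T (p 0)) = 1" "p (Suc 0) \<in> nb T (p 0)"
    using assms by (auto simp: leg_def thread_def)
  then show ?thesis by (metis card_1_singletonE singletonD)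
qed

lemma leg_inj: "leg T p m \<Longrightarrow> i \<le> m \<Longrightarrow> j \<le> m \<Longrightarrow> p i = p j \<longleftrightarrow> i = j"
  using thread_inj[of T p m i j] by (simp add: leg_def)

lemma leg_dg:
  assumes "leg T p m"
  shows "i < m \<Longrightarrow> dg T (p i) = (if i = 0 then 1 else 2)" "3 \<le> dg T (p m)" "1 \<le> m"
  using assms by (auto simp: leg_def thread_def)

lemma leg_edge: "leg T p m \<Longrightarrow> i < m \<Longrightarrow> {p i, p (Suc i)} \<in> T"
  by (auto simp: leg_def thread_def)

lemma leg_nb:
  assumes "leg T p m" "i < m" "{p i, x} \<in> T"
  shows "x = p (Suc i) \<or> (\<exists>j. i = Suc j \<and> x = p j)"
proof -
  have "x \<in> nb T (p i)" using assms by simp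
  then show ?thesis
    using leg_nb_0[OF assms(1)] thread_nb[of T p m] assms
    by (cases i) (auto simp: leg_def simp del: in_nb)
qed

text \<open>At vertices of degree one or two an injective walk has no choice of continuation, and it
  cannot pass the branch vertex, whose degree is at least three.\<close>

lemma preleg_leg:
  assumes q: "preleg T q k" and p: "leg T p m" and z: "q 0 = p 0"
  shows "i \<le> k \<Longrightarrow> i < m \<and> q i = p i"
proof (induction i rule: less_induct)
  case (less i)
  show ?case
  proof (cases i)
    case 0 then show ?thesis using leg_dg(3)[OF p] z by simp
  next
    case (Suc j)
    then have j: "j < m" "q j = p j" using less by auto
    have "{p j, q i} \<in> T" using q Suc less.prems j unfolding preleg_def by (metis Suc_le_lessD)
    then have "q i = p i \<or> (\<exists>l. j = Suc l \<and> q i = p l)" using leg_nb[OF p j(1)] Suc by blast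
    moreover have False if "j = Suc l" "q i = p l" for l
    proof -
      have "q i = q l" using that less Suc by auto
      moreover have "inj_on q {..k}" using q by (simp add: preleg_def)
      ultimately have "i = l" using less.prems Suc that by (auto simp: inj_on_def)
      then show False using Suc that by simp
    qed
    ultimately have e: "q i = p i" by blast
    moreover have "dg T (q i) = 2" using q less.prems Suc by (simp add: preleg_def)
    ultimately have "i \<noteq> m" using leg_dg(2)[OF p] by auto
    then show ?thesis using e j Suc by simp
  qed
qed

lemma leg_preleg: "leg T p m \<Longrightarrow> preleg T p (m - 1)"
  unfolding leg_def thread_def preleg_def by (auto intro: inj_on_subset)

lemma legs_eq:
  assumes "leg T p m" "leg T q k" "p 0 = q 0"
  shows "m = k" "i \<le> m \<Longrightarrow> p i = q i"
proof -
  have mk: "m - 1 < k" "k - 1 < m"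
    using preleg_leg[OF leg_preleg[OF assms(1)] assms(2,3), of "m - 1"]
      preleg_leg[OF leg_preleg[OF assms(2)] assms(1) assms(3)[symmetric], of "k - 1"] by auto
  then show e: "m = k" using leg_dg(3)[OF assms(1)] leg_dg(3)[OF assms(2)] by linarith
  have lt: "p i = q i" if "i < m" for i
    using preleg_leg[OF leg_preleg[OF assms(1)] assms(2,3), of i] that by simp
  show "p i = q i" if "i \<le> m"
  proof (cases "i < m")
    case False
    then have i: "i = m" using that by simp
    obtain j where j: "m = Suc j" using leg_dg(3)[OF assms(1)] by (cases m) auto
    have "{p j, p m} \<in> T" using leg_edge[OF assms(1), of j] j by simp
    then have "{q j, p m} \<in> T" using lt[of j] j by simp
    then have "p m = q m \<or> (\<exists>l. j = Suc l \<and> p m = q l)"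
      using leg_nb[OF assms(2), of j "p m"] j e by simp
    moreover have "p m \<noteq> q l" if "j = Suc l" for l
      using lt[of l] that j leg_inj[OF assms(1), of m l] by simp
    ultimately show ?thesis using i by blast
  qed (rule lt)
qed

text \<open>Follow \<open>q\<close> from its leaf: the vertex before a first meeting would be a
  neighbour of the leg \<open>p\<close>, hence on it or its branch vertex. The bounds are asymmetric
  because two legs may end at the same branch vertex.\<close>

lemma legs_disjoint:
  assumes p: "leg T p m" and q: "leg T q k" and ne: "p 0 \<noteq> q 0"
  shows "i < m \<Longrightarrow> j \<le> k \<Longrightarrow> p i \<noteq> q j"
proof (induction j arbitrary: i)
  case 0
  then show ?case using leg_dg(1)[OF p, of i] leg_dg(1,3)[OF q] ne by (cases "i = 0") auto
next
  case (Suc j)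
  show ?case
  proof
    assume e: "p i = q (Suc j)"
    show False
    proof (cases "Suc j = k")
      case True then show ?thesis using e leg_dg(1)[OF p, of i] leg_dg(2)[OF q] Suc.prems by (auto split: if_splits)
    next
      case False
      then have "{q j, q (Suc j)} \<in> T" using leg_edge[OF q, of j] Suc.prems by simp
      then have "{p i, q j} \<in> T" using e by (simp add: insert_commute)
      then have "q j = p (Suc i) \<or> (\<exists>l. i = Suc l \<and> q j = p l)"
        using leg_nb[OF p Suc.prems(1)] by blast
      moreover have "q j \<noteq> p l" if "l < m" for l using Suc.IH[of l] that Suc.prems by auto
      moreover have "q j \<noteq> p m"
        using leg_dg(2)[OF p] leg_dg(1)[OF q, of j] Suc.prems by (auto split: if_splits)
      ultimately show False using Suc.prems by (metis Suc_lessD Suc_lessI)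
    qed
  qed
qed

text \<open>A longest thread is taken; if its last vertex had degree two, the second neighbour of
  that vertex would extend it.\<close>

lemma thread_exists:
  assumes t: "tree_on E W T" and e: "{x0, x1} \<in> T"
  shows "\<exists>p m. thread T p m \<and> p 0 = x0 \<and> p (Suc 0) = x1 \<and> dg T (p m) \<noteq> 2"
proof -
  have s: "simple_graph W T" using t by (simp add: tree_on_def)
  have fin: "finite W" using simple_graph_finite[OF s] by simp
  let ?P = "\<lambda>m. \<exists>p. thread T p m \<and> p 0 = x0 \<and> p (Suc 0) = x1"
  have bound: "m \<le> card W" if "?P m" for m
  proof -
    obtain p where p: "thread T p m" using \<open>?P m\<close> by blast
    have "p ` {..<m} \<subseteq> W"
      using p simple_graph_edge(1)[OF s] by (auto simp: thread_def)
    moreover have "inj_on p {..<m}" using p by (auto simp: thread_def inj_on_def)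
    ultimately show ?thesis by (metis card_image card_lessThan card_mono fin)
  qed
  have "thread T (\<lambda>i. if i = 0 then x0 else x1) 1"
    using e simple_graph_edge(3)[OF s e] by (auto simp: thread_def inj_on_def le_Suc_eq)
  then have "?P 1" by (intro exI[of _ "\<lambda>i. if i = 0 then x0 else x1"]) simp
  then obtain m where m: "?P m" "\<And>k. ?P k \<Longrightarrow> k \<le> m"
    using GreatestI_nat[of ?P, OF _ bound] Greatest_le_nat[of ?P, OF _ bound] by blast
  then obtain p where p: "thread T p m" "p 0 = x0" "p (Suc 0) = x1" by blast
  have "dg T (p m) \<noteq> 2"
  proof
    assume d: "dg T (p m) = 2"
    obtain j where j: "m = Suc j" using p by (cases m) (auto simp: thread_def)
    have ej: "{p j, p m} \<in> T" using p j by (auto simp: thread_def)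
    then have "p j \<in> nb T (p m)" by (simp add: insert_commute)
    moreover obtain a b where "nb T (p m) = {a, b}" "a \<noteq> b" using d by (auto simp: card_2_iff)
    ultimately obtain q where q: "nb T (p m) = {p j, q}" "q \<noteq> p j"
      by (metis insert_commute insertE singletonD)
    have eq: "{p m, q} \<in> T" using q by (metis in_nb insertI1 insert_commute)
    \<comment> \<open>An inner vertex of the thread already has both its neighbours on it, so only a
      return to \<open>p 0\<close>, that is a cycle, must be excluded.\<close>
    have "q \<noteq> p i" if "i \<le> m" for i
    proof
      assume i: "q = p i"
      have im: "i \<noteq> m" using i eq simple_graph_edge(3)[OF s eq] by auto
      have ij: "i \<noteq> j" using i q by auto
      show False
      proof (cases i)
        case (Suc l)
        then have "nb T (p i) = {p l, p (Suc i)}" using thread_nb[OF p(1), of l] im that by simp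
        moreover have "p m \<in> nb T (p i)" using eq i by (simp add: insert_commute)
        ultimately have "p m = p l \<or> p m = p (Suc i)" by auto
        then show False using thread_inj[OF p(1)] Suc that im ij j by auto
      next
        case 0
        \<comment> \<open>The thread stays on the side of \<open>x1\<close>, since it could leave
          only through \<open>x0\<close>; an edge from \<open>x0\<close> to \<open>p m\<close> then
          forces \<open>p m = x1\<close>.\<close>
        obtain A where A: "cut W T A x0 x1" using tree_on_cut[OF t e] .
        have "Suc l \<le> m \<Longrightarrow> p (Suc l) \<in> W - A" for l
        proof (induction l)
          case 0 then show ?case using A p by (simp add: cut_def)
        next
          case (Suc l)
          have "{p (Suc (Suc l)), p (Suc l)} \<in> T" using p(1) Suc.prems by (auto simp: thread_def insert_commute)
          then have "p (Suc (Suc l)) \<in> A \<Longrightarrow> p (Suc (Suc l)) = x0"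
            "p (Suc (Suc l)) \<in> W"
            using A Suc simple_graph_edge(1)[OF s] unfolding cut_def by auto
          moreover have "p (Suc (Suc l)) \<noteq> x0" using thread_inj[OF p(1), of "Suc (Suc l)" 0] p Suc.prems by simp
          ultimately show ?case by blast
        qed
        from this[of j] have "p m \<in> W - A" using j by simp
        moreover have "{x0, p m} \<in> T" using eq i 0 p by (simp add: insert_commute)
        ultimately have "p m = x1" using A unfolding cut_def by blast
        then have "m = Suc 0" using thread_inj[OF p(1), of m "Suc 0"] p j by simp
        then show False using ij 0 j by simp
      qed
    qed
    then have "q \<notin> p ` {..m}" by blast
    then have "inj_on (p(Suc m := q)) {..Suc m}"
      using p(1) unfolding thread_def atMost_Suc by (auto simp: inj_on_def)
    then have "thread T (p(Suc m := q)) (Suc m)"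
      using p(1) eq d unfolding thread_def by (auto simp: less_Suc_eq)
    then have "?P (Suc m)" using p j by (intro exI[of _ "p(Suc m := q)"]) auto
    then show False using m(2)[of "Suc m"] by simp
  qed
  then show ?thesis using p by blast
qed

text \<open>Every exchange argument draws its contradiction from the minimum number of leaves alone;
  \<open>W\<close> need not be all of \<open>V\<close> here.\<close>

locale tight =
  fixes V :: "'a set" and E :: "'a set set" and W :: "'a set"
  assumes simple: "simple_graph V E" and K15: "K1r_free 5 V E" and WV: "W \<subseteq> V"
    and five: "\<And>T. tree_on E W T \<Longrightarrow> 5 \<le> card (leaf_set W T)"
begin

abbreviation lv :: "'a set set \<Rightarrow> 'a set" where "lv T \<equiv> leaf_set W T"

definition good :: "'a set set \<Rightarrow> bool" where
  "good T \<longleftrightarrow> tree_on E W T \<and> card (lv T) = 5"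

lemma good_tree: "good T \<Longrightarrow> tree_on E W T" by (simp add: good_def)
lemma good_simple: "good T \<Longrightarrow> simple_graph W T" by (simp add: good_def tree_on_def)
lemma finW: "finite W" using WV simple by (meson finite_subset simple_graph_finite(1))
lemma lv_subset: "lv T \<subseteq> W" by (auto simp: leaf_set_def)
lemma finite_lv: "finite (lv T)" using finW lv_subset finite_subset by metis
lemma lv_iff: "u \<in> lv T \<longleftrightarrow> u \<in> W \<and> dg T u = 1" by (auto simp: leaf_set_def)

lemma edge_sym: "{u, v} \<in> E \<Longrightarrow> {v, u} \<in> E" by (simp add: insert_commute)
lemma edge_irrefl: "{u, u} \<notin> E" using simple_graph_edge(3)[OF simple] by blast

lemma good_dg_pos: assumes "good T" "v \<in> W" shows "1 \<le> dg T v"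
proof -
  have "5 \<le> card W" using assms(1) finW lv_subset unfolding good_def by (metis card_mono)
  then show ?thesis using tree_dg_pos[OF good_tree[OF assms(1)]] assms(2) by simp
qed

lemma indep_card:
  assumes "c \<in> W" "S \<subseteq> W" "\<And>s. s \<in> S \<Longrightarrow> {c, s} \<in> E" "\<And>s t. s \<in> S \<Longrightarrow> t \<in> S \<Longrightarrow> {s, t} \<notin> E"
  shows "card S \<le> 4"
proof (rule ccontr)
  assume "\<not> card S \<le> 4"
  then obtain S' where S': "S' \<subseteq> S" "card S' = 5"
    using obtain_subset_with_card_n[of 5 S] by auto
  have "c \<notin> S'" using assms(3)[of c] S' edge_irrefl[of c] by auto
  moreover have "c \<in> V" "S' \<subseteq> V" "\<forall>s\<in>S'. adj E c s" "independent E S'"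
    using S' assms WV unfolding adj_def independent_def by blast+
  ultimately have "\<exists>c\<in>V. \<exists>S\<subseteq>V. card S = 5 \<and> c \<notin> S \<and> (\<forall>s\<in>S. adj E c s) \<and> independent E S"
    using S' by blast
  then show False using K15 by (simp add: K1r_free_def)
qed

lemma leg_in_W:
  assumes "good T" "leg T p m" "i \<le> m" shows "p i \<in> W"
proof (cases "i < m")
  case True show ?thesis using simple_graph_edge(1)[OF good_simple[OF assms(1)] leg_edge[OF assms(2) True]] .
next
  case False
  then obtain j where "m = Suc j" "i = m" using leg_dg(3)[OF assms(2)] assms(3) by (cases m) auto
  then show ?thesis using simple_graph_edge(2)[OF good_simple[OF assms(1)] leg_edge[OF assms(2), of j]] by simp
qed

lemma leg_leaf: "good T \<Longrightarrow> leg T p m \<Longrightarrow> p 0 \<in> lv T"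
  using leg_in_W[of T p m 0] leg_dg(1,3)[of T p m] by (simp add: lv_iff)

text \<open>A thread starting at a leaf and ending at a second leaf would be closed under adjacency,
  so the whole tree would be a path with only two leaves.\<close>

lemma leg_exists:
  assumes g: "good T" and u: "u \<in> lv T"
  obtains p m where "leg T p m" "p 0 = u"
proof -
  have s: "simple_graph W T" using good_simple[OF g] .
  have "dg T u = 1" using u by (simp add: lv_iff)
  then obtain x1 where x1: "{u, x1} \<in> T" by (metis card_1_singletonE in_nb insertI1)
  obtain p m where p: "thread T p m" "p 0 = u" "dg T (p m) \<noteq> 2"
    using thread_exists[OF good_tree[OF g] x1] by blast
  have m1: "1 \<le> m" using p by (simp add: thread_def)
  then obtain j where j: "m = Suc j" by (cases m) auto
  have edge: "{p i, p (Suc i)} \<in> T" if "i < m" for i using p that by (simp add: thread_def)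
  have pW: "p i \<in> W" if "i \<le> m" for i
    using that edge[of i] edge[of j] j simple_graph_edge(1,2)[OF s] by (cases "i < m") (auto simp: le_Suc_eq)
  have "dg T (p m) \<noteq> 1"
  proof
    assume d: "dg T (p m) = 1"
    have "p j \<in> nb T (p m)" using edge[of j] j by (simp add: insert_commute)
    then have nbm: "nb T (p m) = {p j}" using d by (metis card_1_singletonE singletonD)
    have "p 1 \<in> nb T (p 0)" using edge[of 0] j by simp
    then have nb0: "nb T (p 0) = {p 1}" using \<open>dg T u = 1\<close> p by (metis card_1_singletonE singletonD)
    have closed: "nb T (p i) \<subseteq> p ` {..m}" if im: "i \<le> m" for i
    proof -
      consider "i = 0" | "i = m" | l where "i = Suc l" "Suc l < m"
        using im by (cases i; cases "i = m") auto
      then show ?thesis using nb0 nbm thread_nb[OF p(1)] m1 j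
        by cases (auto simp del: in_nb)
    qed
    have "p ` {..m} = W"
    proof (rule ccontr)
      assume ne: "p ` {..m} \<noteq> W"
      have "cut_connected W T" using good_tree[OF g] by (simp add: tree_on_def)
      from cut_connectedD[OF this _ _ ne] pW obtain a b where
        ab: "a \<in> p ` {..m}" "b \<in> W - p ` {..m}" "{a, b} \<in> T" by auto
      then obtain i where "i \<le> m" "a = p i" by auto
      then show False using closed[of i] ab by auto
    qed
    have "x \<in> {p 0, p m}" if x: "x \<in> lv T" for x
    proof -
      have "x \<in> p ` {..m}" using x lv_subset \<open>p ` {..m} = W\<close> by auto
      then obtain i where i: "i \<le> m" "x = p i" by auto
      have "\<not> (0 < i \<and> i < m)" using x p(1) i(2) unfolding thread_def by (auto simp: lv_iff)
      then show ?thesis using i by (cases "i = 0") auto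
    qed
    then have "lv T \<subseteq> {p 0, p m}" by blast
    then have "card (lv T) \<le> card {p 0, p m}" by (intro card_mono) auto
    also have "\<dots> \<le> 2" by (simp add: card_insert_le_m1)
    finally show False using g by (simp add: good_def)
  qed
  moreover have "dg T (p m) \<ge> 1" using good_dg_pos[OF g pW[of m]] by simp
  ultimately have "leg T p m" using p \<open>dg T u = 1\<close> by (simp add: leg_def)
  then show thesis using that p by blast
qed

lemma leg_cut:
  assumes g: "good T" and l: "leg T p m" and t: "t < m"
  shows "cut W T (p ` {..t}) (p t) (p (Suc t))"
  unfolding cut_def
proof (intro conjI ballI impI)
  show "p ` {..t} \<subseteq> W" using leg_in_W[OF g l] t by auto
  show "p t \<in> p ` {..t}" by simp
  show "p (Suc t) \<in> W - p ` {..t}" using leg_in_W[OF g l, of "Suc t"] leg_inj[OF l] t by auto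
  show "{p t, p (Suc t)} \<in> T" using leg_edge[OF l t] .
  fix a b assume a: "a \<in> p ` {..t}" and b: "b \<in> W - p ` {..t}" and e: "{a, b} \<in> T"
  then obtain i where i: "i \<le> t" "a = p i" by auto
  then have "b = p (Suc i) \<or> (\<exists>j. i = Suc j \<and> b = p j)" using leg_nb[OF l, of i b] e t by simp
  moreover have "p j \<in> p ` {..t}" if "j \<le> t" for j using that by blast
  ultimately have "i = t \<and> b = p (Suc t)" using b i
    by (metis DiffD2 Suc_leI Suc_leD le_neq_implies_less)
  then show "a = p t" "b = p (Suc t)" using i by auto
qed

lemma swap_five:
  assumes "good T" "cut W T A y z" "a \<in> A" "b \<in> W - A" "{a, b} \<in> E"
  shows "5 \<le> card (lv (insert {a, b} (T - {{y, z}})))"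
  using five cut_swap_tree[OF good_tree] assms by blast

text \<open>Exchanging the last edge of the leg of \<open>u\<close> for \<open>uv\<close> destroys
  two leaves and creates at most one, while the branch vertex keeps degree at least two. Four leaves
  would remain.\<close>

lemma leaves_nonadj:
  assumes g: "good T" and u: "u \<in> lv T" and v: "v \<in> lv T"
  shows "{u, v} \<notin> E"
proof
  assume e: "{u, v} \<in> E"
  obtain p m where p: "leg T p m" "p 0 = u" using leg_exists[OF g u] .
  obtain j where j: "m = Suc j" using leg_dg(3)[OF p(1)] by (cases m) auto
  have uv: "u \<noteq> v" using e edge_irrefl by auto
  let ?A = "p ` {..j}"
  have cu: "cut W T ?A (p j) (p m)" using leg_cut[OF g p(1), of j] j by simp
  have vA: "v \<notin> ?A"
  proof
    assume "v \<in> ?A"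
    then obtain i where "i \<le> j" "v = p i" by auto
    moreover have "dg T v = 1" using v by (simp add: lv_iff)
    moreover have "i \<noteq> 0" using calculation uv p by metis
    ultimately show False using leg_dg(1)[OF p(1), of i] j by simp
  qed
  let ?T = "insert {u, v} (T - {{p j, p m}})"
  have ne: "u \<noteq> p j \<or> v \<noteq> p m" using leg_dg(2)[OF p(1)] v by (auto simp: lv_iff)
  have uA: "u \<in> ?A" using p by auto
  have vW: "v \<in> W - ?A" using vA v lv_subset by auto
  have d: "dg ?T x + (if x = p j \<or> x = p m then 1 else 0) = dg T x + (if x = u \<or> x = v then 1 else 0)" for x
    using cut_swap_dg[OF good_tree[OF g] cu uA vW ne] .
  have du: "dg T u = 1" "dg T v = 1" using u v by (auto simp: lv_iff)
  have pm: "3 \<le> dg T (p m)" "p m \<noteq> u" "p m \<noteq> v" using leg_dg(2)[OF p(1)] du by auto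
  have "lv ?T \<subseteq> insert (p j) (lv T - {u, v})"
  proof
    fix x assume x: "x \<in> lv ?T"
    then show "x \<in> insert (p j) (lv T - {u, v})"
      using d[of x] pm du by (auto simp: lv_iff split: if_splits)
  qed
  then have "card (lv ?T) \<le> card (insert (p j) (lv T - {u, v}))"
    by (intro card_mono) (auto simp: finite_lv)
  also have "\<dots> \<le> Suc (card (lv T - {u, v}))" by (rule card_insert_le_m1) auto
  also have "card (lv T - {u, v}) = 3" using u v uv g by (simp add: card_Diff_subset good_def)
  finally show False using swap_five[OF g cu uA vW e] by simp
qed

text \<open>The degree of \<open>z\<close> is unchanged and \<open>u\<close> ceases to be a leaf, so
  the number of leaves falls below five unless \<open>y\<close> becomes a leaf.\<close>

lemma rotate:
  assumes g: "good T" and cu: "cut W T A y z" and u: "u \<in> lv T" "u \<in> A" "u \<noteq> y" and e: "{u, z} \<in> E"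
  defines "T' \<equiv> insert {u, z} (T - {{y, z}})"
  shows "dg T y = 2" "good T'" "lv T' = insert y (lv T - {u})"
    "\<And>x. x \<noteq> u \<Longrightarrow> x \<noteq> y \<Longrightarrow> dg T' x = dg T x" "dg T' u = 2" "dg T' y = 1"
proof -
  have zW: "z \<in> W - A" and yz: "y \<noteq> z" "y \<in> W" using cu by (auto simp: cut_def)
  have uz: "u \<noteq> z" using zW u by auto
  have ne: "u \<noteq> y \<or> z \<noteq> z" using u by simp
  have d: "dg T' x + (if x = y \<or> x = z then 1 else 0) = dg T x + (if x = u \<or> x = z then 1 else 0)" for x
    unfolding T'_def using cut_swap_dg[OF good_tree[OF g] cu u(2) zW ne] .
  have t': "tree_on E W T'" unfolding T'_def using cut_swap_tree[OF good_tree[OF g] cu u(2) zW e] .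
  have f: "5 \<le> card (lv T')" using five[OF t'] .
  have du: "dg T u = 1" "u \<in> W" using u by (auto simp: lv_iff)
  have c5: "card (lv T) = 5" using g by (simp add: good_def)
  then have "2 \<le> card W" using card_mono[OF finW lv_subset, of T] by simp
  then have "1 \<le> dg T' y" using tree_dg_pos[OF t'] yz by simp
  then have dy2: "2 \<le> dg T y" using d[of y] yz u(3) by simp
  show dx: "dg T' x = dg T x" if "x \<noteq> u" "x \<noteq> y" for x
    using d[of x] that by (auto split: if_splits)
  show du': "dg T' u = 2" using d[of u] du u uz by simp
  have "\<not> 3 \<le> dg T y"
  proof
    assume "3 \<le> dg T y"
    then have "2 \<le> dg T' y" using d[of y] yz u(3) by simp
    have "x \<in> lv T - {u}" if "x \<in> lv T'" for x
    proof -
      have "x \<in> W" "dg T' x = 1" using that by (auto simp: lv_iff)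
      moreover from this have "x \<noteq> u" "x \<noteq> y" using \<open>2 \<le> dg T' y\<close> du' by auto
      ultimately show ?thesis using dx[of x] by (simp add: lv_iff)
    qed
    then have "lv T' \<subseteq> lv T - {u}" by blast
    then have "card (lv T') \<le> card (lv T - {u})" by (intro card_mono) (auto simp: finite_lv)
    then show False using f c5 u by simp
  qed
  then show y2: "dg T y = 2" using dy2 by simp
  then show y1: "dg T' y = 1" using d[of y] yz u(3) by simp
  show l: "lv T' = insert y (lv T - {u})"
    using dx y1 du' yz(2) by (auto simp: lv_iff) (metis n_not_Suc_n numeral_2_eq_2)+
  have "y \<notin> lv T" using y2 by (simp add: lv_iff)
  then have "card (lv T') = 5" using l c5 u finite_lv by simp
  then show "good T'" using t' by (simp add: good_def)
qed

lemma rotate_nonadj: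
  assumes "good T" "cut W T A y z" "u \<in> lv T" "u \<in> A" "u \<noteq> y" "{u, z} \<in> E" "v \<in> lv T" "v \<noteq> u"
  shows "{y, v} \<notin> E"
  using leaves_nonadj[OF rotate(2)[OF assms(1-6)], of y v] rotate(3)[OF assms(1-6)] assms(7,8) by auto

end

section \<open>Leaf neighbours along a leg\<close>

text \<open>Every two is paid for by the zero directly before it, and the first value cannot be
  two.\<close>

lemma sum_le_pred_zero:
  fixes g :: "nat \<Rightarrow> nat"
  assumes "\<And>i. i < r \<Longrightarrow> g i \<le> 2" "0 < r \<Longrightarrow> g 0 \<le> 1"
    and "\<And>i. Suc i < r \<Longrightarrow> g (Suc i) = 2 \<Longrightarrow> g i = 0"
  shows "k \<le> r \<Longrightarrow> (\<Sum>i<k. g i) \<le> k"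
proof (induction k rule: less_induct)
  case (less k)
  consider "k = 0" | "k = 1" | l where "k = Suc (Suc l)" by (metis One_nat_def not0_implies_Suc)
  then show ?case
  proof cases
    case 2 then show ?thesis using assms(2) less.prems by auto
  next
    case 3
    show ?thesis
    proof (cases "g (Suc l) = 2")
      case True
      then have "g l = 0" using assms(3)[of l] 3 less.prems by simp
      then show ?thesis using less.IH[of l] less.prems 3 True by simp
    next
      case False
      then have "g (Suc l) \<le> 1" using assms(1)[of "Suc l"] 3 less.prems by simp
      then show ?thesis using less.IH[of "Suc l"] less.prems 3 by simp
    qed
  qed simp
qed

text \<open>The second summand is the unit saved at the initial zero: a two spends it, and the zero
  that must follow restores it.\<close>

lemma sum_isolated_twos:
  fixes f :: "nat \<Rightarrow> nat"
  assumes "\<And>i. i \<le> r \<Longrightarrow> f i \<le> 2" "f 0 = 0"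
    and "\<And>i. Suc i \<le> r \<Longrightarrow> f i = 2 \<Longrightarrow> f (Suc i) = 0"
    and "\<And>i. Suc i \<le> r \<Longrightarrow> f (Suc i) = 2 \<Longrightarrow> f i = 0"
  shows "k \<le> r \<Longrightarrow> (\<Sum>i\<le>k. f i) + (if f k = 2 then 0 else 1) \<le> Suc k"
proof (induction k)
  case 0 then show ?case using assms(2) by simp
next
  case (Suc k)
  have "f (Suc k) \<le> 2" using assms(1) Suc.prems by simp
  moreover have "f k = 2 \<Longrightarrow> f (Suc k) = 0" "f (Suc k) = 2 \<Longrightarrow> f k = 0" using assms(3,4) Suc.prems by auto
  moreover have "(\<Sum>i\<le>k. f i) + (if f k = 2 then 0 else 1) \<le> Suc k" using Suc by simp
  ultimately show ?case by (auto split: if_splits)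
qed

context tight
begin

definition nl :: "'a set set \<Rightarrow> 'a \<Rightarrow> 'a set" where
  "nl T x = {u \<in> lv T. {u, x} \<in> E}"

lemma finite_nl: "finite (nl T x)" by (simp add: nl_def finite_lv)

lemma nl_iff: "u \<in> nl T x \<longleftrightarrow> u \<in> lv T \<and> {u, x} \<in> E" by (simp add: nl_def)

text \<open>The leaves in \<open>L\<close> are independent by \<open>leaves_nonadj\<close>, so for
  an application of \<open>K1r_free 5\<close> only the pairs involving \<open>X\<close> have to be
  checked.\<close>

lemma star_bound:
  assumes g: "good T" and c: "c \<in> W" and L: "L \<subseteq> nl T c" and X: "X \<subseteq> W"
    and cX: "\<And>x. x \<in> X \<Longrightarrow> {c, x} \<in> E" and XX: "\<And>x y. x \<in> X \<Longrightarrow> y \<in> X \<Longrightarrow> {x, y} \<notin> E"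
    and LX: "\<And>u x. u \<in> L \<Longrightarrow> x \<in> X \<Longrightarrow> {u, x} \<notin> E" and dis: "L \<inter> X = {}"
  shows "card L + card X \<le> 4"
proof -
  have LW: "L \<subseteq> W" using L lv_subset by (auto simp: nl_def)
  have "card (L \<union> X) \<le> 4"
  proof (rule indep_card[OF c])
    show "L \<union> X \<subseteq> W" using LW X by simp
    show "{c, s} \<in> E" if "s \<in> L \<union> X" for s
      using that L cX edge_sym by (auto simp: nl_def)
    fix s t assume st: "s \<in> L \<union> X" "t \<in> L \<union> X"
    have "{s, t} \<notin> E" if "s \<in> L" "t \<in> L" using leaves_nonadj[OF g] that L by (auto simp: nl_def)
    moreover have "{s, t} \<notin> E" if "s \<in> X" "t \<in> L" using LX that edge_sym by blast
    ultimately show "{s, t} \<notin> E" using st XX LX by blast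
  qed
  then show ?thesis using LW X finW dis by (simp add: card_Un_disjoint finite_subset)
qed

lemma good_edge: "good T \<Longrightarrow> {x, y} \<in> T \<Longrightarrow> {x, y} \<in> E"
  by (auto simp: good_def tree_on_def)

lemma leaf_not_on_leg:
  assumes "leg T p m" "u \<in> lv T" "u \<noteq> p 0" "i \<le> m" shows "u \<noteq> p i"
  using assms leg_dg[OF assms(1)] by (cases "i = m"; cases "i = 0") (auto simp: lv_iff)

lemma leg_notin_image:
  assumes "leg T p m" "S \<subseteq> {..m}" "i \<le> m" "i \<notin> S" shows "p i \<notin> p ` S"
proof
  assume "p i \<in> p ` S"
  then obtain j where "j \<in> S" "p i = p j" by auto
  then show False using leg_inj[OF assms(1), of i j] assms by auto
qed

lemma leaf_off_leg:
  assumes "leg T p m" "u \<in> lv T" "u \<noteq> p 0" "S \<subseteq> {..m}" shows "u \<in> W - p ` S"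
  using leaf_not_on_leg[OF assms(1-3)] assms(2,4) lv_subset[of T] by blast

text \<open>Rotation with \<open>z = p t\<close> and \<open>y = p (Suc t)\<close>: the leaf
  \<open>u\<close> lies beyond the initial piece of the leg, on the side of
  \<open>p (Suc t)\<close>, which therefore turns into a leaf.\<close>

lemma leg_adj:
  assumes g: "good T" and l: "leg T p m" and t: "t < m" and u: "u \<in> lv T" "u \<noteq> p 0" "{u, p t} \<in> E"
  shows "0 < t" "Suc t < m" "\<And>v. v \<in> lv T \<Longrightarrow> v \<noteq> u \<Longrightarrow> {v, p (Suc t)} \<notin> E"
proof -
  have cu: "cut W T (W - p ` {..t}) (p (Suc t)) (p t)" using cut_compl[OF leg_cut[OF g l t]] .
  have uA: "u \<in> W - p ` {..t}" using leaf_off_leg[OF l u(1,2), of "{..t}"] t by simp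
  have uy: "u \<noteq> p (Suc t)" using leaf_not_on_leg[OF l u(1,2)] t by simp
  show "0 < t" using leaves_nonadj[OF g u(1) leg_leaf[OF g l]] u(3) by (cases t) auto
  show "Suc t < m" using rotate(1)[OF g cu u(1) uA uy u(3)] leg_dg(2)[OF l] t by (cases "Suc t = m") auto
  show "{v, p (Suc t)} \<notin> E" if "v \<in> lv T" "v \<noteq> u" for v
    using rotate_nonadj[OF g cu u(1) uA uy u(3) that] edge_sym by blast
qed

text \<open>If \<open>y\<close> and \<open>z\<close> were adjacent, two rotations would bypass \<open>x\<close> and hang it onto \<open>u\<close>,
  making it a leaf adjacent to the leaf \<open>v\<close>.\<close>

lemma insertion_nonadj:
  assumes g: "good T" and c1: "cut W T A y x" and c2: "cut W T (insert x A) x z"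
    and u: "u \<in> lv T" "u \<in> A" "u \<noteq> y" "{u, x} \<in> E" and v: "v \<in> lv T" "v \<noteq> u" "{v, x} \<in> E"
  shows "{y, z} \<notin> E"
proof
  assume e: "{y, z} \<in> E"
  let ?T = "insert {u, x} (T - {{y, x}})"
  note r = rotate[OF g c1 u]
  have y: "y \<in> lv ?T" "y \<in> insert x A" "y \<noteq> x" using r(3) c1 by (auto simp: cut_def)
  have "cut W ?T (insert x A) x z"
    unfolding cut_def
  proof (intro conjI ballI impI)
    show "insert x A \<subseteq> W" "x \<in> insert x A" "z \<in> W - insert x A" using c2 by (auto simp: cut_def)
    have "{y, x} \<noteq> {x, z}" using c1 c2 by (auto simp: cut_def doubleton_eq_iff)
    then show "{x, z} \<in> ?T" using c2 by (auto simp: cut_def)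
    fix a b assume ab: "a \<in> insert x A" "b \<in> W - insert x A" "{a, b} \<in> ?T"
    then have "{a, b} \<noteq> {u, x}" using u by (auto simp: doubleton_eq_iff)
    then have "{a, b} \<in> T" using ab by auto
    then show "a = x" "b = z" using c2 ab unfolding cut_def by blast+
  qed
  note r2 = rotate[OF r(2) this y e]
  have "v \<noteq> y" using v(1) r(1) by (auto simp: lv_iff)
  then have "v \<in> lv (insert {y, z} (?T - {{x, z}}))" "x \<in> lv (insert {y, z} (?T - {{x, z}}))"
    using r2(3) r(3) v by auto
  then show False using leaves_nonadj[OF r2(2)] v(3) by blast
qed

lemma leg_insertion_nonadj:
  assumes g: "good T" and l: "leg T p m" and t: "Suc s < m"
    and u: "u \<in> lv T" "u \<noteq> p 0" "{u, p (Suc s)} \<in> E"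
    and v: "v \<in> lv T" "v \<noteq> u" "{v, p (Suc s)} \<in> E"
  shows "{p s, p (Suc (Suc s))} \<notin> E"
proof -
  have c1: "cut W T (W - p ` {..Suc s}) (p (Suc (Suc s))) (p (Suc s))"
    using cut_compl[OF leg_cut[OF g l t]] .
  have "p (Suc s) \<in> W - p ` {..s}" using leg_in_W[OF g l, of "Suc s"] leg_inj[OF l] t by auto
  then have "insert (p (Suc s)) (W - p ` {..Suc s}) = W - p ` {..s}" by (auto simp: atMost_Suc)
  then have c2: "cut W T (insert (p (Suc s)) (W - p ` {..Suc s})) (p (Suc s)) (p s)"
    using cut_compl[OF leg_cut[OF g l, of s]] t by simp
  have "u \<in> W - p ` {..Suc s}" "u \<noteq> p (Suc (Suc s))"
    using leaf_off_leg[OF l u(1,2), of "{..Suc s}"] leaf_not_on_leg[OF l u(1,2)] t by simp_all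
  from insertion_nonadj[OF g c1 c2 u(1) this u(3) v] show ?thesis using edge_sym by blast
qed

text \<open>Three such leaves together with the two neighbours on the leg would be five independent
  neighbours of \<open>p t\<close>.\<close>

lemma leg_others_le_two:
  assumes g: "good T" and l: "leg T p m" and t: "t < m"
  shows "card (nl T (p t) - {p 0}) \<le> 2"
proof (rule ccontr)
  assume n: "\<not> ?thesis"
  let ?L = "nl T (p t) - {p 0}"
  have other: "\<exists>v\<in>?L. v \<noteq> u" for u
  proof (rule ccontr)
    assume "\<not> ?thesis"
    then have "?L \<subseteq> {u}" by blast
    then have "card ?L \<le> card {u}" by (intro card_mono) auto
    then show False using n by simp
  qed
  have L: "u \<in> lv T" "u \<noteq> p 0" "{u, p t} \<in> E" if "u \<in> ?L" for u using that by (auto simp: nl_iff)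
  obtain u0 where u0: "u0 \<in> ?L" using other by blast
  obtain s where s: "t = Suc s" using leg_adj(1)[OF g l t L[OF u0]] by (cases t) auto
  have t1: "Suc t < m" using leg_adj(2)[OF g l t L[OF u0]] .
  have "card ?L + card {p s, p (Suc t)} \<le> 4"
  proof (rule star_bound[OF g])
    show "p t \<in> W" "{p s, p (Suc t)} \<subseteq> W" using leg_in_W[OF g l] t s by auto
    have "{p t, p s} \<in> E" "{p t, p (Suc t)} \<in> E"
      using leg_edge[OF l, of s] leg_edge[OF l t] s t good_edge[OF g] edge_sym by simp_all
    then show "{p t, x} \<in> E" if "x \<in> {p s, p (Suc t)}" for x using that by blast
    obtain v where v: "v \<in> ?L" "v \<noteq> u0" using other by blast
    have "{p s, p (Suc t)} \<notin> E"
      using leg_insertion_nonadj[OF g l, of s u0 v] L[OF u0] L[OF v(1)] v(2) s t by blast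
    then show "{x, y} \<notin> E" if "x \<in> {p s, p (Suc t)}" "y \<in> {p s, p (Suc t)}" for x y
      using that edge_irrefl edge_sym by blast
    fix u x assume u: "u \<in> ?L" and x: "x \<in> {p s, p (Suc t)}"
    \<comment> \<open>A second leaf \<open>w\<close> at \<open>p t\<close> excludes \<open>u\<close>
      from both leg neighbours: \<open>leg_adj\<close> at \<open>p s\<close> would bar
      \<open>w\<close> from \<open>p t\<close>, and \<open>leg_adj\<close> at \<open>p t\<close> for
      \<open>w\<close> bars \<open>u\<close> from the next vertex.\<close>
    obtain w where w: "w \<in> ?L" "w \<noteq> u" using other by blast
    have "{u, p s} \<notin> E" using leg_adj(3)[OF g l, of s u w] L[OF u] L[OF w(1)] w(2) s t by auto
    moreover have "{u, p (Suc t)} \<notin> E" using leg_adj(3)[OF g l t L[OF w(1)], of u] L[OF u] w(2) by auto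
    ultimately show "{u, x} \<notin> E" using x by blast
  next
    have "p i \<notin> ?L" if "i \<le> m" for i using leaf_not_on_leg[OF l] L that by blast
    then show "?L \<inter> {p s, p (Suc t)} = {}" using s t by auto
  qed auto
  moreover have "p s \<noteq> p (Suc t)" using leg_inj[OF l, of s "Suc t"] s t by simp
  ultimately show False using n by simp
qed

text \<open>The same star as for two other leaves, now with \<open>p 0\<close> as third leaf. Only
  the edge from \<open>p 0\<close> to the preceding vertex is not excluded by
  \<open>leg_adj\<close>, so it must be present.\<close>

lemma leg_full_vertex:
  assumes g: "good T" and l: "leg T p m" and t: "Suc (Suc s) < m"
    and c: "2 \<le> card (nl T (p (Suc (Suc s))) - {p 0})" and e: "{p 0, p (Suc (Suc s))} \<in> E"
  shows "{p 0, p (Suc s)} \<in> E"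
proof (rule ccontr)
  assume ne: "\<not> ?thesis"
  let ?t = "Suc (Suc s)"
  let ?N = "nl T (p ?t)"
  have L: "u \<in> lv T" "{u, p ?t} \<in> E" if "u \<in> ?N" for u using that by (auto simp: nl_iff)
  have p0: "p 0 \<in> ?N" using e leg_leaf[OF g l] by (simp add: nl_iff)
  then have c3: "3 \<le> card ?N" using c finite_nl by (simp add: card_Diff_subset)
  have other: "\<exists>v\<in>?N. v \<noteq> u \<and> v \<noteq> p 0" for u
  proof (rule ccontr)
    assume "\<not> ?thesis"
    then have "?N - {p 0} \<subseteq> {u}" by blast
    then have "card (?N - {p 0}) \<le> card {u}" by (intro card_mono) auto
    then show False using c by simp
  qed
  obtain u0 where u0: "u0 \<in> ?N" "u0 \<noteq> p 0" using other by blast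
  obtain v0 where v0: "v0 \<in> ?N" "v0 \<noteq> u0" "v0 \<noteq> p 0" using other by blast
  have t1: "Suc ?t < m" using leg_adj(2)[OF g l t] L[OF u0(1)] u0(2) by blast
  have "card ?N + card {p (Suc s), p (Suc ?t)} \<le> 4"
  proof (rule star_bound[OF g])
    show "p ?t \<in> W" "{p (Suc s), p (Suc ?t)} \<subseteq> W" using leg_in_W[OF g l] t by auto
    have "{p ?t, p (Suc s)} \<in> E" "{p ?t, p (Suc ?t)} \<in> E"
      using leg_edge[OF l, of "Suc s"] leg_edge[OF l t] t good_edge[OF g] edge_sym by simp_all
    then show "{p ?t, x} \<in> E" if "x \<in> {p (Suc s), p (Suc ?t)}" for x using that by blast
    have "{p (Suc s), p (Suc ?t)} \<notin> E"
      using leg_insertion_nonadj[OF g l t, of u0 v0] L[OF u0(1)] u0 L[OF v0(1)] v0 by blast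
    then show "{x, y} \<notin> E" if "x \<in> {p (Suc s), p (Suc ?t)}" "y \<in> {p (Suc s), p (Suc ?t)}" for x y
      using that edge_irrefl edge_sym by blast
    fix u x assume u: "u \<in> ?N" and x: "x \<in> {p (Suc s), p (Suc ?t)}"
    obtain w where w: "w \<in> ?N" "w \<noteq> u" "w \<noteq> p 0" using other by blast
    have "{u, p (Suc s)} \<notin> E"
    proof (cases "u = p 0")
      case False
      then show ?thesis using leg_adj(3)[OF g l, of "Suc s" u w] L[OF u] L[OF w(1)] w t by auto
    qed (use ne in simp)
    moreover have "{u, p (Suc ?t)} \<notin> E" using leg_adj(3)[OF g l t L(1)[OF w(1)] w(3) L(2)[OF w(1)], of u] L[OF u] w by auto
    ultimately show "{u, x} \<notin> E" using x by blast
  next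
    have "p i \<notin> lv T" if "i \<le> m" "0 < i" for i
      using leaf_not_on_leg[OF l, of "p i" i] leg_inj[OF l, of i 0] that by auto
    then have "p (Suc s) \<notin> lv T" "p (Suc ?t) \<notin> lv T" using t1 by simp_all
    then show "?N \<inter> {p (Suc s), p (Suc ?t)} = {}" using L(1) by blast
  qed auto
  moreover have "p (Suc s) \<noteq> p (Suc ?t)" using leg_inj[OF l, of "Suc s" "Suc ?t"] t by simp
  ultimately show False using c3 by simp
qed

text \<open>Unlike in \<open>rotate\<close>, the new edge joins a leaf \<open>l\<close> to a
  non-leaf \<open>k\<close>, and the deleted edge ends at a branch vertex \<open>r\<close>. The
  other end \<open>s\<close> must make up for the lost leaf. The letters \<open>r\<close>,
  \<open>s\<close>, \<open>l\<close>, \<open>k\<close> cover both orientations of each edge.\<close>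

lemma attach:
  assumes g: "good T" and cu: "cut W T A y z" and ab: "a \<in> A" "b \<in> W - A" "{a, b} \<in> E"
    and rs: "r = y \<and> s = z \<or> r = z \<and> s = y" and r3: "3 \<le> dg T r"
    and lk: "l = a \<and> k = b \<or> l = b \<and> k = a" and l: "l \<in> lv T" and k: "2 \<le> dg T k"
    and ne: "a \<noteq> y" "b \<noteq> z"
  defines "T' \<equiv> insert {a, b} (T - {{y, z}})"
  shows "dg T s = 2" "good T'" "lv T' = insert s (lv T - {l})"
    "\<And>x. x \<noteq> a \<Longrightarrow> x \<noteq> b \<Longrightarrow> x \<noteq> y \<Longrightarrow> x \<noteq> z \<Longrightarrow> dg T' x = dg T x"
proof -
  have yz: "y \<noteq> z" "y \<in> A" "z \<in> W - A" "A \<subseteq> W" using cu by (auto simp: cut_def)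
  have dist: "a \<noteq> b" "a \<noteq> z" "b \<noteq> y" using ab yz by auto
  have ne1: "a \<noteq> y \<or> b \<noteq> z" using ne by simp
  have d: "dg T' x + (if x = y \<or> x = z then 1 else 0) = dg T x + (if x = a \<or> x = b then 1 else 0)" for x
    unfolding T'_def using cut_swap_dg[OF good_tree[OF g] cu ab(1,2) ne1] .
  have t': "tree_on E W T'" unfolding T'_def using cut_swap_tree[OF good_tree[OF g] cu ab] .
  have f: "5 \<le> card (lv T')" using five[OF t'] .
  have c5: "card (lv T) = 5" using g by (simp add: good_def)
  then have "2 \<le> card W" using card_mono[OF finW lv_subset, of T] by simp
  then have pos: "1 \<le> dg T' s" using tree_dg_pos[OF t', of s] yz rs by auto
  show other: "dg T' x = dg T x" if "x \<noteq> a" "x \<noteq> b" "x \<noteq> y" "x \<noteq> z" for x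
    using d[of x] that by simp
  have dr: "2 \<le> dg T' r" using d[of r] r3 rs by (auto split: if_splits)
  have dl: "dg T l = 1" "dg T' l = 2" using d[of l] l lk dist ne by (auto simp: lv_iff)
  have dk: "3 \<le> dg T' k" using d[of k] k lk dist ne by auto
  have ds: "dg T s = Suc (dg T' s)" using d[of s] rs dist ne by auto
  have sub: "x \<in> lv T - {l}" if x: "x \<in> lv T'" "x \<noteq> s" for x
  proof -
    have x1: "x \<in> W" "dg T' x = 1" using x by (auto simp: lv_iff)
    then have "x \<noteq> r" "x \<noteq> l" "x \<noteq> k" using dr dl dk by auto
    then have "dg T' x = dg T x" using other[of x] x(2) rs lk by blast
    then show ?thesis using x1 \<open>x \<noteq> l\<close> by (simp add: lv_iff)
  qed
  have s1: "dg T' s = 1"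
  proof (rule ccontr)
    assume "dg T' s \<noteq> 1"
    then have "s \<notin> lv T'" by (simp add: lv_iff)
    then have "lv T' \<subseteq> lv T - {l}" using sub by blast
    then have "card (lv T') \<le> card (lv T - {l})" by (intro card_mono) (auto simp: finite_lv)
    then show False using f c5 l by simp
  qed
  then show s2: "dg T s = 2" using ds by simp
  have sW: "s \<in> W" using yz rs by auto
  have sup: "x \<in> lv T'" if x: "x \<in> lv T - {l}" for x
  proof -
    have x1: "x \<in> W" "dg T x = 1" "x \<noteq> l" using x by (auto simp: lv_iff)
    then have "x \<noteq> r" "x \<noteq> s" "x \<noteq> k" using r3 s2 k by auto
    then have "dg T' x = dg T x" using other[of x] x1 rs lk by blast
    then show ?thesis using x1 by (simp add: lv_iff)
  qed
  show lv': "lv T' = insert s (lv T - {l})"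
  proof -
    have "s \<in> lv T'" using s1 sW by (simp add: lv_iff)
    then show ?thesis using sub sup by blast
  qed
  have "s \<notin> lv T" using s2 by (simp add: lv_iff)
  then have "card (lv T') = 5" using lv' c5 l finite_lv by simp
  then show "good T'" using t' by (simp add: good_def)
qed

text \<open>Exchanging the last edge of the leg for the edge from \<open>a\<close> to \<open>p t\<close> makes \<open>p (m - 1)\<close> a leaf
  while \<open>p 0\<close> remains one; both claims are rotations in the new tree.\<close>

lemma leg_pendant:
  assumes g: "good T" and l: "leg T p m" and t: "0 < t" "t < m"
    and a: "a \<in> lv T" "a \<noteq> p 0" "{a, p t} \<in> E"
  shows "{p 0, p (m - 1)} \<notin> E"
    "\<And>s h. t < s \<Longrightarrow> s < m \<Longrightarrow> h \<in> lv T \<Longrightarrow> h \<noteq> a \<Longrightarrow> h \<noteq> p 0 \<Longrightarrow> {h, p s} \<in> E \<Longrightarrow> {p 0, p (s - 1)} \<notin> E"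
proof -
  have t1: "Suc t < m" using leg_adj(2)[OF g l t(2) a] .
  have m: "Suc (m - 1) = m" using t by simp
  have cu: "cut W T (p ` {..m - 1}) (p (m - 1)) (p m)"
    using leg_cut[OF g l, of "m - 1"] m by simp
  have aA: "a \<in> W - p ` {..m - 1}" "a \<noteq> p m"
    using leaf_off_leg[OF l a(1,2), of "{..m - 1}"] leaf_not_on_leg[OF l a(1,2)] by simp_all
  let ?T = "insert {p t, a} (T - {{p (m - 1), p m}})"
  have pt: "p t \<in> p ` {..m - 1}" "p t \<noteq> p (m - 1)" "2 \<le> dg T (p t)" "{p t, a} \<in> E"
    using t1 leg_inj[OF l, of t "m - 1"] leg_dg(1)[OF l t(2)] t a(3) edge_sym by auto
  have "p m = p (m - 1) \<and> p (m - 1) = p m \<or> p m = p m \<and> p (m - 1) = p (m - 1)"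
    "a = p t \<and> p t = a \<or> a = a \<and> p t = p t" by simp_all
  note at = attach[OF g cu pt(1) aA(1) pt(4) this(1) leg_dg(2)[OF l] this(2) a(1) pt(3,2) aA(2)]
  have lvs: "p 0 \<in> lv ?T" using at(3) leg_leaf[OF g l] a(2) by auto
  have "p (m - 1) \<in> lv ?T" using at(3) by auto
  then show "{p 0, p (m - 1)} \<notin> E" using leaves_nonadj[OF at(2) lvs] by blast
  fix s h assume s: "t < s" "s < m" and h: "h \<in> lv T" "h \<noteq> a" "h \<noteq> p 0" "{h, p s} \<in> E"
  let ?B = "p ` {s..m - 1}"
  have BW: "?B \<subseteq> W" using leg_in_W[OF g l] m by auto
  have pB: "p i \<notin> ?B" if "i < s" for i using leg_notin_image[OF l, of "{s..m - 1}" i] that s by auto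
  have pmB: "p m \<notin> ?B" using leg_notin_image[OF l, of "{s..m - 1}" m] s by auto
  have s1: "Suc (s - 1) = s" using s by simp
  have cB: "cut W ?T ?B (p s) (p (s - 1))"
    unfolding cut_def
  proof (intro conjI ballI impI)
    show "?B \<subseteq> W" by (rule BW)
    show "p s \<in> ?B" using s by auto
    show "p (s - 1) \<in> W - ?B" using pB[of "s - 1"] leg_in_W[OF g l, of "s - 1"] s by auto
    have "{p (s - 1), p s} \<in> T" using leg_edge[OF l, of "s - 1"] s s1 by simp
    moreover have "{p (s - 1), p s} \<noteq> {p (m - 1), p m}"
      using leg_inj[OF l, of s "m - 1"] leg_inj[OF l, of "s - 1" m] leg_inj[OF l, of s m] s
      by (auto simp: doubleton_eq_iff)
    ultimately show "{p s, p (s - 1)} \<in> ?T" by (simp add: insert_commute)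
    fix x y assume xy: "x \<in> ?B" "y \<in> W - ?B" "{x, y} \<in> ?T"
    have "x \<noteq> p t" "x \<noteq> a"
      using pB[OF s(1)] leaf_off_leg[OF l a(1,2), of "{s..m - 1}"] xy(1) by (blast, force)
    then have "{x, y} \<noteq> {p t, a}" by (auto simp: doubleton_eq_iff)
    then have xyT: "{x, y} \<in> T" "{x, y} \<noteq> {p (m - 1), p m}" using xy(3) by auto
    obtain i where i: "x = p i" "s \<le> i" "i \<le> m - 1" using xy(1) by auto
    have "y = p (Suc i) \<or> (\<exists>j. i = Suc j \<and> y = p j)" using leg_nb[OF l, of i y] i xyT(1) s by simp
    then have "i = s \<and> y = p (s - 1)"
    proof
      assume y: "y = p (Suc i)"
      then have "\<not> Suc i \<le> m - 1" using xy(2) i by auto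
      then have "i = m - 1" using i by simp
      then show ?thesis using xyT(2) y i(1) m by simp
    next
      assume "\<exists>j. i = Suc j \<and> y = p j"
      then obtain j where j: "i = Suc j" "y = p j" by blast
      then have "\<not> s \<le> j" using xy(2) i by auto
      then have "s = i" using j i by simp
      then show ?thesis using j by simp
    qed
    then show "x = p s" "y = p (s - 1)" using i by auto
  qed
  have hB: "h \<in> W - ?B" "h \<noteq> p (s - 1)"
    using leaf_off_leg[OF l h(1,3), of "{s..m - 1}"] leaf_not_on_leg[OF l h(1,3)] s by auto
  have hl: "h \<in> lv ?T" using at(3) h by auto
  show "{p 0, p (s - 1)} \<notin> E"
    using rotate_nonadj[OF at(2) cut_compl[OF cB] hl hB h(4) lvs] h(3) edge_sym by blast
qed

end

section \<open>Counting leaf neighbours along a whole leg\<close>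

lemma sum_lessThan_add: "(\<Sum>i<a + b. f i) = (\<Sum>i<a. f i) + (\<Sum>i<b. f (a + i :: nat) :: nat)"
  by (induction b) auto

context tight
begin

definition leg_count :: "'a set set \<Rightarrow> (nat \<Rightarrow> 'a) \<Rightarrow> nat \<Rightarrow> nat" where
  "leg_count T p m = (\<Sum>i<m. card (nl T (p i)))"

lemma card_nl_split:
  assumes "good T" "leg T p m"
  shows "card (nl T x) = card (nl T x - {p 0}) + (if {p 0, x} \<in> E then 1 else 0)"
proof (cases "{p 0, x} \<in> E")
  case True
  then have p: "p 0 \<in> nl T x" using leg_leaf[OF assms] by (simp add: nl_iff)
  then show ?thesis using True card_Suc_Diff1[OF finite_nl p] by simp
next
  case False
  then have "nl T x - {p 0} = nl T x" by (auto simp: nl_iff)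
  then show ?thesis using False by simp
qed

lemma nl_singleton_le:
  assumes "\<And>v. v \<in> nl T x \<Longrightarrow> v = u" shows "card (nl T x) \<le> 1"
proof -
  have "nl T x \<subseteq> {u}" using assms by blast
  then have "card (nl T x) \<le> card {u}" by (intro card_mono) auto
  then show ?thesis by simp
qed

text \<open>A leaf other than \<open>p 0\<close> at \<open>p i\<close> bars \<open>p 0\<close> from
  \<open>p (Suc i)\<close>, so the possible edge from \<open>p 0\<close> to \<open>p (Suc i)\<close>
  is booked together with the other leaves at \<open>p i\<close>. The other leaves at
  \<open>p r\<close> stay unpaired and form the extra term.\<close>

lemma leg_prefix_sum:
  assumes g: "good T" and l: "leg T p m" and r: "r < m"
    and nofull: "\<And>t. t < r \<Longrightarrow> {p 0, p t} \<in> E \<Longrightarrow> card (nl T (p t) - {p 0}) \<le> 1"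
  shows "(\<Sum>i\<le>r. card (nl T (p i))) \<le> r + card (nl T (p r) - {p 0})"
proof -
  define o' where "o' i = card (nl T (p i) - {p 0})" for i
  define a where "a i = (if {p 0, p i} \<in> E then 1 else 0 :: nat)" for i
  have sp: "card (nl T (p i)) = o' i + a i" for i
    unfolding o'_def a_def using card_nl_split[OF g l] .
  have a0: "a 0 = 0" using edge_irrefl[of "p 0"] by (simp add: a_def)
  have o2: "o' i \<le> 2" if "i < m" for i unfolding o'_def using leg_others_le_two[OF g l that] .
  have o0: "o' 0 = 0"
  proof -
    have "nl T (p 0) = {}" using leaves_nonadj[OF g _ leg_leaf[OF g l]] by (auto simp: nl_iff)
    then show ?thesis by (simp add: o'_def)
  qed
  have ex: "\<exists>u. u \<in> lv T \<and> u \<noteq> p 0 \<and> {u, p i} \<in> E" if "o' i \<noteq> 0" for i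
  proof -
    have "nl T (p i) - {p 0} \<noteq> {}" using that unfolding o'_def by (metis card.empty)
    then show ?thesis by (auto simp: nl_iff)
  qed
  have oa: "a (Suc i) = 0" if im: "i < m" and oi: "o' i \<noteq> 0" for i
  proof -
    obtain u where u: "u \<in> lv T" "u \<noteq> p 0" "{u, p i} \<in> E" using ex[OF oi] by blast
    then show ?thesis using leg_adj(3)[OF g l im u leg_leaf[OF g l]] by (auto simp: a_def)
  qed
  have oo: "o' (Suc i) \<le> 1" if im: "i < m" and oi: "o' i \<noteq> 0" for i
  proof -
    obtain u where u: "u \<in> lv T" "u \<noteq> p 0" "{u, p i} \<in> E" using ex[OF oi] by blast
    have "nl T (p (Suc i)) - {p 0} \<subseteq> {u}" using leg_adj(3)[OF g l im u] by (auto simp: nl_iff)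
    then have "card (nl T (p (Suc i)) - {p 0}) \<le> card {u}" by (intro card_mono) auto
    then show ?thesis by (simp add: o'_def)
  qed
  have "(\<Sum>i<r. o' i + a (Suc i)) \<le> r"
  proof (rule sum_le_pred_zero[of r "\<lambda>i. o' i + a (Suc i)"])
    show "o' i + a (Suc i) \<le> 2" if "i < r" for i
      using o2[of i] oa[of i] that r by (cases "o' i = 0") (auto simp: a_def)
    show "o' 0 + a (Suc 0) \<le> 1" using o0 by (simp add: a_def)
    \<comment> \<open>A two consists of two other leaves at \<open>p (Suc i)\<close>. They leave no
      other leaf at \<open>p i\<close>, and \<open>nofull\<close> excludes \<open>p 0\<close> from
      \<open>p (Suc i)\<close>, so the preceding pair is empty.\<close>
    fix i assume i: "Suc i < r" and e: "o' (Suc i) + a (Suc (Suc i)) = 2"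
    have "o' (Suc i) \<noteq> 0" using e by (auto simp: a_def split: if_splits)
    then have "a (Suc (Suc i)) = 0" using oa[of "Suc i"] i r by simp
    then have os: "o' (Suc i) = 2" using e by simp
    then have "o' i = 0" using oo[of i] i r by (cases "o' i = 0") auto
    moreover have "{p 0, p (Suc i)} \<notin> E" using nofull[of "Suc i"] i os by (auto simp: o'_def)
    ultimately show "o' i + a (Suc i) = 0" by (simp add: a_def)
  qed simp
  moreover have "(\<Sum>i\<le>r. a i) = (\<Sum>i<r. a (Suc i))"
    by (metis a0 add_0 lessThan_Suc_atMost sum.lessThan_Suc_shift)
  moreover have "(\<Sum>i\<le>r. o' i) = (\<Sum>i<r. o' i) + o' r"
    by (metis lessThan_Suc_atMost sum.lessThan_Suc)
  ultimately show ?thesis by (simp add: sp sum.distrib o'_def)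
qed

lemma leg_suffix:
  assumes g: "good T" and l: "leg T p m" and t: "0 < t" "t < m"
    and full: "{p 0, p t} \<in> E" "2 \<le> card (nl T (p t) - {p 0})"
  shows "nl T (p (Suc t)) = {}" "nl T (p (m - 1)) = {}" "Suc t < m"
    and "\<And>s. t < s \<Longrightarrow> s < m \<Longrightarrow> card (nl T (p s)) \<le> 2"
    and "\<And>s. t < s \<Longrightarrow> Suc s < m \<Longrightarrow> card (nl T (p s)) = 2 \<Longrightarrow> nl T (p (Suc s)) = {}"
    and "\<And>s. t < s \<Longrightarrow> Suc s < m \<Longrightarrow> card (nl T (p (Suc s))) = 2 \<Longrightarrow> nl T (p s) = {}"
proof -
  let ?v = "p 0"
  have v: "?v \<in> lv T" using leg_leaf[OF g l] .
  have pick: "\<exists>a. a \<in> lv T \<and> a \<noteq> ?v \<and> a \<noteq> h \<and> {a, p t} \<in> E" for h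
  proof (rule ccontr)
    assume "\<not> ?thesis"
    then have "nl T (p t) - {p 0} \<subseteq> {h}" by (auto simp: nl_iff)
    then have "card (nl T (p t) - {p 0}) \<le> card {h}" by (intro card_mono) auto
    then show False using full by simp
  qed
  obtain a where a: "a \<in> lv T" "a \<noteq> ?v" "{a, p t} \<in> E" using pick by blast
  obtain b where b: "b \<in> lv T" "b \<noteq> ?v" "b \<noteq> a" "{b, p t} \<in> E" using pick by blast
  show t1: "Suc t < m" using leg_adj(2)[OF g l t(2) a] .
  show "nl T (p (Suc t)) = {}"
  proof -
    have "w \<notin> nl T (p (Suc t))" for w
      using leg_adj(3)[OF g l t(2) a, of w] leg_adj(3)[OF g l t(2) b(1,2,4), of w] b(3)
      by (auto simp: nl_iff)
    then show ?thesis by blast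
  qed
  have up: "{w, p (Suc s)} \<notin> E" if "s < m" "u \<in> nl T (p s)" "u \<noteq> ?v" "w \<in> lv T" "w \<noteq> u" for s u w
    using leg_adj(3)[OF g l that(1), of u w] that by (auto simp: nl_iff)
  have dn: "{?v, p s} \<notin> E" if s: "t < Suc s" "Suc s < m" "h \<in> nl T (p (Suc s))" "h \<noteq> ?v" for s h
  proof -
    obtain c where c: "c \<in> lv T" "c \<noteq> ?v" "c \<noteq> h" "{c, p t} \<in> E" using pick by blast
    show ?thesis using leg_pendant(2)[OF g l t c(1,2,4), of "Suc s" h] s c by (auto simp: nl_iff)
  qed
  show "nl T (p (m - 1)) = {}"
  proof -
    have "w \<notin> nl T (p (m - 1))" if "w \<noteq> ?v" for w
      using leg_adj(2)[OF g l, of "m - 1" w] that t by (auto simp: nl_iff)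
    moreover have "?v \<notin> nl T (p (m - 1))" using leg_pendant(1)[OF g l t a] by (simp add: nl_iff)
    ultimately show ?thesis by (metis equals0I)
  qed
  have others: "card (nl T (p s) - {?v}) \<le> 2" if "s < m" for s using leg_others_le_two[OF g l that] .
  have pr: "\<exists>u\<in>nl T (p s). u \<noteq> h" if c: "card (nl T (p s)) = 2" for s h
  proof (rule ccontr)
    assume "\<not> ?thesis"
    then have "card (nl T (p s)) \<le> 1" by (intro nl_singleton_le) blast
    then show False using c by simp
  qed
  show "nl T (p (Suc s)) = {}" if s: "t < s" "Suc s < m" "card (nl T (p s)) = 2" for s
  proof -
    have "w \<notin> nl T (p (Suc s))" for w
    proof
      assume w: "w \<in> nl T (p (Suc s))"
      obtain u where u: "u \<in> nl T (p s)" "u \<noteq> ?v" using pr[OF s(3)] by blast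
      have wu: "w = u" using up[of s u w] u w s by (auto simp: nl_iff)
      obtain u' where u': "u' \<in> nl T (p s)" "u' \<noteq> u" using pr[OF s(3)] by blast
      have "u' = ?v"
      proof (rule ccontr)
        assume "u' \<noteq> ?v"
        then show False using up[of s u' w] u' w wu s by (auto simp: nl_iff)
      qed
      moreover have "{?v, p s} \<notin> E" using dn[of s w] s w wu u by simp
      ultimately show False using u' by (simp add: nl_iff)
    qed
    then show ?thesis by blast
  qed
  show "nl T (p s) = {}" if s: "t < s" "Suc s < m" "card (nl T (p (Suc s))) = 2" for s
  proof -
    obtain h where h: "h \<in> nl T (p (Suc s))" "h \<noteq> ?v" using pr[OF s(3)] by blast
    have "w \<notin> nl T (p s)" for w
    proof
      assume w: "w \<in> nl T (p s)"
      have wv: "w \<noteq> ?v" using dn[of s h] s h w by (auto simp: nl_iff)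
      obtain u where u: "u \<in> nl T (p (Suc s))" "u \<noteq> w" using pr[OF s(3)] by blast
      then show False using up[of s w u] w wv s by (auto simp: nl_iff)
    qed
    then show ?thesis by blast
  qed
  show "card (nl T (p s)) \<le> 2" if s: "t < s" "s < m" for s
  proof (rule ccontr)
    assume n: "\<not> ?thesis"
    have sp: "card (nl T (p s)) = card (nl T (p s) - {?v}) + (if {?v, p s} \<in> E then 1 else 0)"
      using card_nl_split[OF g l] .
    then have e: "{?v, p s} \<in> E" and c2: "2 \<le> card (nl T (p s) - {?v})"
      using n others[OF s(2)] by (auto split: if_splits)
    \<comment> \<open>Three leaves at \<open>p s\<close> include \<open>p 0\<close> and two others;
      \<open>leg_full_vertex\<close> then joins \<open>p 0\<close> to the preceding vertex, which
      \<open>dn\<close> forbids. The index shift is legitimate since \<open>s\<close> exceeds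
      \<open>t\<close>, which is positive.\<close>
    have "s = Suc (Suc (s - 2))" using s t by simp
    then obtain r where r: "s = Suc (Suc r)" by blast
    have "{?v, p (Suc r)} \<in> E" using leg_full_vertex[OF g l _ _ ] s r c2 e by blast
    moreover have "nl T (p s) - {?v} \<noteq> {}"
    proof
      assume "nl T (p s) - {?v} = {}"
      then have "card (nl T (p s) - {?v}) = 0" by (simp only: card.empty)
      then show False using c2 by simp
    qed
    then obtain h where "h \<in> nl T (p s) - {?v}" by blast
    ultimately show False using dn[of "Suc r" h] s r by simp
  qed
qed

text \<open>The leg is divided after its first vertex \<open>p t\<close> adjacent to
  \<open>p 0\<close> and to two other leaves. If there is none, the prefix estimate gives
  \<open>m - 1\<close>. Otherwise the prefix contributes at most \<open>t + 2\<close>, and the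
  \<open>r + 1\<close> vertices after it at most \<open>r\<close>, where
  \<open>m = t + r + 2\<close>.\<close>

lemma leg_count_bound:
  assumes g: "good T" and l: "leg T p m"
  shows "leg_count T p m \<le> m - 1 \<or>
    leg_count T p m = m \<and> 2 \<le> m \<and> nl T (p (m - 1)) = {} \<and> nl T (p (m - 2)) - {p 0} \<noteq> {} \<and>
    (\<exists>t<m. 2 \<le> card (nl T (p t) - {p 0}))"
proof -
  let ?v = "p 0"
  have v: "?v \<in> lv T" using leg_leaf[OF g l] .
  have m1: "1 \<le> m" using leg_dg(3)[OF l] .
  let ?F = "\<lambda>t. t < m \<and> {?v, p t} \<in> E \<and> 2 \<le> card (nl T (p t) - {?v})"
  show ?thesis
  proof (cases "\<exists>t. ?F t")
    case False
    have "w = ?v" if "w \<in> nl T (p (m - 1))" for w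
      using leg_adj(2)[OF g l, of "m - 1" w] m1 that by (auto simp: nl_iff)
    then have "nl T (p (m - 1)) - {?v} = {}" by blast
    then have z: "card (nl T (p (m - 1)) - {?v}) = 0" by (simp only: card.empty)
    have "card (nl T (p t) - {p 0}) \<le> 1" if "t < m - 1" "{p 0, p t} \<in> E" for t
    proof -
      have "t < m" using that by simp
      then have "\<not> 2 \<le> card (nl T (p t) - {p 0})" using False that by blast
      then show ?thesis by simp
    qed
    then have "(\<Sum>i\<le>m - 1. card (nl T (p i))) \<le> m - 1"
      using leg_prefix_sum[OF g l, of "m - 1"] m1 z by simp
    moreover have "{..<m} = {..m - 1}" using m1 by auto
    ultimately show ?thesis by (simp add: leg_count_def)
  next
    case True
    define t where "t = (LEAST t. ?F t)"
    have t: "t < m" "{?v, p t} \<in> E" "2 \<le> card (nl T (p t) - {?v})"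
      using LeastI_ex[OF True] by (auto simp: t_def)
    have least: "\<not> ?F s" if "s < t" for s using not_less_Least[of s ?F] that by (simp add: t_def)
    have t0: "0 < t" using t(2) edge_irrefl by (cases t) auto
    note suf = leg_suffix[OF g l t0 t]
    have o2: "card (nl T (p t) - {?v}) = 2" using t(3) leg_others_le_two[OF g l t(1)] by simp
    have pre: "(\<Sum>i\<le>t. card (nl T (p i))) \<le> t + 2"
    proof -
      have "card (nl T (p s) - {p 0}) \<le> 1" if "s < t" "{p 0, p s} \<in> E" for s
        using least[OF that(1)] that t(1) by simp
      then show ?thesis using leg_prefix_sum[OF g l t(1)] o2 by simp
    qed
    define f where "f k = card (nl T (p (Suc t + k)))" for k
    obtain r where r: "m = Suc t + Suc r" using suf(3) by (metis less_iff_Suc_add add_Suc add_Suc_right)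
    have split: "leg_count T p m = (\<Sum>i\<le>t. card (nl T (p i))) + (\<Sum>k\<le>r. f k)"
    proof -
      have "leg_count T p m = (\<Sum>i<Suc t. card (nl T (p i))) + (\<Sum>k<Suc r. card (nl T (p (Suc t + k))))"
        unfolding leg_count_def r by (rule sum_lessThan_add)
      then show ?thesis by (simp only: lessThan_Suc_atMost f_def)
    qed
    have iso: "k \<le> r \<Longrightarrow> (\<Sum>i\<le>k. f i) + (if f k = 2 then 0 else 1) \<le> Suc k" for k
    proof (rule sum_isolated_twos)
      show "f i \<le> 2" if "i \<le> r" for i using suf(4)[of "Suc t + i"] that r by (simp add: f_def)
      show "f 0 = 0" using suf(1) by (simp add: f_def)
      show "f (Suc i) = 0" if "Suc i \<le> r" "f i = 2" for i
        using suf(5)[of "Suc t + i"] that r by (simp add: f_def)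
      show "f i = 0" if "Suc i \<le> r" "f (Suc i) = 2" for i
        using suf(6)[of "Suc t + i"] that r by (simp add: f_def)
    qed
    have fr: "f r = 0" using suf(2) r by (simp add: f_def)
    \<comment> \<open>The suffix ends as well as starts with a zero, which leaves the saved unit
      unspent.\<close>
    have sr: "(\<Sum>k\<le>r. f k) \<le> r" using iso[of r] fr by simp
    have le: "leg_count T p m \<le> m" using split pre sr r by simp
    show ?thesis
    proof (cases "leg_count T p m = m")
      case False then show ?thesis using le by auto
    next
      case eq: True
      then have sr': "(\<Sum>k\<le>r. f k) = r" using split pre sr r by simp
      have "nl T (p (m - 2)) - {?v} \<noteq> {}"
      proof (cases r)
        case 0
        then have "m - 2 = t" using r by simp
        then show ?thesis using o2 by (metis card.empty zero_neq_numeral)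
      next
        case (Suc r')
        have "(\<Sum>k\<le>r'. f k) = Suc r'" using sr' fr Suc by simp
        \<comment> \<open>Equality means that the saved unit is spent just before the final zero, so
          \<open>p (m - 2)\<close> has two leaf neighbours, one of them other than
          \<open>p 0\<close>.\<close>
        then have "f r' = 2" using iso[of r'] Suc by (auto split: if_splits)
        moreover have "Suc t + r' = m - 2" using r Suc by simp
        ultimately have "card (nl T (p (m - 2))) = 2" by (simp add: f_def)
        then have "card (nl T (p (m - 2)) - {?v}) \<noteq> 0"
          using card_nl_split[OF g l, of "p (m - 2)"] by (auto split: if_splits)
        then show ?thesis by (metis card.empty)
      qed
      then show ?thesis using eq suf(2) r t(1,3) by auto
    qed
  qed
qed

text \<open>A rotation at \<open>p (m - 2)\<close> turns \<open>p (m - 1)\<close> into a leaf. An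
  edge from it to \<open>z\<close> would allow a second rotation removing the edge from
  \<open>p m\<close> to \<open>z\<close>, which requires degree two at the branch vertex
  \<open>p m\<close>.\<close>

lemma leg_end_nonadj:
  assumes g: "good T" and l: "leg T p m" and m: "2 \<le> m"
    and u: "u \<in> nl T (p (m - 2))" "u \<noteq> p 0"
    and z: "{p m, z} \<in> T" "z \<noteq> p (m - 1)"
  shows "{p (m - 1), z} \<notin> E"
proof
  assume e: "{p (m - 1), z} \<in> E"
  have ul: "u \<in> lv T" "{u, p (m - 2)} \<in> E" using u by (auto simp: nl_iff)
  have s: "Suc (m - 2) = m - 1" "Suc (m - 1) = m" using m by auto
  have cu: "cut W T (W - p ` {..m - 2}) (p (m - 1)) (p (m - 2))"
    using cut_compl[OF leg_cut[OF g l, of "m - 2"]] m s by simp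
  have uA: "u \<in> W - p ` {..m - 2}" using leaf_off_leg[OF l ul(1) u(2), of "{..m - 2}"] by simp
  have uy: "u \<noteq> p (m - 1)" "u \<noteq> p m" using leaf_not_on_leg[OF l ul(1) u(2)] by auto
  note r = rotate[OF g cu ul(1) uA uy(1) ul(2)]
  let ?T = "insert {u, p (m - 2)} (T - {{p (m - 1), p (m - 2)}})"
  have d: "p m \<noteq> p (m - 1)" "p m \<noteq> p (m - 2)" using leg_inj[OF l, of m "m - 1"] leg_inj[OF l, of m "m - 2"] m by auto
  have e1: "{p m, z} \<in> ?T" using z d by (auto simp: doubleton_eq_iff)
  have "{p (m - 1), p m} \<in> T" using leg_edge[OF l, of "m - 1"] s m by simp
  then have e2: "{p (m - 1), p m} \<in> ?T" using d by (auto simp: doubleton_eq_iff)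
  obtain A where A: "cut W ?T A (p m) z" using tree_on_cut[OF good_tree[OF r(2)] e1] .
  have wl: "p (m - 1) \<in> lv ?T" using r(3) by simp
  have "p (m - 1) \<in> A"
  proof (rule ccontr)
    assume "p (m - 1) \<notin> A"
    then have "p (m - 1) \<in> W - A" using wl by (simp add: lv_iff)
    moreover have "{p m, p (m - 1)} \<in> ?T" using e2 by (simp add: insert_commute)
    ultimately have "p (m - 1) = z" using A unfolding cut_def by blast
    then show False using z by simp
  qed
  from rotate(1)[OF r(2) A wl this d(1)[symmetric] e] have "dg ?T (p m) = 2" .
  then show False using r(4)[of "p m"] uy d leg_dg(2)[OF l] by simp
qed

end

section \<open>Trees with a maximal leg region\<close>

lemma preleg_transfer:
  assumes "preleg T r k" "\<And>i. i \<le> k \<Longrightarrow> dg T' (r i) = dg T (r i)" "\<And>i. i < k \<Longrightarrow> {r i, r (Suc i)} \<in> T'"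
  shows "preleg T' r k"
  using assms by (simp add: preleg_def)

lemma leg_transfer:
  assumes "leg T r k" "\<And>i. i \<le> k \<Longrightarrow> dg T' (r i) = dg T (r i)" "\<And>i. i < k \<Longrightarrow> {r i, r (Suc i)} \<in> T'"
  shows "leg T' r k"
  using assms by (simp add: leg_def thread_def)

lemma preleg_region: "preleg T p k \<Longrightarrow> i \<le> k \<Longrightarrow> p i \<in> leg_region T"
  by (auto simp: leg_region_def)

context tight
begin

text \<open>By \<open>legs_eq\<close> a leg is determined by its leaf, so the choice is immaterial
  up to index \<open>legm T u\<close>; later values are arbitrary.\<close>

definition legp :: "'a set set \<Rightarrow> 'a \<Rightarrow> nat \<Rightarrow> 'a" where
  "legp T u = (SOME p. \<exists>m. leg T p m \<and> p 0 = u)"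

definition legm :: "'a set set \<Rightarrow> 'a \<Rightarrow> nat" where
  "legm T u = (SOME m. leg T (legp T u) m)"

definition base :: "'a set set \<Rightarrow> 'a \<Rightarrow> 'a" where
  "base T u = legp T u (legm T u)"

definition leg_verts :: "'a set set \<Rightarrow> 'a \<Rightarrow> 'a set" where
  "leg_verts T u = legp T u ` {..<legm T u}"

definition inner :: "'a set set \<Rightarrow> 'a set" where
  "inner T = W - leg_region T"

definition best :: "'a set set \<Rightarrow> bool" where
  "best T \<longleftrightarrow> good T \<and> (\<forall>T'. good T' \<longrightarrow> card (leg_region T') \<le> card (leg_region T))"

lemma leg_legp:
  assumes "good T" "u \<in> lv T"
  shows "leg T (legp T u) (legm T u)" "legp T u 0 = u"
proof -
  have "\<exists>p m. leg T p m \<and> p 0 = u" using leg_exists[OF assms] by metis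
  then have p: "\<exists>m. leg T (legp T u) m \<and> legp T u 0 = u"
    unfolding legp_def by (rule someI_ex)
  then show "legp T u 0 = u" by blast
  have "\<exists>m. leg T (legp T u) m" using p by blast
  then show "leg T (legp T u) (legm T u)" unfolding legm_def by (rule someI_ex)
qed

lemma leg_unique:
  assumes g: "good T" and l: "leg T p m"
  shows "legm T (p 0) = m" "i \<le> m \<Longrightarrow> legp T (p 0) i = p i" "base T (p 0) = p m"
    "leg_verts T (p 0) = p ` {..<m}"
proof -
  note L = leg_legp[OF g leg_leaf[OF g l]]
  show m: "legm T (p 0) = m" using legs_eq(1)[OF L(1) l L(2)] .
  show e: "legp T (p 0) i = p i" if "i \<le> m" for i using legs_eq(2)[OF L(1) l L(2)] m that by simp
  show "base T (p 0) = p m" using e[of m] m by (simp add: base_def)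
  show "leg_verts T (p 0) = p ` {..<m}" using e m by (auto simp: leg_verts_def)
qed

lemma leg_region_eq:
  assumes g: "good T"
  shows "leg_region T = (\<Union>u\<in>lv T. leg_verts T u)"
proof
  show "(\<Union>u\<in>lv T. leg_verts T u) \<subseteq> leg_region T"
  proof
    fix x assume "x \<in> (\<Union>u\<in>lv T. leg_verts T u)"
    then obtain u i where u: "u \<in> lv T" "i < legm T u" "x = legp T u i" by (auto simp: leg_verts_def)
    then show "x \<in> leg_region T"
      using preleg_region[OF leg_preleg[OF leg_legp(1)[OF g u(1)]], of i] by simp
  qed
  show "leg_region T \<subseteq> (\<Union>u\<in>lv T. leg_verts T u)"
  proof
    fix x assume "x \<in> leg_region T"
    then obtain q k i where q: "preleg T q k" "i \<le> k" "x = q i" by (auto simp: leg_region_def)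
    have d: "dg T (q 0) = 1" using q by (simp add: preleg_def)
    then obtain y where "{q 0, y} \<in> T" by (metis card_1_singletonE in_nb insertI1)
    then have u: "q 0 \<in> lv T" using d simple_graph_edge(1)[OF good_simple[OF g]] by (simp add: lv_iff)
    note L = leg_legp[OF g u]
    have "i < legm T (q 0) \<and> q i = legp T (q 0) i" using preleg_leg[OF q(1) L(1) L(2)[symmetric] q(2)] .
    then show "x \<in> (\<Union>u\<in>lv T. leg_verts T u)" using u q(3) by (auto simp: leg_verts_def)
  qed
qed

lemma leg_verts_disjoint:
  assumes g: "good T" and u: "u \<in> lv T" and v: "v \<in> lv T" and ne: "u \<noteq> v"
  shows "leg_verts T u \<inter> leg_verts T v = {}" "base T v \<notin> leg_verts T u"
proof -
  have d: "legp T u i \<noteq> legp T v j" if "i < legm T u" "j \<le> legm T v" for i j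
    using legs_disjoint[OF leg_legp(1)[OF g u] leg_legp(1)[OF g v] _ that] leg_legp(2)[OF g u]
      leg_legp(2)[OF g v] ne by simp
  show "leg_verts T u \<inter> leg_verts T v = {}"
    unfolding leg_verts_def using d less_imp_le by blast
  show "base T v \<notin> leg_verts T u"
    unfolding leg_verts_def base_def using d[OF _ order_refl] by (metis imageE lessThan_iff)
qed

lemma base_notin:
  assumes g: "good T" and u: "u \<in> lv T" and v: "v \<in> lv T"
  shows "base T v \<notin> leg_verts T u"
proof (cases "u = v")
  case True
  have "legp T v (legm T v) \<notin> legp T v ` {..<legm T v}"
    by (rule leg_notin_image[OF leg_legp(1)[OF g v]]) auto
  then show ?thesis using True by (simp add: base_def leg_verts_def)
qed (use leg_verts_disjoint(2)[OF g u v] in blast)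

lemma leg_verts_W: "good T \<Longrightarrow> u \<in> lv T \<Longrightarrow> leg_verts T u \<subseteq> W"
  using leg_in_W[OF _ leg_legp(1)] by (auto simp: leg_verts_def)

lemma base_inner:
  assumes g: "good T" and u: "u \<in> lv T" shows "base T u \<in> inner T"
  using base_notin[OF g _ u] leg_in_W[OF g leg_legp(1)[OF g u], of "legm T u"] leg_region_eq[OF g]
  by (auto simp: inner_def base_def)

lemma dg_base: "good T \<Longrightarrow> u \<in> lv T \<Longrightarrow> 3 \<le> dg T (base T u)"
  using leg_dg(2)[OF leg_legp(1)] by (simp add: base_def)

lemma card_leg_verts: "good T \<Longrightarrow> u \<in> lv T \<Longrightarrow> card (leg_verts T u) = legm T u"
  unfolding leg_verts_def using leg_inj[OF leg_legp(1), of T u]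
  by (subst card_image) (auto simp: inj_on_def)

lemma leaf_region:
  assumes "good T" "u \<in> lv T" shows "u \<in> leg_verts T u"
proof -
  have "0 < legm T u" using leg_dg(3)[OF leg_legp(1)[OF assms]] by simp
  then have "legp T u 0 \<in> leg_verts T u" by (simp add: leg_verts_def)
  then show ?thesis using leg_legp(2)[OF assms] by simp
qed

lemma card_leg_region:
  assumes g: "good T" shows "card (leg_region T) = (\<Sum>u\<in>lv T. legm T u)"
  unfolding leg_region_eq[OF g]
  using leg_verts_disjoint(1)[OF g] card_leg_verts[OF g] finite_lv
  by (subst card_UN_disjoint) (auto simp: leg_verts_def)

lemma region_W: "good T \<Longrightarrow> leg_region T \<subseteq> W"
  using leg_verts_W leg_region_eq by blast

lemma inner_dg:
  assumes g: "good T" and x: "x \<in> inner T" shows "2 \<le> dg T x" "x \<notin> lv T"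
proof -
  show "x \<notin> lv T" using x leaf_region[OF g] leg_region_eq[OF g] by (auto simp: inner_def)
  then show "2 \<le> dg T x" using good_dg_pos[OF g, of x] x by (auto simp: lv_iff inner_def)
qed

lemma inner_nb:
  assumes g: "good T" and x: "x \<in> inner T" and e: "{x, y} \<in> T"
  shows "y \<in> inner T \<or> (\<exists>u\<in>lv T. base T u = x \<and> y = legp T u (legm T u - 1))"
proof (cases "y \<in> leg_region T")
  case False
  then show ?thesis using simple_graph_edge(2)[OF good_simple[OF g] e] by (simp add: inner_def)
next
  case True
  then obtain u i where u: "u \<in> lv T" "i < legm T u" "y = legp T u i"
    using leg_region_eq[OF g] by (auto simp: leg_verts_def)
  have nin: "x \<notin> leg_verts T u" using x u leg_region_eq[OF g] by (auto simp: inner_def)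
  have "{legp T u i, x} \<in> T" using e u by (simp add: insert_commute)
  then have "x = legp T u (Suc i) \<or> (\<exists>j. i = Suc j \<and> x = legp T u j)"
    using leg_nb[OF leg_legp(1)[OF g u(1)] u(2)] by blast
  then have "x = legp T u (Suc i)" "Suc i = legm T u"
    using nin u(2) unfolding leg_verts_def by (metis Suc_lessD Suc_lessI imageI lessThan_iff)+
  then have "base T u = x \<and> y = legp T u (legm T u - 1)" using u by (metis base_def diff_Suc_1)
  then show ?thesis using u(1) by blast
qed

text \<open>Otherwise an exchange at \<open>p m\<close> would add \<open>p m\<close> to the leg of \<open>q 0\<close> and enlarge the leg region.\<close>

lemma best_leaf_inner:
  assumes b: "best T" and p: "leg T p m" and q: "leg T q k" and pq: "p 0 \<noteq> q 0" "p m = q k"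
    and d3: "dg T (p m) = 3" and s: "s \<in> inner T" "s \<noteq> p m"
  shows "{p 0, s} \<notin> E"
proof
  assume e: "{p 0, s} \<in> E"
  have g: "good T" using b by (simp add: best_def)
  have m1: "1 \<le> m" "Suc (m - 1) = m" using leg_dg(3)[OF p] by simp_all
  let ?A = "p ` {..m - 1}"
  have A: "?A = p ` {..<m}" using m1 by (auto simp: image_iff Bex_def)
  have cu: "cut W T ?A (p (m - 1)) (p m)" using leg_cut[OF g p, of "m - 1"] m1 by simp
  have reg: "x \<in> leg_region T" if "x \<in> ?A" for x
    using that A leg_unique(4)[OF g p] leg_leaf[OF g p] leg_region_eq[OF g] by blast
  have aA: "p 0 \<in> ?A" by simp
  have bA: "s \<in> W - ?A" using s reg by (auto simp: inner_def)
  let ?T = "insert {p 0, s} (T - {{p (m - 1), p m}})"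
  have ne1: "p 0 \<noteq> p (m - 1) \<or> s \<noteq> p m" using s by simp
  have d: "dg ?T x + (if x = p (m - 1) \<or> x = p m then 1 else 0) = dg T x + (if x = p 0 \<or> x = s then 1 else 0)" for x
    using cut_swap_dg[OF good_tree[OF g] cu aA bA ne1] .
  have t': "tree_on E W ?T" using cut_swap_tree[OF good_tree[OF g] cu aA bA e] .
  have ds: "2 \<le> dg T s" using inner_dg(1)[OF g s(1)] .
  have p0: "p 0 \<in> lv T" using leg_leaf[OF g p] .
  have dp0: "dg T (p 0) = 1" using p0 by (simp add: lv_iff)
  have sA: "s \<noteq> p i" if "i < m" for i using bA that A by auto
  have pmA: "p m \<noteq> p i" if "i < m" for i using leg_inj[OF p, of m i] that by simp
  have dpm: "dg ?T (p m) = 2" using d[of "p m"] d3 s pmA[of 0] m1 by simp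
  have dend: "dg ?T (p (m - 1)) = 1"
  proof (cases "m = 1")
    case True then show ?thesis using d[of "p 0"] dp0 by simp
  next
    case False
    then have "p (m - 1) \<noteq> p 0" "dg T (p (m - 1)) = 2"
      using leg_inj[OF p, of "m - 1" 0] leg_dg(1)[OF p, of "m - 1"] m1 by auto
    then show ?thesis using d[of "p (m - 1)"] sA[of "m - 1"] m1 by simp
  qed
  have dstart: "dg ?T (p 0) = 2" if "m \<noteq> 1"
  proof -
    have "p 0 \<noteq> p (m - 1)" using leg_inj[OF p, of 0 "m - 1"] that m1 by auto
    then show ?thesis using d[of "p 0"] dp0 pmA[of 0] m1 by simp
  qed
  have same: "dg ?T x = dg T x" if "x \<noteq> p (m - 1)" "x \<noteq> p m" "x \<noteq> p 0" "x \<noteq> s" for x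
    using d[of x] that by simp
  have dsT: "2 \<le> dg ?T s" using d[of s] ds sA[of "m - 1"] m1 s by simp
  have endW: "p (m - 1) \<in> W" using leg_in_W[OF g p, of "m - 1"] m1 by simp
  have lvT: "lv ?T = insert (p (m - 1)) (lv T - {p 0})"
  proof (intro set_eqI)
    fix x
    consider "x = p (m - 1)" | "x = p m" | "x = p 0" "x \<noteq> p (m - 1)" | "x = s" 
      | "x \<noteq> p (m - 1)" "x \<noteq> p m" "x \<noteq> p 0" "x \<noteq> s" by blast
    then show "x \<in> lv ?T \<longleftrightarrow> x \<in> insert (p (m - 1)) (lv T - {p 0})"
    proof cases
      case 1 then show ?thesis using dend endW by (simp add: lv_iff)
    next
      case 2 then show ?thesis using dpm d3 pmA[of "m - 1"] m1 by (auto simp: lv_iff)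
    next
      case 3
      then have "m \<noteq> 1" by auto
      then show ?thesis using 3 dstart by (simp add: lv_iff)
    next
      case 4 then show ?thesis using dsT ds sA[of "m - 1"] m1 by (auto simp: lv_iff)
    next
      case 5 then show ?thesis using same[of x] by (simp add: lv_iff)
    qed
  qed
  have "p (m - 1) \<notin> lv T - {p 0}"
    using leg_dg(1)[OF p, of "m - 1"] m1 by (auto simp: lv_iff split: if_splits)
  then have "card (lv ?T) = 5" using lvT g p0 finite_lv by (simp add: good_def)
  then have g': "good ?T" using t' by (simp add: good_def)
  have pmreg: "p m \<notin> leg_region T"
    using base_inner[OF g p0] leg_unique(3)[OF g p] by (simp add: inner_def)
  have edge: "{x, y} \<in> ?T" if "{x, y} \<in> T" "x \<notin> ?A" "y \<noteq> p m \<or> x \<noteq> p (m - 1)" "x \<noteq> p (m - 1)" "y \<noteq> p (m - 1)" for x y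
    using that by (auto simp: doubleton_eq_iff)
  have other: "i < n \<Longrightarrow> dg ?T (r i) = dg T (r i)" "i < n \<Longrightarrow> {r i, r (Suc i)} \<in> ?T"
    if r: "leg T r n" "r 0 \<noteq> p 0" for r n i
  proof -
    have rp: "r j \<noteq> p i" if "j < n" "i \<le> m" for i j
      using legs_disjoint[OF r(1) p r(2) that] .
    have rp': "p i \<noteq> r j" if "j \<le> n" "i < m" for i j
      using legs_disjoint[OF p r(1) r(2)[symmetric] that(2,1)] .
    have rs: "r j \<noteq> s" if "j < n" for j
      using that s leg_unique(4)[OF g r(1)] leg_leaf[OF g r(1)] leg_region_eq[OF g]
      by (auto simp: inner_def)
    show "dg ?T (r i) = dg T (r i)" if "i < n"
      using same[of "r i"] rp[OF that] rs[OF that] m1 by simp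
    show "{r i, r (Suc i)} \<in> ?T" if "i < n"
    proof -
      have "r i \<noteq> p (m - 1)" "r i \<noteq> p m" using rp[OF that] by simp_all
      then have "{r i, r (Suc i)} \<noteq> {p (m - 1), p m}" by (auto simp: doubleton_eq_iff)
      then show ?thesis using leg_edge[OF r(1) that] by simp
    qed
  qed
  have pre: "preleg ?T r (n - 1)" if r: "leg T r n" "r 0 \<noteq> p 0" for r n
    using preleg_transfer[OF leg_preleg[OF r(1)]] other[OF r] leg_dg(3)[OF r(1)] by simp
  have "leg_verts T u \<subseteq> leg_region ?T" if u: "u \<in> lv T" "u \<noteq> p 0" for u
  proof
    fix x assume "x \<in> leg_verts T u"
    then obtain i where i: "i < legm T u" "x = legp T u i" by (auto simp: leg_verts_def)
    have "preleg ?T (legp T u) (legm T u - 1)" using pre leg_legp[OF g u(1)] u(2) by simp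
    then show "x \<in> leg_region ?T" using preleg_region[of ?T "legp T u" "legm T u - 1" i] i by simp
  qed
  moreover have "leg_verts T (p 0) \<subseteq> leg_region ?T"
  proof -
    have pr: "preleg ?T (\<lambda>i. p (m - 1 - i)) (m - 1)"
      unfolding preleg_def
    proof (intro conjI allI impI)
      show "inj_on (\<lambda>i. p (m - 1 - i)) {..m - 1}"
        using leg_inj[OF p] by (auto simp: inj_on_def)
      show "dg ?T (p (m - 1 - 0)) = 1" using dend by simp
      fix i
      show "{p (m - 1 - i), p (m - 1 - Suc i)} \<in> ?T" if "i < m - 1"
      proof -
        have "{p (m - 1 - Suc i), p (m - 1 - i)} \<in> T"
          using leg_edge[OF p, of "m - 1 - Suc i"] that by (simp add: Suc_diff_Suc)
        moreover have "p (m - 1 - i) \<noteq> p m" "p (m - 1 - Suc i) \<noteq> p m"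
          using pmA[of "m - 1 - i"] pmA[of "m - 1 - Suc i"] m1 that by auto
        ultimately show ?thesis by (auto simp: doubleton_eq_iff insert_commute)
      qed
      show "dg ?T (p (m - 1 - i)) = 2" if i: "0 < i \<and> i \<le> m - 1"
      proof (cases "i = m - 1")
        case True then show ?thesis using dstart i by simp
      next
        case False
        let ?j = "m - 1 - i"
        have j: "0 < ?j" "?j < m - 1" "?j < m" using i False by auto
        have "p ?j \<noteq> p (m - 1)" "p ?j \<noteq> p 0" "p ?j \<noteq> p m"
          using leg_inj[OF p, of ?j "m - 1"] leg_inj[OF p, of ?j 0] pmA[OF j(3)] j by auto
        then show ?thesis using same[of "p ?j"] sA[OF j(3)] leg_dg(1)[OF p j(3)] j by simp
      qed
    qed
    have "p i \<in> leg_region ?T" if "i < m" for i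
      using preleg_region[OF pr, of "m - 1 - i"] that by simp
    then show ?thesis using leg_unique(4)[OF g p] by auto
  qed
  moreover have "p m \<in> leg_region ?T"
  proof -
    have "preleg ?T q k"
      unfolding preleg_def
    proof (intro conjI allI impI)
      show "inj_on q {..k}" using q by (simp add: leg_def thread_def)
      show "dg ?T (q 0) = 1" using other(1)[OF q pq(1)[symmetric], of 0] leg_dg[OF q] by simp
      fix i
      show "i < k \<Longrightarrow> {q i, q (Suc i)} \<in> ?T" using other(2)[OF q pq(1)[symmetric]] .
      assume i: "0 < i \<and> i \<le> k"
      show "dg ?T (q i) = 2"
      proof (cases "i = k")
        case True then show ?thesis using dpm pq by simp
      next
        case False
        then show ?thesis using other(1)[OF q pq(1)[symmetric], of i] leg_dg(1)[OF q, of i] i by simp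
      qed
    qed
    then show ?thesis using preleg_region[of ?T q k k] pq(2) by simp
  qed
  ultimately have "insert (p m) (leg_region T) \<subseteq> leg_region ?T"
    using leg_region_eq[OF g] by blast
  then have "card (insert (p m) (leg_region T)) \<le> card (leg_region ?T)"
    using region_W[OF g'] finW by (meson card_mono finite_subset)
  moreover have "finite (leg_region T)" using region_W[OF g] finW finite_subset by blast
  ultimately have "card (leg_region T) < card (leg_region ?T)" using pmreg by simp
  then show False using b g' by (auto simp: best_def)
qed

text \<open>The rotation splits the leg \<open>p\<close>: its part beyond \<open>p t\<close> becomes
  a leg with leaf \<open>p (Suc t)\<close>, and the part up to \<open>p t\<close> is put in front of
  the leg \<open>q\<close>. Thus no vertex leaves the leg region, and maximality forbids a
  gain.\<close>

lemma shift_leg: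
  assumes b: "best T" and p: "leg T p m" and q: "leg T q k" and pq: "p 0 \<noteq> q 0"
    and t: "t < m" and e: "{q 0, p t} \<in> E"
  defines "T' \<equiv> insert {q 0, p t} (T - {{p (Suc t), p t}})"
  shows "Suc t < m" "best T'" "lv T' = insert (p (Suc t)) (lv T - {q 0})" "leg_region T' = leg_region T"
    "leg T' (\<lambda>i. p (Suc t + i)) (m - Suc t)" "dg T' (p m) = dg T (p m)"
    "\<And>r n. leg T r n \<Longrightarrow> r 0 \<noteq> p 0 \<Longrightarrow> r 0 \<noteq> q 0 \<Longrightarrow> leg T' r n"
proof -
  have g: "good T" using b by (simp add: best_def)
  have q0: "q 0 \<in> lv T" using leg_leaf[OF g q] .
  note ad = leg_adj[OF g p t q0 pq[symmetric] e]
  show t1: "Suc t < m" using ad(2) .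
  have cu: "cut W T (W - p ` {..t}) (p (Suc t)) (p t)" using cut_compl[OF leg_cut[OF g p t]] .
  have uA: "q 0 \<in> W - p ` {..t}" using leaf_off_leg[OF p q0 pq[symmetric], of "{..t}"] t by simp
  have qp: "q 0 \<noteq> p i" if "i \<le> m" for i using leaf_not_on_leg[OF p q0 pq[symmetric] that] .
  have uy: "q 0 \<noteq> p (Suc t)" using qp t1 by simp
  note ro = rotate[OF g cu q0 uA uy e, folded T'_def]
  show lv': "lv T' = insert (p (Suc t)) (lv T - {q 0})" using ro(3) .
  have pne: "p i \<noteq> p (Suc t)" if "i \<le> m" "i \<noteq> Suc t" for i using leg_inj[OF p, of i "Suc t"] that t1 by simp
  have pedge: "{p i, p (Suc i)} \<in> T'" if "i < m" "i \<noteq> t" for i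
  proof -
    have "{p i, p (Suc i)} \<noteq> {p (Suc t), p t}"
      using leg_inj[OF p, of "Suc i" "Suc t"] leg_inj[OF p, of "Suc i" t] leg_inj[OF p, of i "Suc t"] leg_inj[OF p, of i t] that t1
      by (auto simp: doubleton_eq_iff)
    then show ?thesis using leg_edge[OF p that(1)] by (simp add: T'_def)
  qed
  have pdg: "dg T' (p i) = dg T (p i)" if "i \<le> m" "i \<noteq> Suc t" for i
    using ro(4)[of "p i"] qp[OF that(1)] pne[OF that] by simp
  show dm: "dg T' (p m) = dg T (p m)" using pdg[of m] t1 by simp
  have other: "i \<le> n \<Longrightarrow> dg T' (r i) = dg T (r i)" "i < n \<Longrightarrow> {r i, r (Suc i)} \<in> T'"
    if r: "leg T r n" "r 0 \<noteq> p 0" "r 0 \<noteq> q 0" for r n i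
  proof -
    have rp: "p j \<noteq> r i" if "i \<le> n" "j < m" for i j
      using legs_disjoint[OF p r(1) r(2)[symmetric] that(2,1)] .
    have rq: "q 0 \<noteq> r i" if "i \<le> n" for i using leaf_not_on_leg[OF r(1) q0 r(3)[symmetric] that] .
    show "dg T' (r i) = dg T (r i)" if "i \<le> n"
      using ro(4)[of "r i"] rq[OF that] rp[OF that, of "Suc t"] t1 by simp
    show "{r i, r (Suc i)} \<in> T'" if "i < n"
    proof -
      have "r i \<noteq> p (Suc t)" "r i \<noteq> p t" using rp[of i "Suc t"] rp[of i t] that t1 by auto
      then have "{r i, r (Suc i)} \<noteq> {p (Suc t), p t}" by (auto simp: doubleton_eq_iff)
      then show ?thesis using leg_edge[OF r(1) that] by (simp add: T'_def)
    qed
  qed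
  show "leg T' r n" if "leg T r n" "r 0 \<noteq> p 0" "r 0 \<noteq> q 0" for r n
    using leg_transfer[OF that(1)] other[OF that] by simp
  show legs: "leg T' (\<lambda>i. p (Suc t + i)) (m - Suc t)"
    unfolding leg_def thread_def
  proof (intro conjI allI impI)
    show "1 \<le> m - Suc t" using t1 by simp
    show "inj_on (\<lambda>i. p (Suc t + i)) {..m - Suc t}"
      using leg_inj[OF p] t1 by (auto simp: inj_on_def)
    show "dg T' (p (Suc t + 0)) = 1" using ro(6) by simp
    show "3 \<le> dg T' (p (Suc t + (m - Suc t)))" using dm t1 leg_dg(2)[OF p] by simp
    fix i
    show "{p (Suc t + i), p (Suc t + Suc i)} \<in> T'" if "i < m - Suc t"
      using pedge[of "Suc t + i"] that by simp
    show "dg T' (p (Suc t + i)) = 2" if "0 < i \<and> i < m - Suc t"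
    proof -
      have "Suc t + i < m" "i \<noteq> 0" using that by auto
      then show ?thesis using pdg[of "Suc t + i"] leg_dg(1)[OF p, of "Suc t + i"] by simp
    qed
  qed
  \<comment> \<open>The lengthened leg: \<open>p 0\<close> to \<open>p t\<close>, continued by
    \<open>q 0\<close> onwards. Its last vertex before the branch vertex is
    \<open>q (k - 1)\<close>, at index \<open>t + k\<close>.\<close>
  define r where "r i = (if i \<le> t then p i else q (i - Suc t))" for i
  have k1: "1 \<le> k" using leg_dg(3)[OF q] .
  have qpd: "q j \<noteq> p i" if "j < k" "i \<le> m" for i j
    using legs_disjoint[OF q p pq[symmetric] that] .
  have pr: "preleg T' r (t + k)"
    unfolding preleg_def
  proof (intro conjI allI impI)
    show "inj_on r {..t + k}"
    proof (rule inj_onI)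
      fix i j assume "i \<in> {..t + k}" "j \<in> {..t + k}" and eq: "r i = r j"
      then have ij: "i \<le> t + k" "j \<le> t + k" by simp_all
      have L: "r i \<noteq> r j" if "i \<le> t" "\<not> j \<le> t" "j \<le> t + k" for i j
      proof -
        have "j - Suc t < k" "i \<le> m" using that t1 by linarith+
        then have "q (j - Suc t) \<noteq> p i" by (rule qpd)
        then show ?thesis using that by (simp add: r_def)
      qed
      consider "i \<le> t" "j \<le> t" | "\<not> i \<le> t" "\<not> j \<le> t" | "i \<le> t" "\<not> j \<le> t" | "\<not> i \<le> t" "j \<le> t" by blast
      then show "i = j"
      proof cases
        case 1 then show ?thesis using eq leg_inj[OF p, of i j] t1 by (simp add: r_def)
      next
        case 2
        then have "i - Suc t = j - Suc t" using eq leg_inj[OF q, of "i - Suc t" "j - Suc t"] ij by (simp add: r_def)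
        then show ?thesis using 2 by simp
      next
        case 3 then show ?thesis using L[of i j] eq ij by simp
      next
        case 4 then show ?thesis using L[of j i] eq ij by simp
      qed
    qed
    show "dg T' (r 0) = 1" using pdg[of 0] leg_dg(1)[OF p, of 0] t1 by (simp add: r_def)
    fix i
    show "{r i, r (Suc i)} \<in> T'" if i: "i < t + k"
    proof -
      consider "i < t" | "i = t" | "t < i" by linarith
      then show ?thesis
      proof cases
        case 1 then show ?thesis using pedge[of i] t1 by (simp add: r_def)
      next
        case 2 then show ?thesis by (simp add: r_def T'_def insert_commute)
      next
        case 3
        let ?j = "i - Suc t"
        have j: "?j < k" "Suc ?j < k" using 3 i by auto
        have "q ?j \<noteq> p (Suc t)" "q ?j \<noteq> p t" using qpd[OF j(1)] t1 by auto
        then have "{q ?j, q (Suc ?j)} \<noteq> {p (Suc t), p t}" by (auto simp: doubleton_eq_iff)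
        then have "{q ?j, q (Suc ?j)} \<in> T'" using leg_edge[OF q j(1)] by (simp add: T'_def)
        moreover have "Suc i - Suc t = Suc ?j" using 3 by simp
        ultimately show ?thesis using 3 by (simp add: r_def)
      qed
    qed
    show "dg T' (r i) = 2" if i: "0 < i \<and> i \<le> t + k"
    proof -
      consider "i \<le> t" | "i = Suc t" | "Suc t < i" by linarith
      then show ?thesis
      proof cases
        case 1 then show ?thesis using pdg[of i] leg_dg(1)[OF p, of i] i t1 by (simp add: r_def)
      next
        case 2 then show ?thesis using ro(5) by (simp add: r_def)
      next
        case 3
        let ?j = "i - Suc t"
        have j: "0 < ?j" "?j < k" using 3 i by auto
        have "q ?j \<noteq> q 0" using leg_inj[OF q, of ?j 0] j by simp
        moreover have "q ?j \<noteq> p (Suc t)" using qpd[OF j(2), of "Suc t"] t1 by simp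
        ultimately have "dg T' (q ?j) = dg T (q ?j)" by (intro ro(4))
        then show ?thesis using leg_dg(1)[OF q j(2)] j 3 by (simp add: r_def)
      qed
    qed
  qed
  have "leg_verts T u \<subseteq> leg_region T'" if u: "u \<in> lv T" for u
  proof -
    consider "u = p 0" | "u = q 0" | "u \<noteq> p 0" "u \<noteq> q 0" by blast
    then show ?thesis
    proof cases
      case 1
      have "p i \<in> leg_region T'" if "i < m" for i
      proof (cases "i \<le> t")
        case True then show ?thesis using preleg_region[OF pr, of i] by (simp add: r_def)
      next
        case False
        have "preleg T' (\<lambda>i. p (Suc t + i)) (m - Suc t - 1)" using leg_preleg[OF legs] .
        from preleg_region[OF this, of "i - Suc t"] show ?thesis using False that by simp
      qed
      then show ?thesis using 1 leg_unique(4)[OF g p] by auto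
    next
      case 2
      have "q i \<in> leg_region T'" if "i < k" for i
        using preleg_region[OF pr, of "Suc t + i"] that by (simp add: r_def)
      then show ?thesis using 2 leg_unique(4)[OF g q] by auto
    next
      case 3
      note L = leg_legp[OF g u]
      have "leg T' (legp T u) (legm T u)"
        using leg_transfer[OF L(1)] other[OF L(1)] L(2) 3 by simp
      from leg_preleg[OF this] have "preleg T' (legp T u) (legm T u - 1)" .
      then show ?thesis using preleg_region[of T' "legp T u" "legm T u - 1"]
        by (auto simp: leg_verts_def)
    qed
  qed
  then have sub: "leg_region T \<subseteq> leg_region T'" using leg_region_eq[OF g] by blast
  have fin: "finite (leg_region T')" using region_W[OF ro(2)] finW finite_subset by blast
  have le: "card (leg_region T') \<le> card (leg_region T)" using b ro(2) by (simp add: best_def)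
  show eq: "leg_region T' = leg_region T" using card_seteq[OF fin sub le] by simp
  then show "best T'" using b ro(2) by (simp add: best_def)
qed

section \<open>Ends of the spine\<close>


definition foot :: "'a set set \<Rightarrow> 'a \<Rightarrow> 'a" where
  "foot T u = legp T u (legm T u - 1)"

definition full_leg :: "'a set set \<Rightarrow> 'a \<Rightarrow> bool" where
  "full_leg T u \<longleftrightarrow> leg_count T (legp T u) (legm T u) = legm T u"

definition full_at :: "'a set set \<Rightarrow> 'a \<Rightarrow> 'a set" where
  "full_at T s = {u \<in> lv T. base T u = s \<and> full_leg T u}"

text \<open>The one edge by which an exceptional leg exceeds the regular bound is charged to its
  branch vertex, where a single star controls both summands.\<close>

definition weight :: "'a set set \<Rightarrow> 'a \<Rightarrow> nat" where
  "weight T s = card (nl T s) + card (full_at T s)"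

definition inner_adj :: "'a set set \<Rightarrow> nat" where
  "inner_adj T = (\<Sum>u\<in>lv T. card {s \<in> inner T. {u, s} \<in> E})"

definition optimal :: "'a set set \<Rightarrow> bool" where
  "optimal T \<longleftrightarrow> best T \<and> (\<forall>T'. best T' \<longrightarrow> inner_adj T \<le> inner_adj T')"

lemma foot_edge:
  assumes "good T" "u \<in> lv T" shows "{foot T u, base T u} \<in> T"
  using leg_edge[OF leg_legp(1)[OF assms], of "legm T u - 1"] leg_dg(3)[OF leg_legp(1)[OF assms]]
  by (simp add: foot_def base_def)

lemma foot_leg_verts:
  assumes "good T" "u \<in> lv T" shows "foot T u \<in> leg_verts T u"
  using leg_dg(3)[OF leg_legp(1)[OF assms]] by (auto simp: foot_def leg_verts_def)

lemma foot_inj: "good T \<Longrightarrow> u \<in> lv T \<Longrightarrow> v \<in> lv T \<Longrightarrow> foot T u = foot T v \<Longrightarrow> u = v"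
  using foot_leg_verts[of T u] foot_leg_verts[of T v] leg_verts_disjoint(1)[of T u v] by auto

lemma foot_not_inner: "good T \<Longrightarrow> u \<in> lv T \<Longrightarrow> foot T u \<notin> inner T"
  using foot_leg_verts[of T u] leg_region_eq[of T] by (auto simp: inner_def)

lemma full_leg_D:
  assumes g: "good T" and u: "u \<in> lv T" and f: "full_leg T u"
  shows "2 \<le> legm T u" "nl T (foot T u) = {}"
    "\<exists>v. v \<in> nl T (legp T u (legm T u - 2)) \<and> v \<noteq> u"
    "\<exists>t<legm T u. 2 \<le> card (nl T (legp T u t) - {u})"
proof -
  note L = leg_legp[OF g u]
  have "\<not> leg_count T (legp T u) (legm T u) \<le> legm T u - 1"
    using f leg_dg(3)[OF L(1)] by (simp add: full_leg_def)
  then have "2 \<le> legm T u \<and> nl T (foot T u) = {} \<and> nl T (legp T u (legm T u - 2)) - {u} \<noteq> {} \<and>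
    (\<exists>t<legm T u. 2 \<le> card (nl T (legp T u t) - {u}))"
    using leg_count_bound[OF g L(1)] L(2) by (simp add: foot_def)
  then show "2 \<le> legm T u" "nl T (foot T u) = {}"
    "\<exists>v. v \<in> nl T (legp T u (legm T u - 2)) \<and> v \<noteq> u"
    "\<exists>t<legm T u. 2 \<le> card (nl T (legp T u t) - {u})" by auto
qed

lemma foot_nonadj:
  assumes g: "good T" and u: "u \<in> lv T" and f: "full_leg T u"
    and z: "{base T u, z} \<in> T" "z \<noteq> foot T u"
  shows "{foot T u, z} \<notin> E"
proof -
  note L = leg_legp[OF g u]
  obtain v where v: "v \<in> nl T (legp T u (legm T u - 2))" "v \<noteq> legp T u 0"
    using full_leg_D(3)[OF g u f] L(2) by auto
  show ?thesis
    using leg_end_nonadj[OF g L(1) full_leg_D(1)[OF g u f] v] z by (simp add: foot_def base_def)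
qed

text \<open>The feet of the exceptional legs represent these legs in the star around
  \<open>s\<close>: a foot has no leaf neighbour by \<open>full_leg_D\<close> and is nonadjacent to
  the other tree neighbours of \<open>s\<close> by \<open>foot_nonadj\<close>.\<close>

lemma weight_star:
  assumes g: "good T" and s: "s \<in> inner T"
    and Z: "Z \<subseteq> inner T" "\<And>z. z \<in> Z \<Longrightarrow> {s, z} \<in> T" "\<And>y z. y \<in> Z \<Longrightarrow> z \<in> Z \<Longrightarrow> {y, z} \<notin> E"
    and LZ: "\<And>u z. u \<in> nl T s \<Longrightarrow> z \<in> Z \<Longrightarrow> {u, z} \<notin> E"
  shows "weight T s + card Z \<le> 4"
proof -
  let ?F = "foot T ` full_at T s"
  have fa: "u \<in> lv T" "base T u = s" "full_leg T u" if "u \<in> full_at T s" for u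
    using that by (auto simp: full_at_def)
  have sW: "s \<in> W" using s by (simp add: inner_def)
  have ZW: "Z \<subseteq> W" using Z(1) by (auto simp: inner_def)
  have foote: "{s, foot T u} \<in> T" if "u \<in> full_at T s" for u
    using foot_edge[OF g fa(1)[OF that]] fa(2)[OF that] by (simp add: insert_commute)
  have FZ: "{foot T u, z} \<notin> E" if "u \<in> full_at T s" "{s, z} \<in> T" "z \<noteq> foot T u" for u z
    using foot_nonadj[OF g fa(1)[OF that(1)] fa(3)[OF that(1)]] fa(2)[OF that(1)] that by simp
  have dis: "?F \<inter> Z = {}" using foot_not_inner[OF g] fa(1) Z(1) by blast
  have "card (nl T s) + card (?F \<union> Z) \<le> 4"
  proof (rule star_bound[OF g sW order_refl])
    show "?F \<union> Z \<subseteq> W" using ZW foot_leg_verts[OF g] leg_verts_W[OF g] fa(1) by blast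
    show "{s, x} \<in> E" if "x \<in> ?F \<union> Z" for x
      using that foote Z(2) good_edge[OF g] by blast
    show "{x, y} \<notin> E" if xy: "x \<in> ?F \<union> Z" "y \<in> ?F \<union> Z" for x y
    proof (cases "x = y")
      case True then show ?thesis using edge_irrefl by simp
    next
      case False
      have sx: "{s, x} \<in> T" "{s, y} \<in> T" using xy foote Z(2) by blast+
      consider "x \<in> Z" "y \<in> Z" | u where "u \<in> full_at T s" "x = foot T u" | u where "u \<in> full_at T s" "y = foot T u"
        using xy by blast
      then show ?thesis
      proof cases
        case 1 then show ?thesis using Z(3) by blast
      next
        case 2 then show ?thesis using FZ[of u y] sx False by auto
      next
        case 3 then show ?thesis using FZ[of u x] sx False edge_sym by blast
      qed
    qed
    show "{u, x} \<notin> E" if "u \<in> nl T s" "x \<in> ?F \<union> Z" for u x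
    proof -
      have "{u, foot T v} \<notin> E" if "v \<in> full_at T s" for v
        using full_leg_D(2)[OF g fa(1)[OF that] fa(3)[OF that]] \<open>u \<in> nl T s\<close>
        by (auto simp: nl_def)
      then show ?thesis using that LZ by blast
    qed
    have "foot T v \<notin> lv T" if "v \<in> full_at T s" for v
      using full_leg_D(1)[OF g fa(1)[OF that] fa(3)[OF that]]
        leg_dg(1)[OF leg_legp(1)[OF g fa(1)[OF that]], of "legm T v - 1"]
      by (auto simp: lv_iff foot_def)
    then show "nl T s \<inter> (?F \<union> Z) = {}"
      using inner_dg(2)[OF g] Z(1) by (auto simp: nl_def)
  qed
  moreover have "card ?F = card (full_at T s)"
    by (rule card_image) (use foot_inj[OF g] fa(1) in \<open>auto simp: inj_on_def\<close>)
  moreover have "finite ?F" "finite Z" using ZW finW finite_subset finite_lv by (auto simp: full_at_def)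
  ultimately show ?thesis using dis by (simp add: weight_def card_Un_disjoint)
qed

end

text \<open>A spine end: a branch vertex \<open>p 0\<close> carrying exactly the two legs of \<open>v1\<close> and \<open>v2\<close>,
  followed by the stretch of the spine up to the next branch vertex \<open>p m\<close>.\<close>

locale spine_end = tight +
  fixes T :: "'a set set" and p :: "nat \<Rightarrow> 'a" and m :: nat and v1 v2 :: 'a
  assumes opt: "optimal T" and thr: "thread T p m" and pin: "\<And>i. i \<le> m \<Longrightarrow> p i \<in> inner T"
    and v12: "v1 \<in> lv T" "v2 \<in> lv T" "v1 \<noteq> v2" and d0: "dg T (p 0) = 3" and dm: "3 \<le> dg T (p m)"
    and base0: "\<And>u. u \<in> lv T \<Longrightarrow> base T u = p 0 \<longleftrightarrow> u = v1 \<or> u = v2"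
begin

lemma best: "best T" using opt by (simp add: optimal_def)
lemma g: "good T" using best by (simp add: best_def)
lemma m1: "1 \<le> m" using thr by (simp add: thread_def)
lemma pedge: "i < m \<Longrightarrow> {p i, p (Suc i)} \<in> T" using thr by (simp add: thread_def)

text \<open>The part of the tree that the spine edge after \<open>p i\<close> cuts off together with
  the two legs at \<open>p 0\<close>; see \<open>side_cut\<close>.\<close>

definition side :: "nat \<Rightarrow> 'a set" where
  "side i = leg_verts T v1 \<union> leg_verts T v2 \<union> p ` {..i}"

lemma nb0: "nb T (p 0) = {foot T v1, foot T v2, p 1}"
proof (rule card_seteq[symmetric])
  show "finite (nb T (p 0))" using finite_nb[OF good_simple[OF g]] .
  have "{foot T v, p 0} \<in> T" if "v = v1 \<or> v = v2" for v
    using foot_edge[OF g, of v] base0[of v] v12 that by auto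
  then show "{foot T v1, foot T v2, p 1} \<subseteq> nb T (p 0)"
    using pedge[of 0] m1 by (auto simp: insert_commute)
  have "foot T v1 \<noteq> foot T v2" using foot_inj[OF g v12(1,2)] v12(3) by blast
  moreover have "p 1 \<noteq> foot T v1" "p 1 \<noteq> foot T v2"
    using foot_not_inner[OF g] v12 pin[OF m1] by metis+
  ultimately show "card (nb T (p 0)) \<le> card {foot T v1, foot T v2, p 1}" using d0 by auto
qed

lemma side_cut:
  assumes i: "i < m" shows "cut W T (side i) (p i) (p (Suc i))"
  unfolding cut_def
proof (intro conjI ballI impI)
  have inW: "p j \<in> W" if "j \<le> m" for j using pin[OF that] by (simp add: inner_def)
  have nleg: "p j \<notin> leg_verts T v1 \<union> leg_verts T v2" if "j \<le> m" for j
    using pin[OF that] v12 leg_region_eq[OF g] by (auto simp: inner_def)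
  show "side i \<subseteq> W" using leg_verts_W[OF g] v12 inW i by (auto simp: side_def)
  show "p i \<in> side i" by (simp add: side_def)
  have "p (Suc i) \<noteq> p j" if "j \<le> i" for j using thread_inj[OF thr, of "Suc i" j] i that by simp
  then have "p (Suc i) \<notin> p ` {..i}" by blast
  then show "p (Suc i) \<in> W - side i" using nleg[of "Suc i"] inW[of "Suc i"] i by (simp add: side_def)
  show "{p i, p (Suc i)} \<in> T" using pedge[OF i] .
  fix a b assume a: "a \<in> side i" and b: "b \<in> W - side i" and e: "{a, b} \<in> T"
  have "\<not> a \<in> leg_verts T v" if v: "v = v1 \<or> v = v2" for v
  proof
    assume "a \<in> leg_verts T v"
    then obtain j where j: "j < legm T v" "a = legp T v j" by (auto simp: leg_verts_def)
    have vl: "v \<in> lv T" using v v12 by blast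
    have "b = legp T v (Suc j) \<or> (\<exists>l. j = Suc l \<and> b = legp T v l)"
      using leg_nb[OF leg_legp(1)[OF g vl] j(1)] e j by simp
    then have "b \<in> leg_verts T v \<or> b = base T v"
      using j by (auto simp: leg_verts_def base_def) (metis Suc_lessI image_eqI lessThan_iff)
    moreover have "base T v = p 0" using base0[OF vl] v by simp
    ultimately show False using b v by (auto simp: side_def)
  qed
  then obtain j where j: "j \<le> i" "a = p j" using a by (auto simp: side_def)
  have nbs: "b = p (Suc j) \<or> b \<in> side i"
  proof (cases j)
    case 0
    then have "b \<in> {foot T v1, foot T v2, p 1}" using nb0 e j by (metis in_nb)
    then show ?thesis using 0 foot_leg_verts[OF g] v12 by (auto simp: side_def)
  next
    case (Suc l)
    then have "b \<in> {p l, p (Suc j)}" using thread_nb[OF thr, of l] e j i by (metis in_nb Suc_le_lessD le_trans less_imp_le_nat less_le_trans linorder_not_le)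
    then show ?thesis using Suc j by (auto simp: side_def)
  qed
  then have bj: "b = p (Suc j)" using b by blast
  have "j = i"
  proof (rule ccontr)
    assume "j \<noteq> i"
    then have "p (Suc j) \<in> side i" using j by (auto simp: side_def)
    then show False using b bj by simp
  qed
  then show "a = p i" "b = p (Suc i)" using j bj by auto
qed

lemma outer_side:
  assumes "u \<in> lv T" "u \<noteq> v1" "u \<noteq> v2" "i \<le> m" shows "u \<in> W - side i"
proof -
  have "u \<notin> leg_verts T v1" "u \<notin> leg_verts T v2"
    using leaf_region[OF g assms(1)] leg_verts_disjoint(1)[OF g assms(1)] v12 assms(2,3) by blast+
  moreover have "u \<noteq> p j" if "j \<le> i" for j using inner_dg(2)[OF g pin[of j]] assms that by auto
  ultimately show ?thesis using assms(1) lv_subset by (auto simp: side_def)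
qed

text \<open>The rotation that turns \<open>p (Suc i)\<close> into a leaf. It requires degree two
  there, so the branch vertex \<open>p m\<close> is out of reach.\<close>

lemma outer_adj:
  assumes u: "u \<in> lv T" "u \<noteq> v1" "u \<noteq> v2" and i: "i < m" and e: "{u, p i} \<in> E"
  shows "Suc i < m" "\<And>v. v \<in> nl T (p (Suc i)) \<Longrightarrow> v = u"
proof -
  note cu = cut_compl[OF side_cut[OF i]]
  have uA: "u \<in> W - side i" using outer_side[OF u, of i] i by simp
  have uy: "u \<noteq> p (Suc i)" using inner_dg(2)[OF g pin[of "Suc i"]] u i by auto
  have "dg T (p (Suc i)) = 2" using rotate(1)[OF g cu u(1) uA uy e] .
  then have "Suc i \<noteq> m" using dm by auto
  then show "Suc i < m" using i by simp
  show "v = u" if "v \<in> nl T (p (Suc i))" for v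
    using rotate_nonadj[OF g cu u(1) uA uy e, of v] that edge_sym unfolding nl_iff by blast
qed

text \<open>Here the maximal leg region enters: \<open>p 0\<close> has degree three and two legs, so
  each of the two can play the leg that is moved in \<open>best_leaf_inner\<close>.\<close>

lemma near_nonadj:
  assumes "v = v1 \<or> v = v2" "s \<in> inner T" "s \<noteq> p 0" shows "{v, s} \<notin> E"
proof -
  have *: "{v, s} \<notin> E" if v: "v \<in> lv T" and w: "w \<in> lv T" and vw: "v \<noteq> w"
    and b: "base T v = p 0" "base T w = p 0" for v w
    using best_leaf_inner[OF best leg_legp(1)[OF g v] leg_legp(1)[OF g w], of s]
      leg_legp(2)[OF g v] leg_legp(2)[OF g w] vw b d0 assms by (simp add: base_def)
  show ?thesis using *[of v1 v2] *[of v2 v1] v12 base0 assms(1) by blast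
qed

lemma nl_outer:
  assumes "u \<in> nl T (p i)" "0 < i" "i \<le> m" shows "u \<in> lv T" "u \<noteq> v1" "u \<noteq> v2" "{u, p i} \<in> E"
proof -
  have "p i \<noteq> p 0" using thread_inj[OF thr, of i 0] assms by simp
  then show "u \<noteq> v1" "u \<noteq> v2" using near_nonadj[OF _ pin[OF assms(3)]] assms(1) by (auto simp: nl_iff)
qed (use assms in \<open>auto simp: nl_iff\<close>)

lemma nl_two:
  assumes "2 \<le> card (nl T x)" shows "\<exists>v\<in>nl T x. v \<noteq> u"
proof (rule ccontr)
  assume "\<not> ?thesis"
  then have "card (nl T x) \<le> 1" by (intro nl_singleton_le) blast
  then show False using assms by simp
qed

text \<open>The star argument used on legs. By \<open>near_nonadj\<close> only leaves other than
  \<open>v1\<close> and \<open>v2\<close> occur, and for these the rotations across the spine are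
  available.\<close>

lemma spine_le_two:
  assumes i: "0 < i" "i < m" shows "card (nl T (p i)) \<le> 2"
proof (rule ccontr)
  assume n: "\<not> ?thesis"
  let ?L = "nl T (p i)"
  have two: "\<exists>v\<in>?L. v \<noteq> u" for u using nl_two[of "p i" u] n by simp
  have O: "u \<in> lv T" "u \<noteq> v1" "u \<noteq> v2" "{u, p i} \<in> E" if "u \<in> ?L" for u
    using nl_outer[OF that] i by auto
  obtain u where u: "u \<in> ?L" using two by blast
  obtain v where v: "v \<in> ?L" "v \<noteq> u" using two by blast
  have i2: "Suc i < m" using outer_adj(1)[OF O(1-3)[OF u] i(2) O(4)[OF u]] .
  obtain j where j: "i = Suc j" using i by (cases i) auto
  have X: "p j \<in> inner T" "p (Suc i) \<in> inner T" using pin[of j] pin[of "Suc i"] i j by auto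
  have "{p (Suc i), p j} \<notin> E"
  proof (rule insertion_nonadj[OF g cut_compl[OF side_cut[OF i(2)]] _ O(1)[OF u] _ _ O(4)[OF u] O(1)[OF v(1)] v(2) O(4)[OF v(1)]])
    have "p i \<notin> side j" "p i \<in> W" using side_cut[of j] i j by (auto simp: cut_def)
    moreover have "side i = insert (p i) (side j)" using j by (auto simp: side_def atMost_Suc)
    ultimately have "insert (p i) (W - side i) = W - side j" by auto
    then show "cut W T (insert (p i) (W - side i)) (p i) (p j)"
      using cut_compl[OF side_cut[of j]] i j by simp
    show "u \<in> W - side i" using outer_side[OF O(1-3)[OF u], of i] i by simp
    show "u \<noteq> p (Suc i)" using inner_dg(2)[OF g X(2)] O(1)[OF u] by auto
  qed
  then have XX: "{x, y} \<notin> E" if "x \<in> {p j, p (Suc i)}" "y \<in> {p j, p (Suc i)}" for x y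
    using that edge_irrefl edge_sym by blast
  have edges: "{p i, x} \<in> E" if "x \<in> {p j, p (Suc i)}" for x
  proof -
    have "{p i, p j} \<in> T" "{p i, p (Suc i)} \<in> T" using pedge[of j] pedge[of i] i j by (simp_all add: insert_commute)
    then show ?thesis using that good_edge[OF g] by blast
  qed
  have LX: "{w, x} \<notin> E" if w: "w \<in> ?L" and x: "x \<in> {p j, p (Suc i)}" for w x
  proof -
    obtain w' where w': "w' \<in> ?L" "w' \<noteq> w" using two by blast
    have "{w, p j} \<notin> E" using outer_adj(2)[OF O(1-3)[OF w], of j w'] w' i j by auto
    moreover have "{w, p (Suc i)} \<notin> E"
      using outer_adj(2)[OF O(1-3)[OF w'(1)] i(2) O(4)[OF w'(1)], of w] w' O(1)[OF w] by (auto simp: nl_iff)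
    ultimately show ?thesis using x by blast
  qed
  have "card ?L + card {p j, p (Suc i)} \<le> 4"
  proof (rule star_bound[OF g _ order_refl _ edges XX LX])
    show "p i \<in> W" using pin[of i] i by (simp add: inner_def)
    show "{p j, p (Suc i)} \<subseteq> W" using X by (auto simp: inner_def)
    show "?L \<inter> {p j, p (Suc i)} = {}" using inner_dg(2)[OF g X(1)] inner_dg(2)[OF g X(2)] O(1) by blast
  qed
  moreover have "p j \<noteq> p (Suc i)" using thread_inj[OF thr, of j "Suc i"] i j by simp
  ultimately show False using n by simp
qed

text \<open>The unit saved when \<open>p 1\<close> does not have exactly two leaf neighbours is what
  \<open>end_weight\<close> spends at \<open>p 0\<close>.\<close>

lemma spine_sum:
  assumes m2: "2 \<le> m"
  shows "(\<Sum>i\<in>{1..<m}. card (nl T (p i))) + (if card (nl T (p 1)) = 2 then 0 else 1) \<le> m - 1"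
proof -
  \<comment> \<open>The stretch is read backwards, because the guaranteed zero lies at
    \<open>p (m - 1)\<close>: a leaf there would force degree two at \<open>p m\<close>.\<close>
  define h where "h k = card (nl T (p (m - 1 - k)))" for k
  have nxt: "card (nl T (p (Suc i))) \<le> 1 \<and> (\<forall>v\<in>nl T (p (Suc i)). v = u)" if "u \<in> nl T (p i)" "0 < i" "i < m" for i u
  proof -
    have "v = u" if "v \<in> nl T (p (Suc i))" for v
      using outer_adj(2)[OF nl_outer(1-3)[OF \<open>u \<in> nl T (p i)\<close>] _ nl_outer(4)[OF \<open>u \<in> nl T (p i)\<close>] that] \<open>0 < i\<close> \<open>i < m\<close> by simp
    then show ?thesis using nl_singleton_le by blast
  qed
  have iso: "nl T (p i) = {} \<or> nl T (p (Suc i)) = {}"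
    if "card (nl T (p i)) = 2 \<or> card (nl T (p (Suc i))) = 2" "0 < i" "Suc i < m" for i
  proof (rule ccontr)
    assume "\<not> ?thesis"
    then obtain u w where uw: "u \<in> nl T (p i)" "w \<in> nl T (p (Suc i))" by blast
    then have wu: "w = u" "card (nl T (p (Suc i))) \<le> 1" using nxt[OF uw(1)] that by auto
    then have "card (nl T (p i)) = 2" using that by auto
    then obtain u' where u': "u' \<in> nl T (p i)" "u' \<noteq> u" using nl_two[of "p i" u] by auto
    then show False using nxt[OF u'(1)] that uw wu by auto
  qed
  have "(\<Sum>i\<le>m - 2. h i) + (if h (m - 2) = 2 then 0 else 1) \<le> Suc (m - 2)"
  proof (rule sum_isolated_twos[of "m - 2" h "m - 2"])
    show "h i \<le> 2" if "i \<le> m - 2" for i using spine_le_two[of "m - 1 - i"] that m2 by (simp add: h_def)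
    have "u \<notin> nl T (p (m - 1))" for u
      using outer_adj(1)[of u "m - 1"] nl_outer[of u "m - 1"] m2 by auto
    then have "nl T (p (m - 1)) = {}" by blast
    then show "h 0 = 0" by (simp add: h_def)
    have em: "nl T (p j) = {} \<Longrightarrow> card (nl T (p j)) = 0" for j by simp
    fix i assume i: "Suc i \<le> m - 2"
    have e: "m - 1 - i = Suc (m - 1 - Suc i)" "0 < m - 1 - Suc i" "Suc (m - 1 - Suc i) < m" using i by auto
    note * = iso[OF _ e(2,3), folded e(1)]
    show "h (Suc i) = 0" if "h i = 2" using *[OF disjI2] that em by (auto simp: h_def)
    show "h i = 0" if "h (Suc i) = 2" using *[OF disjI1] that em by (auto simp: h_def)
  qed simp
  moreover have "(\<Sum>i\<le>m - 2. h i) = (\<Sum>i\<in>{1..<m}. card (nl T (p i)))"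
    by (rule sum.reindex_bij_witness[of _ "\<lambda>i. m - 1 - i" "\<lambda>i. m - 1 - i"]) (use m2 in \<open>auto simp: h_def\<close>)
  moreover have "h (m - 2) = card (nl T (p 1))" using m2 by (simp add: h_def numeral_2_eq_2 Suc_diff_Suc)
  moreover have "Suc (m - 2) = m - 1" using m2 by simp
  ultimately show ?thesis by simp
qed

text \<open>Joining \<open>u\<close> to the leg and deleting the edge from \<open>p 0\<close> to
  \<open>p 1\<close> is an instance of \<open>attach\<close> with branch vertex \<open>p 0\<close>,
  so \<open>p 1\<close> has degree two and becomes a leaf in place of \<open>u\<close>.\<close>

lemma cross_adj:
  assumes v: "v = v1 \<or> v = v2" and t: "t < legm T v"
    and u: "u \<in> lv T" "u \<noteq> v1" "u \<noteq> v2" and e: "{u, legp T v t} \<in> E"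
  shows "2 \<le> m" "\<And>w. w \<in> nl T (p 1) \<Longrightarrow> w = u"
proof -
  have vl: "v \<in> lv T" using v v12 by blast
  note L = leg_legp[OF g vl]
  have cu: "cut W T (side 0) (p 0) (p 1)" using side_cut[of 0] m1 by simp
  let ?x = "legp T v t"
  have xl: "?x \<in> leg_verts T v" using t by (simp add: leg_verts_def)
  have t0: "0 < t"
    using leg_adj(1)[OF g L(1) t u(1) _ e] L(2) v u by auto
  have x2: "2 \<le> dg T ?x" using leg_dg(1)[OF L(1) t] t0 by simp
  have xs: "?x \<in> side 0" using xl v by (auto simp: side_def)
  have uo: "u \<in> W - side 0" using outer_side[OF u, of 0] by simp
  have e': "{?x, u} \<in> E" using e edge_sym by blast
  have nx: "?x \<noteq> p 0" using xl pin[of 0] leg_region_eq[OF g] vl by (auto simp: inner_def)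
  have un: "u \<noteq> p 1" using inner_dg(2)[OF g pin[OF m1]] u(1) by auto
  have triv: "p 0 = p 0 \<and> p 1 = p 1 \<or> p 0 = p 1 \<and> p 1 = p 0" "u = ?x \<and> ?x = u \<or> u = u \<and> ?x = ?x" by simp_all
  note at = attach[OF g cu xs uo e' triv(1) _ triv(2) u(1) x2 nx un]
  have d3: "3 \<le> dg T (p 0)" using d0 by simp
  have "dg T (p 1) = 2" using at(1)[OF d3] .
  then have "m \<noteq> 1" using dm by auto
  then show "2 \<le> m" using m1 by simp
  show "w = u" if "w \<in> nl T (p 1)" for w
  proof (rule ccontr)
    assume "w \<noteq> u"
    let ?T = "insert {?x, u} (T - {{p 0, p 1}})"
    have "w \<in> lv ?T" "p 1 \<in> lv ?T" using at(3)[OF d3] that \<open>w \<noteq> u\<close> by (auto simp: nl_iff)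
    then show False using leaves_nonadj[OF at(2)[OF d3]] that by (auto simp: nl_iff)
  qed
qed

text \<open>An exceptional leg has a vertex adjacent to two leaves besides its own, and at most one
  of these can be the other leaf at \<open>p 0\<close>.\<close>

lemma full_cross:
  assumes "v \<in> full_at T (p 0)"
  shows "v = v1 \<or> v = v2" "\<exists>t u. t < legm T v \<and> u \<in> lv T \<and> u \<noteq> v1 \<and> u \<noteq> v2 \<and> {u, legp T v t} \<in> E"
proof -
  have v: "v \<in> lv T" "base T v = p 0" "full_leg T v" using assms by (auto simp: full_at_def)
  show vv: "v = v1 \<or> v = v2" using base0[OF v(1)] v(2) by simp
  obtain t where t: "t < legm T v" "2 \<le> card (nl T (legp T v t) - {v})" using full_leg_D(4)[OF g v(1,3)] by blast
  have "\<not> nl T (legp T v t) - {v} \<subseteq> {v1, v2} - {v}"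
  proof
    assume "nl T (legp T v t) - {v} \<subseteq> {v1, v2} - {v}"
    then have "card (nl T (legp T v t) - {v}) \<le> card ({v1, v2} - {v})" by (intro card_mono) auto
    also have "\<dots> \<le> 1" using vv v12(3) by auto
    finally show False using t by simp
  qed
  then obtain u where "u \<in> nl T (legp T v t)" "u \<noteq> v1" "u \<noteq> v2" by blast
  then show "\<exists>t u. t < legm T v \<and> u \<in> lv T \<and> u \<noteq> v1 \<and> u \<noteq> v2 \<and> {u, legp T v t} \<in> E"
    using t(1) by (auto simp: nl_iff)
qed

text \<open>Moving the start of the leg of \<open>v\<close> onto the leg of \<open>u\<close> keeps the leg region. The old leaf \<open>u\<close> is
  adjacent to two inner vertices, the new leaf to at most one, against the minimality of
  \<open>inner_adj\<close>.\<close>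

lemma no_double_contact:
  assumes v: "v \<in> full_at T (p 0)" and u: "u \<in> lv T" "u \<noteq> v1" "u \<noteq> v2"
    and e0: "{u, p 0} \<in> E" and e1: "{u, p 1} \<in> E"
  shows False
proof -
  note vv = full_cross(1)[OF v]
  obtain t u' where t: "t < legm T v" and u': "u' \<in> lv T" "u' \<noteq> v1" "u' \<noteq> v2" "{u', legp T v t} \<in> E"
    using full_cross(2)[OF v] by blast
  have "u = u'" using cross_adj(2)[OF vv t u', of u] u(1) e1 by (simp add: nl_iff)
  then have ex: "{u, legp T v t} \<in> E" using u' by simp
  have vl: "v \<in> lv T" using vv v12 by blast
  obtain w where w: "w = v1 \<or> w = v2" "w \<noteq> v" using vv v12(3) by blast
  have wl: "w \<in> lv T" using w v12 by blast
  note Lv = leg_legp[OF g vl] and Lu = leg_legp[OF g u(1)] and Lw = leg_legp[OF g wl]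
  have vu: "v \<noteq> u" and wu: "w \<noteq> u" using vv w u by auto
  have h: "legp T v 0 \<noteq> legp T u 0" "{legp T u 0, legp T v t} \<in> E" using Lv Lu vu ex by auto
  let ?X = "legp T v (Suc t)"
  let ?T = "insert {legp T u 0, legp T v t} (T - {{?X, legp T v t}})"
  note sh = shift_leg[OF best Lv(1) Lu(1) h(1) t h(2)]
  have bv: "legp T v (legm T v) = p 0" and bw: "legp T w (legm T w) = p 0"
    using base0[OF vl] base0[OF wl] vv w by (auto simp: base_def)
  have g': "good ?T" using sh(2) by (simp add: best_def)
  have in': "inner ?T = inner T" using sh(4) by (simp add: inner_def)
  have Lw': "leg ?T (legp T w) (legm T w)" using sh(7)[OF Lw(1)] Lw(2) Lv(2) Lu(2) w(2) wu by simp
  have Xv: "?X \<notin> lv T" using leg_dg(1)[OF Lv(1) sh(1)] by (simp add: lv_iff)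
  have lvT: "lv ?T = insert ?X (lv T - {u})" using sh(3) Lu(2) by simp
  \<comment> \<open>In the new tree the shortened leg of \<open>?X\<close> and the leg of
    \<open>w\<close> both end at \<open>p 0\<close>, still of degree three, so
    \<open>best_leaf_inner\<close> applies to \<open>?X\<close>.\<close>
  have Xn: "{?X, s} \<notin> E" if "s \<in> inner ?T" "s \<noteq> p 0" for s
  proof -
    have "?X \<noteq> legp T w 0" using Xv Lw(2) wl by auto
    then show ?thesis
      using best_leaf_inner[OF sh(2) sh(5) Lw', of s] that sh(6) d0 bv bw sh(1) by simp
  qed
  let ?c = "\<lambda>u. card {s \<in> inner T. {u, s} \<in> E}"
  have "{s \<in> inner T. {?X, s} \<in> E} \<subseteq> {p 0}" using Xn in' by auto
  then have "?c ?X \<le> card {p 0}" by (intro card_mono) auto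
  then have cX: "?c ?X \<le> 1" by simp
  have finI: "finite (inner T)" using finW by (simp add: inner_def)
  have "{p 0, p 1} \<subseteq> {s \<in> inner T. {u, s} \<in> E}" using pin[of 0] pin[of 1] m1 e0 e1 by simp
  then have "card {p 0, p 1} \<le> ?c u" using finI by (intro card_mono) auto
  moreover have "p 0 \<noteq> p 1" using thread_inj[OF thr, of 0 1] m1 by simp
  ultimately have cu: "2 \<le> ?c u" by simp
  have "inner_adj ?T = ?c ?X + (\<Sum>u\<in>lv T - {u}. ?c u)"
    unfolding inner_adj_def in' lvT using Xv finite_lv by (subst sum.insert) auto
  moreover have "inner_adj T = ?c u + (\<Sum>u\<in>lv T - {u}. ?c u)"
    unfolding inner_adj_def using u(1) finite_lv by (subst sum.remove[of _ u]) auto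
  ultimately have "inner_adj ?T < inner_adj T" using cX cu by simp
  moreover have "inner_adj T \<le> inner_adj ?T" using opt sh(2) by (simp add: optimal_def)
  ultimately show False by simp
qed

lemma weight_interior:
  assumes "0 < i" "i < m" shows "weight T (p i) = card (nl T (p i))"
proof -
  have "dg T (p i) = 2" using thr assms by (simp add: thread_def)
  then have "full_at T (p i) = {}" using dg_base[OF g] by (fastforce simp: full_at_def)
  then show ?thesis by (simp add: weight_def)
qed

lemma card_near: "S \<subseteq> {v1, v2} \<Longrightarrow> card S \<le> 2"
  using card_mono[of "{v1, v2}" S] v12 by simp

text \<open>A trade between the first two spine vertices. If \<open>p 1\<close> has two leaf
  neighbours, the interior may use \<open>m - 1\<close> and \<open>p 0\<close> must stay within two;
  otherwise the interior saves one and \<open>p 0\<close> may weigh three.\<close>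

lemma end_weight: "(\<Sum>i<m. weight T (p i)) \<le> m + 1"
proof -
  have sp: "(\<Sum>i<m. weight T (p i)) = weight T (p 0) + (\<Sum>i\<in>{1..<m}. card (nl T (p i)))"
  proof -
    have "{..<m} = insert 0 {1..<m}" using m1 by auto
    then show ?thesis using weight_interior by simp
  qed
  have near: "card (nl T (p 0)) \<le> 2" if "\<And>u. u \<in> nl T (p 0) \<Longrightarrow> u = v1 \<or> u = v2"
    using card_near[of "nl T (p 0)"] that by blast
  show ?thesis
  proof (cases "m = 1")
    case True
    have "full_at T (p 0) = {}" using full_cross cross_adj(1) True by fastforce
    moreover have "u = v1 \<or> u = v2" if "u \<in> nl T (p 0)" for u
      using outer_adj(1)[of u 0] that True by (auto simp: nl_iff)
    ultimately show ?thesis using near sp True by (simp add: weight_def)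
  next
    case False
    then have m2: "2 \<le> m" using m1 by simp
    show ?thesis
    proof (cases "card (nl T (p 1)) = 2")
      case two: True
      \<comment> \<open>An exceptional leg at \<open>p 0\<close>, or a leaf adjacent to
        \<open>p 0\<close> other than \<open>v1\<close> and \<open>v2\<close>, would allow at most
        one leaf at \<open>p 1\<close>.\<close>
      have one: "False" if "\<And>w. w \<in> nl T (p 1) \<Longrightarrow> w = u" for u
      proof -
        have "card (nl T (p 1)) \<le> 1" by (rule nl_singleton_le[of T "p 1" u]) (rule that)
        then show False using two by simp
      qed
      have "full_at T (p 0) = {}" using full_cross cross_adj(2) one by (metis equals0I)
      moreover have "u = v1 \<or> u = v2" if "u \<in> nl T (p 0)" for u
        using outer_adj(2)[of u 0] that one[of u] m1 by (auto simp: nl_iff)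
      ultimately have "weight T (p 0) \<le> 2" using near by (simp add: weight_def)
      then show ?thesis using sp spine_sum[OF m2] two m2 by simp
    next
      case not2: False
      have "weight T (p 0) \<le> 3"
      \<comment> \<open>Normally \<open>p 1\<close> joins the star around \<open>p 0\<close> and
        uses one of its four places. A leaf adjacent to both prevents this, but then there is no
        exceptional leg and \<open>u\<close> is the only further leaf at \<open>p 0\<close>.\<close>
      proof (cases "\<exists>u\<in>nl T (p 0). u \<noteq> v1 \<and> u \<noteq> v2 \<and> {u, p 1} \<in> E")
        case True
        then obtain u where u: "u \<in> lv T" "u \<noteq> v1" "u \<noteq> v2" "{u, p 0} \<in> E" "{u, p 1} \<in> E"
          by (auto simp: nl_iff)
        have "full_at T (p 0) = {}" using no_double_contact[OF _ u] by blast
        moreover have "nl T (p 0) \<subseteq> {v1, v2, u}"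
        proof
          fix w assume w: "w \<in> nl T (p 0)"
          show "w \<in> {v1, v2, u}"
            using outer_adj(2)[of w 0 u] w u m1 by (auto simp: nl_iff)
        qed
        then have "card (nl T (p 0)) \<le> card {v1, v2, u}" by (intro card_mono) auto
        then have "card (nl T (p 0)) \<le> 3" using card_insert_le_m1[of 3 "{v2, u}" v1] card_insert_le_m1[of 2 "{u}" v2] by simp
        ultimately show ?thesis by (simp add: weight_def)
      next
        case False
        have "weight T (p 0) + card {p 1} \<le> 4"
        proof (rule weight_star[OF g])
          show "p 0 \<in> inner T" "{p 1} \<subseteq> inner T" using pin m1 by auto
          show "{p 0, z} \<in> T" if "z \<in> {p 1}" for z using pedge[of 0] that m1 by simp
          show "{y, z} \<notin> E" if "y \<in> {p 1}" "z \<in> {p 1}" for y z using that edge_irrefl by simp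
          have "p 1 \<noteq> p 0" using thread_inj[OF thr, of 1 0] m1 by simp
          then show "{u, z} \<notin> E" if "u \<in> nl T (p 0)" "z \<in> {p 1}" for u z
            using near_nonadj[OF _ pin[OF m1], of u] False that by blast
        qed
        then show ?thesis by simp
      qed
      then show ?thesis using sp spine_sum[OF m2] not2 m2 by simp
    qed
  qed
qed

text \<open>What the vertex closing the stretch needs: the first part limits the leaves at a middle
  branch vertex, the second lets \<open>p (m - 1)\<close> join the star around
  \<open>p m\<close>.\<close>

lemma far_weight: "nl T (p m) \<inter> {v1, v2} = {}" "\<And>u. u \<in> nl T (p m) \<Longrightarrow> {u, p (m - 1)} \<notin> E"
proof -
  show d: "nl T (p m) \<inter> {v1, v2} = {}" using nl_outer(2,3)[of _ m] m1 by auto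
  show "{u, p (m - 1)} \<notin> E" if "u \<in> nl T (p m)" for u
    using outer_adj(1)[of u "m - 1"] nl_outer(1-3)[OF that] m1 by auto
qed

end

section \<open>The shape of the spine and the weight bound\<close>

context tight
begin


section \<open>The spine is a path, and its weight\<close>

lemma finite_inner: "finite (inner T)" using finW by (simp add: inner_def)

text \<open>Enlarge \<open>X\<close> by the legs ending in it. A tree edge leaving the enlarged set
  would lead from \<open>X\<close> to a further inner vertex, so connectivity makes the set all of
  \<open>W\<close>.\<close>

lemma inner_closed:
  assumes g: "good T" and X: "X \<subseteq> inner T" "X \<noteq> {}"
    and cl: "\<And>x y. x \<in> X \<Longrightarrow> {x, y} \<in> T \<Longrightarrow> y \<in> inner T \<Longrightarrow> y \<in> X"
  shows "X = inner T"
proof -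
  let ?C = "X \<union> (\<Union>u\<in>{u \<in> lv T. base T u \<in> X}. leg_verts T u)"
  have CW: "?C \<subseteq> W" using X leg_verts_W[OF g] by (auto simp: inner_def)
  have "?C = W"
  proof (rule ccontr)
    assume ne: "?C \<noteq> W"
    have "cut_connected W T" using good_tree[OF g] by (simp add: tree_on_def)
    from cut_connectedD[OF this CW _ ne] X(2) obtain a b where
      ab: "a \<in> ?C" "b \<in> W - ?C" "{a, b} \<in> T" by blast
    show False
    proof (cases "a \<in> X")
      case True
      then have "b \<in> inner T \<or> (\<exists>u\<in>lv T. base T u = a \<and> b = foot T u)"
        using inner_nb[OF g, of a b] X ab by (auto simp: foot_def)
      then show False using cl[OF True ab(3)] ab(2) True foot_leg_verts[OF g] by blast
    next
      case False
      then obtain u where u: "u \<in> lv T" "base T u \<in> X" "a \<in> leg_verts T u" using ab by blast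
      then obtain i where i: "i < legm T u" "a = legp T u i" by (auto simp: leg_verts_def)
      have "b = legp T u (Suc i) \<or> (\<exists>j. i = Suc j \<and> b = legp T u j)"
        using leg_nb[OF leg_legp(1)[OF g u(1)] i(1)] ab i by simp
      then have "b \<in> leg_verts T u \<or> b = base T u"
        using i by (auto simp: leg_verts_def base_def) (metis Suc_lessI image_eqI lessThan_iff)
      then show False using ab u by blast
    qed
  qed
  then show ?thesis using X leg_region_eq[OF g] by (auto simp: inner_def)
qed

definition legs_at :: "'a set set \<Rightarrow> 'a \<Rightarrow> 'a set" where
  "legs_at T s = {u \<in> lv T. base T u = s}"

definition inner_deg :: "'a set set \<Rightarrow> 'a \<Rightarrow> nat" where
  "inner_deg T s = card (nb T s \<inter> inner T)"

lemma dg_split: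
  assumes g: "good T" and s: "s \<in> inner T"
  shows "dg T s = inner_deg T s + card (legs_at T s)"
proof -
  have "nb T s = (nb T s \<inter> inner T) \<union> foot T ` legs_at T s"
  proof (intro equalityI subsetI)
    fix y assume "y \<in> nb T s"
    then show "y \<in> (nb T s \<inter> inner T) \<union> foot T ` legs_at T s"
      using inner_nb[OF g s, of y] unfolding legs_at_def foot_def by auto
  next
    fix y assume "y \<in> (nb T s \<inter> inner T) \<union> foot T ` legs_at T s"
    then show "y \<in> nb T s"
      using foot_edge[OF g] unfolding legs_at_def by (auto simp: insert_commute)
  qed
  moreover have "(nb T s \<inter> inner T) \<inter> foot T ` legs_at T s = {}"
    using foot_not_inner[OF g] by (auto simp: legs_at_def)
  moreover have "card (foot T ` legs_at T s) = card (legs_at T s)"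
    by (rule card_image) (use foot_inj[OF g] in \<open>auto simp: inj_on_def legs_at_def\<close>)
  moreover have "finite (legs_at T s)" using finite_lv by (simp add: legs_at_def)
  ultimately show ?thesis unfolding inner_deg_def
    using finite_inner by (metis card_Un_disjoint finite_Int finite_imageI)
qed

lemma card_fibres:
  assumes "finite S" "finite I" "b ` S \<subseteq> I"
  shows "(\<Sum>s\<in>I. card {u \<in> S. b u = s}) = card S"
  using sum.group[OF assms(1,2,3), of "\<lambda>_. 1::nat"] by simp

lemma sum_legs_at: "good T \<Longrightarrow> (\<Sum>s\<in>inner T. card (legs_at T s)) = 5"
  unfolding legs_at_def using card_fibres[OF finite_lv finite_inner, of "base T" T T] base_inner[of T]
  by (auto simp: good_def)

lemma card_W: "good T \<Longrightarrow> card W = card (leg_region T) + card (inner T)"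
  using region_W[of T] finW
  by (metis card_Diff_subset card_mono finite_subset inner_def le_add_diff_inverse)

lemma sum_W:
  assumes g: "good T"
  shows "(\<Sum>x\<in>W. h x) = (\<Sum>u\<in>lv T. \<Sum>i<legm T u. h (legp T u i)) + (\<Sum>s\<in>inner T. (h s :: nat))"
proof -
  have "(\<Sum>x\<in>W. h x) = (\<Sum>x\<in>leg_region T. h x) + (\<Sum>s\<in>inner T. h s)"
    unfolding inner_def using region_W[OF g] finW by (metis add.commute sum.subset_diff)
  also have "(\<Sum>x\<in>leg_region T. h x) = (\<Sum>u\<in>lv T. \<Sum>x\<in>leg_verts T u. h x)"
    unfolding leg_region_eq[OF g] using leg_verts_disjoint(1)[OF g] finite_lv
    by (intro sum.UNION_disjoint) (auto simp: leg_verts_def)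
  also have "\<dots> = (\<Sum>u\<in>lv T. \<Sum>i<legm T u. h (legp T u i))"
  proof (rule sum.cong[OF refl])
    fix u assume u: "u \<in> lv T"
    have "inj_on (legp T u) {..<legm T u}" using leg_inj[OF leg_legp(1)[OF g u]] by (auto simp: inj_on_def)
    then show "(\<Sum>x\<in>leg_verts T u. h x) = (\<Sum>i<legm T u. h (legp T u i))"
      unfolding leg_verts_def by (subst sum.reindex) auto
  qed
  finally show ?thesis .
qed

text \<open>This is the handshake identity for the tree induced on the inner vertices, obtained by
  subtraction: a leg with \<open>m\<close> vertices has degree sum \<open>2 * m - 1\<close> and adds
  one to the degree of its branch vertex.\<close>

lemma sum_inner_dg:
  assumes g: "good T"
  shows "(\<Sum>s\<in>inner T. inner_deg T s) + 2 = 2 * card (inner T)"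
proof -
  have leg: "(\<Sum>i<legm T u. dg T (legp T u i)) + 1 = 2 * legm T u" if u: "u \<in> lv T" for u
  proof -
    note l = leg_legp(1)[OF g u]
    have "(\<Sum>i<k. if i = 0 then 1 else 2 :: nat) + 1 = 2 * k" if "1 \<le> k" for k
      using that by (induction k rule: dec_induct) auto
    moreover have "(\<Sum>i<legm T u. dg T (legp T u i)) = (\<Sum>i<legm T u. if i = 0 then 1 else 2)"
      using leg_dg(1)[OF l] by (intro sum.cong) auto
    ultimately show ?thesis using leg_dg(3)[OF l] by simp
  qed
  have "(\<Sum>u\<in>lv T. \<Sum>i<legm T u. dg T (legp T u i)) + 5 = (\<Sum>u\<in>lv T. (\<Sum>i<legm T u. dg T (legp T u i)) + 1)"
    unfolding sum.distrib using g by (simp add: good_def)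
  also have "\<dots> = 2 * card (leg_region T)"
    using leg by (simp add: card_leg_region[OF g] sum_distrib_left)
  finally have r: "(\<Sum>u\<in>lv T. \<Sum>i<legm T u. dg T (legp T u i)) + 5 = 2 * card (leg_region T)" .
  have "(\<Sum>x\<in>W. dg T x) = 2 * card T" using handshake[OF good_simple[OF g]] .
  moreover have "card T + 1 = card W" using good_tree[OF g] by (simp add: tree_on_def)
  moreover have "(\<Sum>s\<in>inner T. dg T s) = (\<Sum>s\<in>inner T. inner_deg T s) + 5"
    using dg_split[OF g] sum_legs_at[OF g] by (simp add: sum.distrib)
  ultimately show ?thesis using sum_W[OF g, of "dg T"] r card_W[OF g] by simp
qed

lemma legs_at_dg:
  assumes "good T" "legs_at T s \<noteq> {}" shows "3 \<le> dg T s"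
  using assms dg_base[OF assms(1)] by (auto simp: legs_at_def)

text \<open>A vertex of degree two carries no leg, so the thread that enters the spine at
  \<open>c\<close> cannot leave it before the next branch vertex.\<close>

lemma spine_thread:
  assumes g: "good T" and c: "c \<in> inner T" "inner_deg T c = 1"
  obtains p m where "thread T p m" "p 0 = c" "\<And>i. i \<le> m \<Longrightarrow> p i \<in> inner T" "3 \<le> dg T (p m)"
    "nb T c \<inter> inner T = {p 1}"
proof -
  obtain x where x: "nb T c \<inter> inner T = {x}" using c(2) unfolding inner_deg_def by (metis card_1_singletonE)
  then have "{c, x} \<in> T" by auto
  from thread_exists[OF good_tree[OF g] this] obtain p m where
    p: "thread T p m" "p 0 = c" "p (Suc 0) = x" "dg T (p m) \<noteq> 2" by blast
  have inn: "i \<le> m \<Longrightarrow> p i \<in> inner T" for i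
  proof (induction i)
    case 0 then show ?case using p c by simp
  next
    case (Suc i)
    show ?case
    proof (cases i)
      case 0 then show ?thesis using p x by auto
    next
      case (Suc j)
      have "dg T (p i) = 2" "{p i, p (Suc i)} \<in> T" using p(1) Suc.prems Suc by (auto simp: thread_def)
      then have "legs_at T (p i) = {}" using legs_at_dg[OF g, of "p i"] by auto
      then show ?thesis using inner_nb[OF g _ \<open>{p i, p (Suc i)} \<in> T\<close>] Suc.IH Suc.prems
        by (auto simp: legs_at_def)
    qed
  qed
  have "3 \<le> dg T (p m)" using inner_dg(1)[OF g inn[of m]] p(4) by simp
  then show thesis using that[of p m] p inn x by simp
qed

lemma thread_last:
  assumes "thread T p m" shows "{p (m - 1), p m} \<in> T"
proof -
  have "m - 1 < m" "Suc (m - 1) = m" "\<forall>i<m. {p i, p (Suc i)} \<in> T"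
    using assms by (auto simp: thread_def)
  then show ?thesis by metis
qed

lemma thread_closed:
  assumes "thread T p m" "i < m" "0 < i" "{p i, y} \<in> T" shows "y \<in> p ` {..m}"
proof -
  obtain j where j: "i = Suc j" using assms by (cases i) auto
  have "y \<in> nb T (p i)" using assms by simp
  then have "y \<in> {p j, p (Suc i)}" using thread_nb[OF assms(1), of j] assms j by simp
  then show ?thesis using assms j by auto
qed

lemma spine_endI:
  assumes opt: "optimal T" and p: "thread T p m" "\<And>i. i \<le> m \<Longrightarrow> p i \<in> inner T" "3 \<le> dg T (p m)"
    and c: "card (legs_at T (p 0)) = 2" "inner_deg T (p 0) = 1"
  obtains v1 v2 where "spine_end V E W T p m v1 v2" "legs_at T (p 0) = {v1, v2}"
proof -
  have g: "good T" using opt by (simp add: optimal_def best_def)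
  obtain v1 v2 where v: "legs_at T (p 0) = {v1, v2}" "v1 \<noteq> v2" using c(1) by (auto simp: card_2_iff)
  have "dg T (p 0) = 3" using dg_split[OF g p(2)[of 0]] c by simp
  then have "spine_end V E W T p m v1 v2"
    using opt p v by unfold_locales (auto simp: legs_at_def)
  then show thesis using that v by blast
qed

text \<open>The vertices of inner degree one, collected in \<open>C\<close>, are the ends of the
  spine and carry at least two legs each. The degree sum gives at least two ends and the five legs
  allow at most two. A single inner vertex is covered by the star bound four.\<close>

lemma weight_sum:
  assumes opt: "optimal T"
  shows "(\<Sum>s\<in>inner T. weight T s) \<le> card (inner T) + 3"
proof -
  have g: "good T" using opt by (simp add: optimal_def best_def)
  let ?I = "inner T"
  have wstar: "weight T s \<le> 4" if "s \<in> ?I" for s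
    using weight_star[OF g that, of "{}"] by simp
  have c5: "card (lv T) = 5" using g by (simp add: good_def)
  then obtain u where u: "u \<in> lv T" by fastforce
  then have bI: "base T u \<in> ?I" using base_inner[OF g] by blast
  show ?thesis
  proof (cases "card ?I = 1")
    case True
    then obtain b where "?I = {b}" by (rule card_1_singletonE)
    then show ?thesis using wstar[of b] by simp
  next
    case False
    have pos: "1 \<le> inner_deg T s" if s: "s \<in> ?I" for s
    proof (rule ccontr)
      assume "\<not> ?thesis"
      then have "card (nb T s \<inter> ?I) = 0" by (simp add: inner_deg_def)
      then have "nb T s \<inter> ?I = {}" using finite_inner[of T] by (metis card_0_eq finite_Int)
      then have "{s} = ?I" using s by (intro inner_closed[OF g]) auto
      then show False using False by (metis is_singletonI is_singleton_altdef)
    qed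
    define C where "C = {s \<in> ?I. inner_deg T s = 1}"
    define R where "R = ?I - C"
    have fin: "finite C" "finite R" using finite_inner[of T] by (auto simp: C_def R_def)
    have IR: "?I = C \<union> R" "C \<inter> R = {}" by (auto simp: C_def R_def)
    have R2: "2 \<le> inner_deg T s" if "s \<in> R" for s using pos[of s] that by (auto simp: R_def C_def)
    have C2: "2 \<le> card (legs_at T s)" if "s \<in> C" for s
    proof -
      have s: "s \<in> ?I" "inner_deg T s = 1" using that by (auto simp: C_def)
      then have "legs_at T s \<noteq> {}" using dg_split[OF g s(1)] inner_dg(1)[OF g s(1)] by auto
      then show ?thesis using legs_at_dg[OF g] dg_split[OF g s(1)] s(2) by fastforce
    qed
    have split: "(\<Sum>s\<in>?I. h s) = (\<Sum>s\<in>C. h s) + (\<Sum>s\<in>R. h s)" for h :: "'a \<Rightarrow> nat"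
      unfolding IR(1) using sum.union_disjoint[OF fin IR(2)] .
    have sC: "(\<Sum>s\<in>C. inner_deg T s) = card C" by (simp add: C_def)
    have cI: "card ?I = card C + card R" unfolding IR(1) using card_Un_disjoint[OF fin IR(2)] .
    have sRge: "2 * card R \<le> (\<Sum>s\<in>R. inner_deg T s)"
      using sum_mono[of R "\<lambda>_. 2" "inner_deg T"] R2 by simp
    have dsum: "card C + (\<Sum>s\<in>R. inner_deg T s) + 2 = 2 * card C + 2 * card R"
      using sum_inner_dg[OF g] split[of "inner_deg T"] sC cI by simp
    have lsum: "(\<Sum>s\<in>C. card (legs_at T s)) + (\<Sum>s\<in>R. card (legs_at T s)) = 5"
      using sum_legs_at[OF g] split by simp
    have lC: "2 * card C \<le> (\<Sum>s\<in>C. card (legs_at T s))"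
      using sum_mono[of C "\<lambda>_. 2" "\<lambda>s. card (legs_at T s)"] C2 by simp
    have cC: "card C = 2" using sRge dsum lC lsum by linarith
    then have sR: "(\<Sum>s\<in>R. inner_deg T s) = (\<Sum>s\<in>R. 2)" using dsum by simp
    have Req: "inner_deg T s = 2" if "s \<in> R" for s
    \<comment> \<open>With two ends the remaining inner degrees average two, and none is smaller, so
      the spine does not branch.\<close>
    proof (rule ccontr)
      assume "inner_deg T s \<noteq> 2"
      then have "2 < inner_deg T s" using R2[OF that] by simp
      then have "(\<Sum>s\<in>R. 2) < (\<Sum>s\<in>R. inner_deg T s)"
        using R2 that fin by (intro sum_strict_mono_ex1) auto
      then show False using sR by simp
    qed
    obtain c1 c2 where c12: "C = {c1, c2}" "c1 \<noteq> c2" using cC by (auto simp: card_2_iff)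
    have Cin: "c1 \<in> ?I" "c2 \<in> ?I" "inner_deg T c1 = 1" "inner_deg T c2 = 1" using c12 by (auto simp: C_def)
    have two: "2 \<le> card (legs_at T c1)" "2 \<le> card (legs_at T c2)" using C2 c12 by auto
    have l5: "card (legs_at T c1) + card (legs_at T c2) + (\<Sum>s\<in>R. card (legs_at T s)) = 5"
      using lsum c12 by simp
    show ?thesis
    proof (cases "\<exists>b\<in>R. legs_at T b \<noteq> {}")
      case False
      then have R0: "dg T s = 2" if "s \<in> R" for s
        using dg_split[OF g, of s] Req[OF that] that IR by auto
      have "(\<Sum>s\<in>R. card (legs_at T s)) = 0" using False by simp
      \<comment> \<open>Distribution 2 + 3: the stretch starts at the end with exactly two legs, as
        \<open>spine_end\<close> requires.\<close>
      then obtain c d where cd: "C = {c, d}" "c \<noteq> d" "card (legs_at T c) = 2"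
      proof -
        have "card (legs_at T c1) = 2 \<or> card (legs_at T c2) = 2"
          using l5 two \<open>(\<Sum>s\<in>R. card (legs_at T s)) = 0\<close> by linarith
        then show thesis using that[of c1 c2] that[of c2 c1] c12 by auto
      qed
      have cI': "c \<in> ?I" "inner_deg T c = 1" "d \<in> ?I" "inner_deg T d = 1" using cd by (auto simp: C_def)
      obtain p m where p: "thread T p m" "p 0 = c" "\<And>i. i \<le> m \<Longrightarrow> p i \<in> ?I" "3 \<le> dg T (p m)"
        "nb T c \<inter> ?I = {p 1}" using spine_thread[OF g cI'(1,2)] by metis
      have m1: "1 \<le> m" using p by (simp add: thread_def)
      obtain v1 v2 where se: "spine_end V E W T p m v1 v2" "legs_at T c = {v1, v2}"
        using spine_endI[OF opt p(1,3,4)] p(2) cd(3) cI'(2) by metis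
      have "p m \<noteq> c" using thread_inj[OF p(1), of m 0] p(2) m1 by simp
      then have pm: "p m = d" using R0[of "p m"] p(4) p(3)[of m] IR cd by auto
      have pe: "{p (m - 1), p m} \<in> T" by (rule thread_last[OF p(1)])
      have dn: "nb T d \<inter> ?I = {p (m - 1)}"
      proof -
        have "p (m - 1) \<in> nb T d \<inter> ?I" using pe pm p(3)[of "m - 1"] by (simp add: insert_commute)
        then show ?thesis using cI'(4) unfolding inner_deg_def by (metis card_1_singletonE singletonD)
      qed
      have "p ` {..m} = ?I"
      proof (rule inner_closed[OF g])
        show "p ` {..m} \<subseteq> ?I" using p(3) by auto
        fix x y assume "x \<in> p ` {..m}" "{x, y} \<in> T" "y \<in> ?I"
        then obtain i where i: "i \<le> m" "x = p i" by auto
        consider "i = 0" | "i = m" | "0 < i" "i < m" using i by linarith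
        then show "y \<in> p ` {..m}"
        proof cases
          case 1
          then have "y \<in> nb T c \<inter> ?I" using i p(2) \<open>{x, y} \<in> T\<close> \<open>y \<in> ?I\<close> by simp
          then show ?thesis using p(5) m1 by auto
        next
          case 2
          then have "y \<in> nb T d \<inter> ?I" using i pm \<open>{x, y} \<in> T\<close> \<open>y \<in> ?I\<close> by simp
          then show ?thesis using dn by auto
        next
          case 3 then show ?thesis using thread_closed[OF p(1)] i \<open>{x, y} \<in> T\<close> by simp
        qed
      qed simp
      moreover have inj: "inj_on p {..m}" using p(1) by (simp add: thread_def)
      ultimately have "(\<Sum>s\<in>?I. weight T s) = (\<Sum>i\<le>m. weight T (p i))" "card ?I = Suc m"
        using sum.reindex[OF inj, of "weight T"] card_image[OF inj] by (auto simp: comp_def)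
      moreover have "(\<Sum>i<m. weight T (p i)) \<le> m + 1" using spine_end.end_weight[OF se(1)] .
      \<comment> \<open>At the end with three legs the spine neighbour takes one of the four places
        of the star, so the weight there is at most three.\<close>
      moreover have "weight T (p m) + card {p (m - 1)} \<le> 4"
      proof (rule weight_star[OF g p(3)[OF order_refl]])
        show "{p (m - 1)} \<subseteq> ?I" using p(3)[of "m - 1"] by simp
        show "{p m, z} \<in> T" if "z \<in> {p (m - 1)}" for z using dn pm that by auto
        show "{y, z} \<notin> E" if "y \<in> {p (m - 1)}" "z \<in> {p (m - 1)}" for y z using that edge_irrefl by simp
        show "{u, z} \<notin> E" if "u \<in> nl T (p m)" "z \<in> {p (m - 1)}" for u z
          using spine_end.far_weight(2)[OF se(1)] that by simp
      qed
      ultimately show ?thesis by (simp add: lessThan_Suc_atMost[symmetric])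
    next
      case True
      then obtain b where b: "b \<in> R" "legs_at T b \<noteq> {}" by blast
      have finl: "finite (legs_at T s)" for s using finite_lv by (simp add: legs_at_def)
      have b1: "1 \<le> card (legs_at T b)" using b(2) finl by (simp add: Suc_le_eq card_gt_0_iff)
      have Rb: "(\<Sum>s\<in>R. card (legs_at T s)) = card (legs_at T b) + (\<Sum>s\<in>R - {b}. card (legs_at T s))"
        using b fin by (simp add: sum.remove)
      \<comment> \<open>Distribution 2 + 1 + 2: a leg away from the ends uses up the only leg that
        the two ends do not require.\<close>
      have lb: "card (legs_at T b) = 1" "(\<Sum>s\<in>R - {b}. card (legs_at T s)) = 0"
        "card (legs_at T c1) = 2" "card (legs_at T c2) = 2"
        using l5 two b1 Rb by linarith+
      have bI': "b \<in> ?I" "inner_deg T b = 2" using b Req by (auto simp: R_def)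
      have db: "dg T b = 3" using dg_split[OF g bI'(1)] lb bI'(2) by simp
      have Ro: "dg T s = 2" if "s \<in> ?I" "s \<noteq> b" "s \<noteq> c1" "s \<noteq> c2" for s
      proof -
        have "s \<in> R - {b}" using that c12 by (auto simp: R_def)
        then have "card (legs_at T s) = 0" using lb(2) fin by simp
        then show ?thesis using dg_split[OF g that(1)] Req \<open>s \<in> R - {b}\<close> by simp
      qed
      have arm: "\<exists>p m v1 v2. spine_end V E W T p m v1 v2 \<and> p 0 = c \<and> p m = b \<and> legs_at T c = {v1, v2} \<and>
          nb T c \<inter> ?I = {p 1}"
        if c: "c \<in> ?I" "inner_deg T c = 1" "card (legs_at T c) = 2"
          and d: "d \<in> ?I" "inner_deg T d = 1" "\<And>s. s \<in> ?I \<Longrightarrow> s \<noteq> b \<Longrightarrow> s \<noteq> c \<Longrightarrow> s \<noteq> d \<Longrightarrow> dg T s = 2" for c d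
      proof -
        obtain p m where p: "thread T p m" "p 0 = c" "\<And>i. i \<le> m \<Longrightarrow> p i \<in> ?I" "3 \<le> dg T (p m)"
          "nb T c \<inter> ?I = {p 1}" using spine_thread[OF g c(1,2)] by metis
        have m1: "1 \<le> m" using p by (simp add: thread_def)
        obtain v1 v2 where se: "spine_end V E W T p m v1 v2" "legs_at T c = {v1, v2}"
          using spine_endI[OF opt p(1,3,4)] p(2) c by metis
        have bc: "b \<noteq> c" "b \<noteq> d" using bI' c d by auto
        have "p m \<noteq> c" using thread_inj[OF p(1), of m 0] p(2) m1 by simp
        then have "p m = b \<or> p m = d" using d(3)[of "p m"] p(4) p(3)[of m] by auto
        moreover have "p m \<noteq> d"
        \<comment> \<open>A thread running from one end to the other would cover the whole spine,
          hence contain \<open>b\<close> as an inner vertex of degree two.\<close>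
        proof
          assume pm: "p m = d"
          have "{p (m - 1), p m} \<in> T" by (rule thread_last[OF p(1)])
          then have "p (m - 1) \<in> nb T d \<inter> ?I" using pm p(3)[of "m - 1"] by (simp add: insert_commute)
          then have dn: "nb T d \<inter> ?I = {p (m - 1)}" using d(2) unfolding inner_deg_def by (metis card_1_singletonE singletonD)
          have "p ` {..m} = ?I"
          proof (rule inner_closed[OF g])
            show "p ` {..m} \<subseteq> ?I" using p(3) by auto
            fix x y assume xy: "x \<in> p ` {..m}" "{x, y} \<in> T" "y \<in> ?I"
            then obtain i where i: "i \<le> m" "x = p i" by auto
            consider "i = 0" | "i = m" | "0 < i" "i < m" using i by linarith
            then show "y \<in> p ` {..m}"
            proof cases
              case 1
              then have "y \<in> nb T c \<inter> ?I" using i p(2) xy by simp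
              then show ?thesis using p(5) m1 by auto
            next
              case 2
              then have "y \<in> nb T d \<inter> ?I" using i pm xy by simp
              then show ?thesis using dn by auto
            next
              case 3 then show ?thesis using thread_closed[OF p(1)] i xy by simp
            qed
          qed simp
          then obtain i where i: "i \<le> m" "b = p i" using bI' by auto
          then have "i \<noteq> 0" "i \<noteq> m" using bc p(2) pm by metis+
          then have "dg T b = 2" using p(1) i by (simp add: thread_def)
          then show False using db by simp
        qed
        ultimately show ?thesis using se p by blast
      qed
      obtain p m v1 v2 where p: "spine_end V E W T p m v1 v2" "p 0 = c1" "p m = b"
        "legs_at T c1 = {v1, v2}" "nb T c1 \<inter> ?I = {p 1}"
        using arm[of c1 c2] Cin lb Ro by blast
      obtain q k w1 w2 where q: "spine_end V E W T q k w1 w2" "q 0 = c2" "q k = b"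
        "legs_at T c2 = {w1, w2}" "nb T c2 \<inter> ?I = {q 1}"
        using arm[of c2 c1] Cin lb Ro by blast
      have tp: "thread T p m" "thread T q k" using spine_end.thr[OF p(1)] spine_end.thr[OF q(1)] by simp_all
      have mk: "1 \<le> m" "1 \<le> k" using tp by (simp_all add: thread_def)
      have inn: "i \<le> m \<Longrightarrow> p i \<in> ?I" "i \<le> k \<Longrightarrow> q i \<in> ?I" for i
        using spine_end.pin[OF p(1)] spine_end.pin[OF q(1)] by simp_all
      have c13: "dg T c1 = 3" "dg T c2 = 3" using dg_split[OF g Cin(1)] dg_split[OF g Cin(2)] Cin lb by simp_all
      \<comment> \<open>The arms from the two ends meet only at \<open>b\<close>: a common earlier
        vertex could be traced back along both arms to an end or to \<open>b\<close>.\<close>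
      have disj: "i < m \<Longrightarrow> j < k \<Longrightarrow> p i \<noteq> q j" for i j
      proof (induction i arbitrary: j)
        case 0
        then show ?case using p(2) q(2) c12(2) c13 tp(2) by (cases "j = 0") (auto simp: thread_def)
      next
        case (Suc i)
        show ?case
        proof
          assume e: "p (Suc i) = q j"
          have "dg T (p (Suc i)) = 2" using tp(1) Suc.prems by (simp add: thread_def)
          then obtain l where l: "j = Suc l" using e q(2) c13 by (cases j) auto
          have "{q j, p i} \<in> T" using tp(1) Suc.prems e by (simp add: thread_def insert_commute) (metis Suc_lessD insert_commute)
          then have "p i \<in> nb T (q j)" by simp
          then have "p i = q l \<or> p i = q (Suc j)" using thread_nb[OF tp(2), of l] Suc.prems l by auto
          moreover have "p i \<noteq> q l" using Suc.IH[of l] Suc.prems l by simp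
          moreover have "p i \<noteq> q (Suc j)"
          proof (cases "Suc j < k")
            case True then show ?thesis using Suc.IH Suc.prems by simp
          next
            case False
            then have "q (Suc j) = p m" using Suc.prems p(3) q(3) by (metis Suc_lessI)
            then show ?thesis using thread_inj[OF tp(1), of i m] Suc.prems by simp
          qed
          ultimately show False by blast
        qed
      qed
      have pe: "{p (m - 1), b} \<in> T" "{q (k - 1), b} \<in> T"
        using thread_last[OF tp(1)] thread_last[OF tp(2)] p(3) q(3) by simp_all
      have bn: "nb T b \<inter> ?I = {p (m - 1), q (k - 1)}"
      proof (rule card2_eq)
        show "card (nb T b \<inter> ?I) = 2" using bI' by (simp add: inner_deg_def)
        show "p (m - 1) \<in> nb T b \<inter> ?I" "q (k - 1) \<in> nb T b \<inter> ?I"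
          using pe inn(1)[of "m - 1"] inn(2)[of "k - 1"] by (simp_all add: insert_commute)
        show "p (m - 1) \<noteq> q (k - 1)" using disj[of "m - 1" "k - 1"] mk by simp
      qed
      have cover: "p ` {..m} \<union> q ` {..k} = ?I"
      proof (rule inner_closed[OF g])
        show "p ` {..m} \<union> q ` {..k} \<subseteq> ?I" using inn by auto
        fix x y assume x: "x \<in> p ` {..m} \<union> q ` {..k}" and xy: "{x, y} \<in> T" "y \<in> ?I"
        show "y \<in> p ` {..m} \<union> q ` {..k}"
        proof (cases "x = b \<or> x = c1 \<or> x = c2")
          case True
          then have "y \<in> {p (m - 1), q (k - 1), p 1, q 1}" using xy bn p(5) q(5) by auto
          then show ?thesis using mk by auto
        next
          case False
          consider i where "i \<le> m" "x = p i" | i where "i \<le> k" "x = q i" using x by blast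
          then show ?thesis
          proof cases
            case 1
            then have "0 < i" "i < m" using False p(2,3) by (metis gr0I, metis le_neq_implies_less)
            then show ?thesis using thread_closed[OF tp(1)] 1 xy by blast
          next
            case 2
            then have "0 < i" "i < k" using False q(2,3) by (metis gr0I, metis le_neq_implies_less)
            then show ?thesis using thread_closed[OF tp(2)] 2 xy by blast
          qed
        qed
      qed simp
      let ?P = "p ` {..<m}" and ?Q = "q ` {..<k}"
      have inj: "inj_on p {..<m}" "inj_on q {..<k}"
        using tp by (auto simp: thread_def inj_on_def)
      have "p i \<noteq> b" if "i < m" for i using thread_inj[OF tp(1), of i m] p(3) that by simp
      moreover have "q i \<noteq> b" if "i < k" for i using thread_inj[OF tp(2), of i k] q(3) that by simp
      ultimately have bnot: "b \<notin> ?P" "b \<notin> ?Q" by blast+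
      have PQ: "?P \<inter> ?Q = {}" using disj by auto
      have "p ` {..m} = insert b ?P" "q ` {..k} = insert b ?Q"
        using p(3) q(3) by (auto simp: lessThan_Suc_atMost[symmetric] lessThan_Suc)
      then have I: "?I = insert b (?P \<union> ?Q)" using cover by auto
      have sums: "(\<Sum>s\<in>?I. h s) = h b + (\<Sum>i<m. h (p i)) + (\<Sum>i<k. h (q i))" for h :: "'a \<Rightarrow> nat"
      proof -
        have "(\<Sum>s\<in>?I. h s) = h b + (\<Sum>s\<in>?P \<union> ?Q. h s)" unfolding I using bnot by simp
        also have "(\<Sum>s\<in>?P \<union> ?Q. h s) = (\<Sum>s\<in>?P. h s) + (\<Sum>s\<in>?Q. h s)"
          using PQ by (intro sum.union_disjoint) auto
        finally show ?thesis using sum.reindex[OF inj(1), of h] sum.reindex[OF inj(2), of h] by (simp add: comp_def)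
      qed
      \<comment> \<open>The four leaves at the ends are not adjacent to \<open>b\<close> by
        \<open>far_weight\<close>, so its own single leg contributes at most one leaf neighbour and
        one exceptional leg.\<close>
      have "weight T b \<le> 2"
      proof -
        obtain v where v: "legs_at T b = {v}" using lb(1) by (rule card_1_singletonE)
        have cls: "w \<in> legs_at T b \<or> w \<in> legs_at T c1 \<or> w \<in> legs_at T c2" if w: "w \<in> lv T" for w
        proof -
          let ?s = "base T w"
          have "w \<in> legs_at T ?s" using w by (simp add: legs_at_def)
          then have "3 \<le> dg T ?s" using legs_at_dg[OF g] by blast
          then have "?s = b \<or> ?s = c1 \<or> ?s = c2" using Ro[OF base_inner[OF g w]] by auto
          then show ?thesis using w by (auto simp: legs_at_def)
        qed
        have "nl T b \<inter> {v1, v2} = {}" "nl T b \<inter> {w1, w2} = {}"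
          using spine_end.far_weight(1)[OF p(1)] spine_end.far_weight(1)[OF q(1)] p(3) q(3) by auto
        then have "nl T b \<subseteq> {v}" using cls v p(4) q(4) unfolding nl_def by blast
        then have "card (nl T b) \<le> card {v}" by (intro card_mono) auto
        moreover have "full_at T b \<subseteq> {v}" using v by (auto simp: full_at_def legs_at_def)
        then have "card (full_at T b) \<le> card {v}" by (intro card_mono) auto
        ultimately show ?thesis by (simp add: weight_def)
      qed
      moreover have "(\<Sum>i<m. weight T (p i)) \<le> m + 1" "(\<Sum>i<k. weight T (q i)) \<le> k + 1"
        using spine_end.end_weight[OF p(1)] spine_end.end_weight[OF q(1)] .
      moreover have "card ?I = 1 + m + k" using sums[of "\<lambda>_. 1"] by simp
      ultimately show ?thesis using sums[of "weight T"] by simp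
    qed
  qed
qed

text \<open>The constant is 5 - 3: one edge saved on each of the five legs against the surplus three
  of \<open>weight_sum\<close>. Counting exceptional legs by branch vertex cancels them against the
  second part of \<open>weight\<close>.\<close>

lemma nl_sum:
  assumes opt: "optimal T"
  shows "(\<Sum>x\<in>W. card (nl T x)) + 2 \<le> card W"
proof -
  have g: "good T" using opt by (simp add: optimal_def best_def)
  have c5: "card (lv T) = 5" using g by (simp add: good_def)
  let ?c = "\<lambda>u. leg_count T (legp T u) (legm T u)" and ?f = "\<lambda>u. if full_leg T u then 1 else 0 :: nat"
  have "?c u + 1 \<le> legm T u + ?f u" if "u \<in> lv T" for u
    using leg_count_bound[OF g leg_legp(1)[OF g that]] leg_dg(3)[OF leg_legp(1)[OF g that]]
    by (auto simp: full_leg_def)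
  then have "(\<Sum>u\<in>lv T. ?c u + 1) \<le> (\<Sum>u\<in>lv T. legm T u + ?f u)" by (rule sum_mono)
  moreover have "(\<Sum>u\<in>lv T. ?c u + 1) = (\<Sum>u\<in>lv T. ?c u) + 5"
    unfolding sum.distrib using c5 by simp
  moreover have "(\<Sum>u\<in>lv T. legm T u + ?f u) = card (leg_region T) + card {u \<in> lv T. full_leg T u}"
    unfolding sum.distrib card_leg_region[OF g] using finite_lv by (simp add: sum.If_cases Int_def)
  ultimately have a: "(\<Sum>u\<in>lv T. ?c u) + 5 \<le> card (leg_region T) + card {u \<in> lv T. full_leg T u}"
    by simp
  have b: "card {u \<in> lv T. full_leg T u} = (\<Sum>s\<in>inner T. card (full_at T s))"
  proof -
    have "{u \<in> {u \<in> lv T. full_leg T u}. base T u = s} = full_at T s" for s by (auto simp: full_at_def)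
    then show ?thesis
      using card_fibres[of "{u \<in> lv T. full_leg T u}" "inner T" "base T"] finite_lv finite_inner base_inner[OF g]
      by (auto simp: image_subset_iff)
  qed
  have c: "(\<Sum>s\<in>inner T. weight T s) = (\<Sum>s\<in>inner T. card (nl T s)) + (\<Sum>s\<in>inner T. card (full_at T s))"
    by (simp add: weight_def sum.distrib)
  have "(\<Sum>x\<in>W. card (nl T x)) = (\<Sum>u\<in>lv T. leg_count T (legp T u) (legm T u)) + (\<Sum>s\<in>inner T. card (nl T s))"
    using sum_W[OF g, of "\<lambda>x. card (nl T x)"] by (simp add: leg_count_def)
  then show ?thesis using a b c weight_sum[OF opt] card_W[OF g] by linarith
qed

lemma optimal_exists:
  assumes "good T0" obtains T where "optimal T"
proof -
  have bnd: "card (leg_region T) \<le> card W" if "good T" for T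
    using region_W[OF that] finW by (simp add: card_mono)
  obtain T1 where T1: "best T1"
  proof -
    let ?P = "\<lambda>k. \<exists>T. good T \<and> card (leg_region T) = k"
    have P: "?P (card (leg_region T0))" using assms by blast
    have B: "\<And>k. ?P k \<Longrightarrow> k \<le> card W" using bnd by blast
    obtain T where T: "good T" "card (leg_region T) = (GREATEST k. ?P k)"
      using GreatestI_nat[of ?P, OF P B] by blast
    have "card (leg_region T') \<le> (GREATEST k. ?P k)" if "good T'" for T'
      using Greatest_le_nat[of ?P "card (leg_region T')", OF _ B] that by blast
    then have "best T" using T by (simp add: best_def)
    then show thesis by (rule that)
  qed
  have "optimal (arg_min inner_adj best)"
    unfolding optimal_def using arg_min_nat_lemma[of best T1 inner_adj] T1 by blast
  then show thesis by (rule that)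
qed

end

section \<open>The theorem\<close>

lemma tree_on_connected:
  assumes t: "tree_on E V T" shows "connected_graph V T"
  unfolding connected_graph_def
proof (intro conjI ballI)
  have c: "cut_connected V T" using t by (simp add: tree_on_def)
  then show "V \<noteq> {}" by (simp add: cut_connected_def)
  fix u v assume u: "u \<in> V" and v: "v \<in> V"
  let ?R = "{w \<in> V. \<exists>xs. is_walk V T xs \<and> hd xs = u \<and> last xs = w}"
  have "is_walk V T [u]" using u by (simp add: is_walk_def)
  then have uR: "u \<in> ?R" using u by (intro CollectI conjI exI[of _ "[u]"]) auto
  have "?R = V"
  proof (rule ccontr)
    assume "?R \<noteq> V"
    then obtain a b where ab: "a \<in> ?R" "b \<in> V - ?R" "{a, b} \<in> T"
      using cut_connectedD[OF c, of ?R] uR by blast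
    then obtain xs where xs: "is_walk V T xs" "hd xs = u" "last xs = a" by blast
    have ne: "xs \<noteq> []" using xs by (simp add: is_walk_def)
    have "adj T ((xs @ [b]) ! i) ((xs @ [b]) ! Suc i)" if "Suc i < length (xs @ [b])" for i
    proof (cases "Suc i < length xs")
      case True then show ?thesis using xs(1) by (simp add: is_walk_def nth_append)
    next
      case False
      then have "i = length xs - 1" "Suc i = length xs" using that by auto
      then show ?thesis using ab(3) xs(3) ne by (simp add: nth_append adj_def last_conv_nth)
    qed
    then have "is_walk V T (xs @ [b])" using xs(1) ab(2) by (simp add: is_walk_def)
    then have "b \<in> ?R" using ab(2) xs(2) ne by (intro CollectI conjI exI[of _ "xs @ [b]"]) auto
    then show False using ab(2) by blast
  qed
  then show "\<exists>xs. is_walk V T xs \<and> hd xs = u \<and> last xs = v" using v by blast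
qed

text \<open>The closing edge of a cycle would be the only edge across its cut, but the rest of the
  cycle must cross this cut as well.\<close>

lemma tree_on_acyclic:
  assumes t: "tree_on E V T" shows "\<not> has_cycle V T"
proof
  assume "has_cycle V T"
  then obtain xs where xs: "is_walk V T xs" "3 \<le> length xs" "distinct xs" "{last xs, hd xs} \<in> T"
    by (auto simp: has_cycle_def adj_def)
  let ?n = "length xs"
  have ne: "xs \<noteq> []" using xs by auto
  have hl: "hd xs = xs ! 0" "last xs = xs ! (?n - 1)" using ne by (simp_all add: hd_conv_nth last_conv_nth)
  obtain A where A: "cut V T A (last xs) (hd xs)" using tree_on_cut[OF t xs(4)] .
  have "i < ?n - 1 \<Longrightarrow> xs ! i \<in> V - A" for i
  proof (induction i)
    case 0 then show ?case using A hl by (simp add: cut_def)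
  next
    case (Suc i)
    have e: "{xs ! Suc i, xs ! i} \<in> T" using xs(1) Suc.prems by (simp add: is_walk_def adj_def insert_commute)
    have "xs ! Suc i \<in> V" using xs(1) Suc.prems by (auto simp: is_walk_def)
    moreover have "xs ! Suc i \<noteq> last xs" using hl xs(3) Suc.prems by (simp add: nth_eq_iff_index_eq)
    ultimately show ?case using A e Suc unfolding cut_def by auto
  qed
  from this[of "?n - 2"] have "xs ! (?n - 2) \<in> V - A" using xs(2) by simp
  moreover have "{xs ! (?n - 1), xs ! (?n - 2)} \<in> T"
  proof -
    have "Suc (?n - 2) = ?n - 1" using xs(2) by simp
    moreover have "adj T (xs ! (?n - 2)) (xs ! Suc (?n - 2))" using xs(1,2) by (simp add: is_walk_def)
    ultimately show ?thesis by (simp add: adj_def insert_commute)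
  qed
  moreover have "xs ! (?n - 1) \<in> A" using A hl by (simp add: cut_def)
  ultimately have "xs ! (?n - 2) = xs ! 0" using A hl unfolding cut_def by metis
  moreover have "?n - 2 \<noteq> 0" using xs(2) by simp
  ultimately show False using xs(2,3) ne by (auto simp: nth_eq_iff_index_eq)
qed

lemma tree_on_spanning: "tree_on E V T \<Longrightarrow> spanning_tree V E T"
  using tree_on_connected[of E V T] tree_on_acyclic[of E V T]
  by (auto simp: spanning_tree_def is_tree_def tree_on_def)

section \<open>Growing a tree by one vertex\<close>

lemma connected_crossing:
  assumes c: "connected_graph V E" and W: "W \<subseteq> V" "W \<noteq> {}" "W \<noteq> V"
  obtains y z where "y \<in> W" "z \<in> V - W" "{y, z} \<in> E"
proof -
  obtain u v where uv: "u \<in> W" "v \<in> V - W" using W by blast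
  then obtain xs where xs: "is_walk V E xs" "hd xs = u" "last xs = v"
    using c W unfolding connected_graph_def by blast
  have ne: "xs \<noteq> []" using xs by (simp add: is_walk_def)
  have "\<exists>i. Suc i < length xs \<and> xs ! i \<in> W \<and> xs ! Suc i \<notin> W"
  proof (rule ccontr)
    assume no: "\<not> ?thesis"
    have "i < length xs \<Longrightarrow> xs ! i \<in> W" for i
      by (induction i) (use no uv xs ne in \<open>auto simp: hd_conv_nth\<close>)
    from this[of "length xs - 1"] show False using uv xs(3) ne by (simp add: last_conv_nth)
  qed
  then obtain i where i: "Suc i < length xs" "xs ! i \<in> W" "xs ! Suc i \<notin> W" by blast
  have "xs ! Suc i \<in> V" "{xs ! i, xs ! Suc i} \<in> E"
    using xs(1) i by (auto simp: is_walk_def adj_def)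
  then show thesis using that i by blast
qed

lemma tree_on_singleton: "tree_on E {v} {}" "leaf_set {v} {} = {}"
  by (auto simp: tree_on_def simple_graph_def cut_connected_def leaf_set_def nb_def)

text \<open>The new leaf \<open>z\<close> replaces \<open>y\<close> if \<open>y\<close> was a leaf.
  The case of degree zero is the single-vertex tree, where \<open>y\<close> only now becomes a
  leaf.\<close>

lemma tree_on_extend:
  assumes t: "tree_on E W T" and y: "y \<in> W" and z: "z \<notin> W" and e: "{y, z} \<in> E"
  shows "tree_on E (insert z W) (insert {y, z} T)"
    and "leaf_set (insert z W) (insert {y, z} T) \<subseteq> insert z (if dg T y = 0 then {y} else leaf_set W T - {y})"
proof -
  have s: "simple_graph W T" and c: "cut_connected W T" and n: "card T + 1 = card W" and TE: "T \<subseteq> E"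
    using t by (auto simp: tree_on_def)
  have fin: "finite W" "finite T" using simple_graph_finite[OF s] .
  have yz: "y \<noteq> z" using y z by auto
  have zT: "{x, z} \<notin> T" "{z, x} \<notin> T" for x using simple_graph_edge[OF s] z by blast+
  let ?W = "insert z W" and ?T = "insert {y, z} T"
  have s': "simple_graph ?W ?T"
    unfolding simple_graph_def
  proof (intro conjI ballI)
    show "finite ?W" using fin by simp
    fix e assume "e \<in> ?T"
    then show "\<exists>u v. e = {u, v} \<and> u \<noteq> v \<and> u \<in> ?W \<and> v \<in> ?W"
      using s y yz unfolding simple_graph_def by blast
  qed
  have "cut_connected ?W ?T"
    unfolding cut_connected_def
  proof (intro conjI allI impI)
    fix A assume A: "A \<subseteq> ?W" "A \<noteq> {}" "A \<noteq> ?W"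
    show "\<exists>a\<in>A. \<exists>b\<in>?W - A. {a, b} \<in> ?T"
    proof (cases "A \<inter> W = {} \<or> W \<subseteq> A")
      case True
      then have "A = {z} \<or> A = W" using A z by auto
      then show ?thesis
      proof
        assume "A = {z}"
        then show ?thesis using y yz by (intro bexI[of _ z] bexI[of _ y]) (auto simp: insert_commute)
      next
        assume "A = W"
        then show ?thesis using y z by (intro bexI[of _ y] bexI[of _ z]) auto
      qed
    next
      case False
      then obtain a b where "a \<in> A \<inter> W" "b \<in> W - A \<inter> W" "{a, b} \<in> T"
        using cut_connectedD[OF c, of "A \<inter> W"] by blast
      then show ?thesis by blast
    qed
  qed simp
  moreover have "card ?T + 1 = card ?W" using n fin z zT by simp
  ultimately show "tree_on E ?W ?T" using s' TE e by (simp add: tree_on_def)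
  have nbx: "nb ?T x = nb T x" if "x \<noteq> y" "x \<noteq> z" for x using that by (auto simp: doubleton_eq_iff)
  have "nb ?T y = insert z (nb T y)" using yz by (auto simp: doubleton_eq_iff)
  moreover have "z \<notin> nb T y" using zT by simp
  ultimately have dy: "dg ?T y = Suc (dg T y)" using finite_nb[OF s] by simp
  show "leaf_set ?W ?T \<subseteq> insert z (if dg T y = 0 then {y} else leaf_set W T - {y})"
  proof
    fix x assume x: "x \<in> leaf_set ?W ?T"
    consider "x = z" | "x = y" | "x \<noteq> y" "x \<noteq> z" by blast
    then show "x \<in> insert z (if dg T y = 0 then {y} else leaf_set W T - {y})"
    proof cases
      case 2
      then have "dg T y = 0" using x dy by (simp add: leaf_set_def)
      then show ?thesis using 2 by simp
    next
      case 3
      then have xl: "x \<in> leaf_set W T" using x nbx by (simp add: leaf_set_def)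
      then have "x \<in> W" "y \<in> W" using y by (auto simp: leaf_set_def)
      then have "card {x, y} \<le> card W" using fin by (intro card_mono) auto
      then have "1 \<le> dg T y" using tree_dg_pos[OF t _ y] 3 by simp
      then show ?thesis using xl 3 by simp
    qed simp
  qed
qed

theorem theorem1p9:
  fixes V :: "'a set" and E :: "'a set set"
  assumes "simple_graph V E"
    and "connected_graph V E"
    and "K1r_free 5 V E"
    and "sigma_ge 5 V E (card V - 1)"
  shows "\<exists>T. spanning_tree V E T \<and> card (leaves V T) \<le> 4"
proof (rule ccontr)
  assume none: "\<not> ?thesis"
  have finV: "finite V" using simple_graph_finite[OF assms(1)] by simp
  have span: "5 \<le> card (leaf_set V T)" if t: "tree_on E V T" for T
  proof -
    have "simple_graph V T" using t by (simp add: tree_on_def)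
    then show ?thesis using none tree_on_spanning[OF t] leaf_set_eq[of V T] by fastforce
  qed
  \<comment> \<open>The bound is five, not four, so that a five-leaf tree can still be enlarged at
    one of its leaves; single vertices, with no leaf at all, show that \<open>P\<close> is
    satisfiable.\<close>
  define P where "P W T \<longleftrightarrow> W \<subseteq> V \<and> tree_on E W T \<and> card (leaf_set W T) \<le> 5" for W T
  obtain W T0 where W: "P W T0" and max: "\<And>W' T'. P W' T' \<Longrightarrow> card W' \<le> card W"
  proof -
    let ?Q = "\<lambda>k. \<exists>W T. P W T \<and> card W = k"
    obtain v where "v \<in> V" using assms(2) by (auto simp: connected_graph_def)
    then have "?Q 1" using tree_on_singleton(1)[of E v] tree_on_singleton(2)[of v] by (intro exI[of _ "{v}"] exI[of _ "{}"]) (simp add: P_def)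
    moreover have B: "\<And>k. ?Q k \<Longrightarrow> k \<le> card V" using finV by (auto simp: P_def intro: card_mono)
    ultimately have "?Q (GREATEST k. ?Q k)" by (rule GreatestI_nat)
    then obtain W T0 where "P W T0" "card W = (GREATEST k. ?Q k)" by blast
    moreover have "card W' \<le> (GREATEST k. ?Q k)" if "P W' T'" for W' T'
      using Greatest_le_nat[of ?Q "card W'", OF _ B] that by blast
    ultimately show thesis using that by metis
  qed
  have WV: "W \<subseteq> V" using W by (simp add: P_def)
  have finW: "finite W" using WV finV finite_subset by blast
  \<comment> \<open>Attaching \<open>z\<close> adds one leaf at most, and none if \<open>y\<close>
    is a leaf itself; either way at most five remain on a larger vertex set.\<close>
  have noext: False if t: "tree_on E W T" and yz: "y \<in> W" "z \<in> V - W" "{y, z} \<in> E"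
    and l: "card (leaf_set W T) \<le> 4 \<or> card (leaf_set W T) \<le> 5 \<and> y \<in> leaf_set W T" for T y z
  proof -
    have zW: "z \<notin> W" using yz by simp
    note ex = tree_on_extend[OF t yz(1) zW yz(3)]
    have fl: "finite (leaf_set W T)" using finW by (simp add: leaf_set_def)
    let ?S = "if dg T y = 0 then {y} else leaf_set W T - {y}"
    have "card (leaf_set W T - {y}) \<le> 4"
    proof (cases "y \<in> leaf_set W T")
      case True then show ?thesis using l fl by (auto simp: card_Diff_singleton)
    next
      case False then show ?thesis using l by simp
    qed
    then have "card ?S \<le> 4" by simp
    moreover have "finite ?S" using fl by simp
    ultimately have "card (insert z ?S) \<le> 5" by (simp add: card_insert_if)
    then have "card (leaf_set (insert z W) (insert {y, z} T)) \<le> 5"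
      using card_mono[OF _ ex(2)] fl by (meson \<open>finite ?S\<close> finite_insert order_trans)
    then have "P (insert z W) (insert {y, z} T)" using ex(1) yz WV by (simp add: P_def)
    then show False using max[of "insert z W" "insert {y, z} T"] zW finW by simp
  qed
  have five: "5 \<le> card (leaf_set W T)" if t: "tree_on E W T" for T
  proof (cases "W = V")
    case True then show ?thesis using span t by simp
  next
    case False
    have "W \<noteq> {}" using t by (auto simp: tree_on_def cut_connected_def)
    then obtain y z where "y \<in> W" "z \<in> V - W" "{y, z} \<in> E"
      using connected_crossing[OF assms(2) WV _ False] by blast
    then have "\<not> card (leaf_set W T) \<le> 4" using noext[OF t] by blast
    then show ?thesis by simp
  qed
  interpret tight V E W
    by unfold_locales (use assms WV five in auto)
  have "good T0" using W five[of T0] by (simp add: P_def good_def)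
  then obtain T where opt: "optimal T" by (rule optimal_exists)
  have g: "good T" using opt by (simp add: optimal_def best_def)
  have c5: "card (lv T) = 5" using g by (simp add: good_def)
  have nbW: "x \<in> W" if "u \<in> lv T" "{u, x} \<in> E" for u x
  proof (rule ccontr)
    assume "x \<notin> W"
    moreover have "x \<in> V" using simple_graph_edge(2)[OF assms(1) that(2)] .
    ultimately show False using noext[OF good_tree[OF g], of u x] that c5 lv_subset by auto
  qed
  have "independent E (lv T)" using leaves_nonadj[OF g] by (simp add: independent_def adj_def)
  moreover have "lv T \<subseteq> V" using lv_subset WV by blast
  ultimately have "card V - 1 \<le> (\<Sum>u\<in>lv T. deg V E u)"
    using assms(4) c5 by (simp add: sigma_ge_def)
  also have "(\<Sum>u\<in>lv T. deg V E u) = (\<Sum>u\<in>lv T. \<Sum>x\<in>W. if {u, x} \<in> E then 1 else 0)"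
  proof (rule sum.cong[OF refl])
    fix u assume u: "u \<in> lv T"
    have "{x \<in> V. adj E x u} = {x \<in> W. {u, x} \<in> E}"
      using nbW[OF u] WV edge_sym unfolding adj_def by blast
    then show "deg V E u = (\<Sum>x\<in>W. if {u, x} \<in> E then 1 else 0)"
      using finW by (simp add: deg_def sum.If_cases Int_def)
  qed
  also have "\<dots> = (\<Sum>x\<in>W. \<Sum>u\<in>lv T. if {u, x} \<in> E then 1 else 0)" by (rule sum.swap)
  also have "\<dots> = (\<Sum>x\<in>W. card (nl T x))"
    using finite_lv by (simp add: nl_def sum.If_cases Int_def)
  finally have "card V - 1 \<le> (\<Sum>x\<in>W. card (nl T x))" .
  moreover have "(\<Sum>x\<in>W. card (nl T x)) + 2 \<le> card W" using nl_sum[OF opt] .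
  moreover have "card W \<le> card V" using WV finV by (rule card_mono[rotated])
  ultimately show False by linarith
qed

end
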